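(* Let $B$ be an $S_{\mathbf q}(V)$-bimodule algebra. Then the Hochschild cohomology algebra $\operatorname{HH}^{\bullet}(S_{\mathbf q}(V),B)$ is a subquotient algebra of the tensor product $B\otimes \bigwedge_{\mathbf q^{-1}}(V^* )$, that is, the cup product on $\operatorname{HH}^{\bullet}(S_{\mathbf q}(V),B)$ descends from the product on $B\otimes\bigwedge_{\mathbf q^{-1}}(V^* )$.
   Context: Let $\Bbbk$ be a field of characteristic $0$; all tensor products and exterior powers are over $\Bbbk$. Let $N$ be a positive integer and, for $1\le i,j\le N$, let $q_{i,j}\in\Bbbk$ be nonzero scalars with $q_{i,i}=1$ and $q_{j,i}=q_{i,j}^{-1}$; write $\mathbf q=(q_{i,j})$ and $\mathbf q^{-1}=(q_{i,j}^{-1})$. Let $V$ be a vector space with basis $x_1,\dots,x_N$, and let $x_1^*,\dots,x_N^*$ be the dual basis of the dual space $V^*$. The quantum symmetric algebra is $A=S_{\mathbf q}(V)=\Bbbk\langle x_1,\dots,x_N\mid x_ix_j=q_{i,j}x_jx_i \text{ for all } 1\le i,j\le N\rangle$. The quantum exterior algebra is $\bigwedge_{\mathbf q}(V)=T(V)/(x_ix_j+q_{i,j}x_jx_i\mid 1\le i,j\le N)$, where $T(V)$ is the tensor algebra; thus $\bigwedge_{\mathbf q^{-1}}(V^* )=T(V^* )/(x_i^*x_j^*+q_{i,j}^{-1}x_j^*x_i^*\mid 1\le i,j\le N)$. The product on $B\otimes\bigwedge_{\mathbf q^{-1}}(V^* )$ is that of the tensor product of the two algebras: $(b\otimes w)(b'\otimes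 w')=bb'\otimes ww'$. An $A$-bimodule algebra $B$ is an algebra that is also an $A$-bimodule, the two structures being compatible in the sense that $a(bb')=(ab)b'$ and $(bb')a=b(b'a)$ for all $a\in A$, $b,b'\in B$. Hochschild cohomology: $\operatorname{HH}^{\bullet}(A,B)=\operatorname{Ext}^{\bullet}_{A^e}(A,B)$ with $A^e=A\otimes A^{\mathrm{op}}$, where $A^{\mathrm{op}}$ is $A$ with the opposite multiplication. Using the bar resolution of $A$ (degree $m$ term $A^{\otimes(m+2)}$, differential $a_0\otimes\cdots\otimes a_{m+1}\mapsto\sum_{i=0}^m(-1)^ia_0\otimes\cdots\otimes a_ia_{i+1}\otimes\cdots\otimes a_{m+1}$), the cup product is defined at the cochain level as follows: for $f\in\operatorname{Hom}_{A^e}(A^{\otimes(m+2)},B)$ and $f'\in\operatorname{Hom}_{A^e}(A^{\otimes(n+2)},B)$, the cochain $f\smile f'\in\operatorname{Hom}_{A^e}(A^{\otimes(m+n+2)},B)$ is determined by $$(f\smile f')(a_0\otimes\cdots\otimes a_{m+n+1})=f(a_0\otimes a_1\otimes\cdots\otimes a_m\otimes1)\,f'(1\otimes a_{m+1}\otimes\cdots\otimes a_{m+n}\otimes a_{m+n+1}).$$ How the Hochschild cohomology is a subquotient: for $\beta\in\{0,1\}^N$ put $|\beta|=\sum_i\beta_i$; if $|\beta|=m$ and $j_1<\dots<j_m$ are the indices with $\beta_{j_k}=1$, put $x^{\wedge\beta}=x_{j_1}\wedge\cdots\wedge x_{j_m}$ and $(x^* )^{\wedge\beta}=x_{j_1}^*\wedge\cdots\wedge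 x_{j_m}^*$. The elements $(x^* )^{\wedge\beta}$ with $|\beta|=m$ give a basis both of $\bigwedge^m(V^* )$ and of the degree $m$ part of $\bigwedge_{\mathbf q^{-1}}(V^* )$, and these spaces are identified through these bases. There is a free $A^e$-resolution of $A$ with degree $m$ term $A^e\otimes\bigwedge^m(V)$ and differential, for $j_1<\dots<j_m$, $$d_m(1^{\otimes 2}\otimes x_{j_1}\wedge\cdots\wedge x_{j_m})=\sum_{i=1}^m(-1)^{i+1}\Big[\Big(\prod_{s=1}^iq_{j_s,j_i}\Big)x_{j_i}\otimes1-\Big(\prod_{s=i}^mq_{j_i,j_s}\Big)1\otimes x_{j_i}\Big]\otimes x_{j_1}\wedge\cdots\wedge\hat x_{j_i}\wedge\cdots\wedge x_{j_m}.$$ Applying $\operatorname{Hom}_{A^e}(-,B)$ and identifying $\operatorname{Hom}_{A^e}(A^e\otimes\bigwedge^m(V),B)$ with $B\otimes\bigwedge^m(V^* )$ via $F\mapsto\sum_{|\beta|=m}F(1^{\otimes2}\otimes x^{\wedge\beta})\otimes(x^* )^{\wedge\beta}$ gives a complex with degree $m$ term $B\otimes\bigwedge^m(V^* )$ whose cohomology is $\operatorname{HH}^{\bullet}(A,B)$. Its differentials $d_m^*:B\otimes\bigwedge^{m-1}(V^* )\to B\otimes\bigwedge^m(V^* )$ are, for $b\in B$ and $|\beta|=m-1$, with $[i]$ the $i$-th unit vector, $$d_m^*(b\otimes(x^* )^{\wedge\beta})=\sum_{i=1}^N\delta_{\beta_i,0}(-1)^{\sum_{s=1}^i\beta_s}\Big[\Big(\prod_{s=1}^iq_{s,i}^{\beta_s}\Big)x_ib-\Big(\prod_{s=i}^Nq_{i,s}^{\beta_s}\Big)bx_i\Big]\otimes(x^*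 )^{\wedge(\beta+[i])}.$$ Thus the Hochschild cohomology is a vector space subquotient of $B\otimes\bigwedge_{\mathbf q^{-1}}(V^* )$, and the theorem says that its cup product is determined by the product of that tensor product algebra.
   Formalization: The algebra claims are proved when the cup product is well defined on cohomology, shown to hold if also (ba)b' = b(ab'); without this it can fail (A = k[x], B = 2×2 matrices, xb = E11 b, bx = b E22). The vector space subquotient is proved for every bimodule algebra. *)

theory Defs
  imports "HOL-Library.Poly_Mapping" "HOL-Algebra.QuotRing" "HOL-Algebra.Subrings"
begin

subsection \<open>Algebras over a field\<close>

text \<open>The multiplication is an explicit operation, not the one of a type class, because the
  multiplication of the quantum symmetric algebra depends on the parameters \<open>q\<close>.\<close>

record ('k, 'a) alg =
  smul :: "'k \<Rightarrow> 'a \<Rightarrow> 'a"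
  mul :: "'a \<Rightarrow> 'a \<Rightarrow> 'a"
  unity :: 'a

locale unital_algebra =
  fixes A :: "('k::field, 'a::ab_group_add) alg"
  assumes vector_space: "vector_space (smul A)"
    and mul_assoc: "mul A (mul A a b) c = mul A a (mul A b c)"
    and unity_mul: "mul A (unity A) a = a"
    and mul_unity: "mul A a (unity A) = a"
    and mul_add_left: "mul A (a + b) c = mul A a c + mul A b c"
    and mul_add_right: "mul A a (b + c) = mul A a b + mul A a c"
    and mul_smul_left: "mul A (smul A t a) b = smul A t (mul A a b)"
    and mul_smul_right: "mul A a (smul A t b) = smul A t (mul A a b)"

text \<open>\<open>l a b\<close> is \<open>ab\<close> and \<open>r b a\<close> is \<open>ba\<close>, for \<open>a\<close> in \<open>A\<close> and \<open>b\<close> in \<open>B\<close>.\<close>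

locale bimodule_algebra =
  A: unital_algebra A + B: unital_algebra B
  for A :: "('k::field, 'a::ab_group_add) alg" and B :: "('k, 'b::ab_group_add) alg" +
  fixes l :: "'a \<Rightarrow> 'b \<Rightarrow> 'b" and r :: "'b \<Rightarrow> 'a \<Rightarrow> 'b"
  assumes l_add_left: "l (a + a') b = l a b + l a' b"
    and l_add_right: "l a (b + b') = l a b + l a b'"
    and l_smul_left: "l (smul A t a) b = smul B t (l a b)"
    and l_smul_right: "l a (smul B t b) = smul B t (l a b)"
    and l_mul: "l (mul A a a') b = l a (l a' b)"
    and l_unity: "l (unity A) b = b"
    and r_add_left: "r (b + b') a = r b a + r b' a"
    and r_add_right: "r b (a + a') = r b a + r b a'"
    and r_smul_left: "r (smul B t b) a = smul B t (r b a)"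
    and r_smul_right: "r b (smul A t a) = smul B t (r b a)"
    and r_mul: "r b (mul A a a') = r (r b a) a'"
    and r_unity: "r b (unity A) = b"
    and l_r: "r (l a b) a' = l a (r b a')"
    and compat_left: "l a (mul B b b') = mul B (l a b) b'"
    and compat_right: "r (mul B b b') a = mul B b (r b' a)"

text \<open>The condition \<open>(ba)b' = b(ab')\<close> is what the Leibniz rule for the cup product needs. It is
  not a consequence of \<open>bimodule_algebra\<close>: for \<open>A = k[x]\<close>, let \<open>B\<close> be the algebra of
  \<open>2 \<times> 2\<close> matrices with \<open>x\<close> acting from the left as the matrix unit \<open>E11\<close> and from the right as
  \<open>E22\<close>. Then the degree 0 cohomology is spanned by \<open>E12\<close> and \<open>E21\<close>, and is not closed under
  multiplication.\<close>

definition balanced where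
  "balanced B l r \<longleftrightarrow> (\<forall>b a b'. mul B (r b a) b' = mul B b (l a b'))"


subsection \<open>Formal linear combinations and presentations\<close>

definition lin_ext :: "('k \<Rightarrow> 'v \<Rightarrow> 'v) \<Rightarrow> ('w \<Rightarrow> 'v) \<Rightarrow> ('w \<Rightarrow>\<^sub>0 'k::zero) \<Rightarrow> 'v::comm_monoid_add" where
  "lin_ext s g p = (\<Sum>w\<in>Poly_Mapping.keys p. s (Poly_Mapping.lookup p w) (g w))"

definition fscale :: "'k \<Rightarrow> ('w \<Rightarrow>\<^sub>0 'k) \<Rightarrow> ('w \<Rightarrow>\<^sub>0 'k::field)" where
  "fscale c = Poly_Mapping.map ((*) c)"

lemma lookup_fscale: "Poly_Mapping.lookup (fscale c p) w = c * Poly_Mapping.lookup p w"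
  by (simp add: fscale_def Poly_Mapping.map.rep_eq when_def)

lemma vector_space_fscale: "vector_space fscale"
  by unfold_locales
    (auto intro!: poly_mapping_eqI simp: lookup_fscale lookup_add algebra_simps)

definition fspan :: "('w \<Rightarrow>\<^sub>0 'k::field) set \<Rightarrow> ('w \<Rightarrow>\<^sub>0 'k) set" where
  "fspan = module.span fscale"

abbreviation word :: "'w \<Rightarrow> ('w \<Rightarrow>\<^sub>0 'k::field)" where
  "word w \<equiv> Poly_Mapping.single w 1"

text \<open>The free algebra on \<open>x\<^sub>1, \<dots>, x\<^sub>N\<close> (equivalently, the tensor algebra of the vector space
  with this basis) has the words in the letters \<open>1, \<dots>, N\<close> as a basis, and words are multiplied
  by concatenation.\<close>

definition free_algebra :: "nat \<Rightarrow> (nat list \<Rightarrow>\<^sub>0 'k::field) set" where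
  "free_algebra N = {p. \<forall>w\<in>Poly_Mapping.keys p. set w \<subseteq> {1..N}}"

text \<open>The two-sided ideal of the free algebra generated by \<open>R\<close>.\<close>

definition free_ideal :: "nat \<Rightarrow> (nat list \<Rightarrow>\<^sub>0 'k::field) set \<Rightarrow> (nat list \<Rightarrow>\<^sub>0 'k) set" where
  "free_ideal N R =
     fspan {lin_ext fscale (\<lambda>w. word (u @ w @ v)) p | u p v.
              p \<in> R \<and> set u \<subseteq> {1..N} \<and> set v \<subseteq> {1..N}}"

definition eval_free :: "('k::field, 'a::ab_group_add) alg \<Rightarrow> (nat \<Rightarrow> 'a) \<Rightarrow> (nat list \<Rightarrow>\<^sub>0 'k) \<Rightarrow> 'a" where
  "eval_free A x = lin_ext (smul A) (\<lambda>w. foldr (\<lambda>i a. mul A (x i) a) w (unity A))"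

text \<open>\<open>A\<close> is the algebra with generators \<open>x\<^sub>1, \<dots>, x\<^sub>N\<close> and relations \<open>R\<close>: evaluation identifies it
  with the quotient of the free algebra by the ideal generated by \<open>R\<close>.\<close>

definition presented_algebra ::
  "nat \<Rightarrow> (nat list \<Rightarrow>\<^sub>0 'k::field) set \<Rightarrow> ('k, 'a::ab_group_add) alg \<Rightarrow> (nat \<Rightarrow> 'a) \<Rightarrow> bool" where
  "presented_algebra N R A x \<longleftrightarrow>
     unital_algebra A \<and>
     eval_free A x ` free_algebra N = UNIV \<and>
     (\<forall>p\<in>free_algebra N. eval_free A x p = 0 \<longleftrightarrow> p \<in> free_ideal N R)"


subsection \<open>Quantum symmetric and quantum exterior algebras\<close>

definition quantum_parameters :: "nat \<Rightarrow> (nat \<Rightarrow> nat \<Rightarrow> 'k::field) \<Rightarrow> bool" where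
  "quantum_parameters N q \<longleftrightarrow>
     (\<forall>i\<in>{1..N}. \<forall>j\<in>{1..N}. q i j \<noteq> 0 \<and> q j i = inverse (q i j)) \<and> (\<forall>i\<in>{1..N}. q i i = 1)"

definition quantum_symmetric_algebra ::
  "nat \<Rightarrow> (nat \<Rightarrow> nat \<Rightarrow> 'k::field) \<Rightarrow> ('k, 'a::ab_group_add) alg \<Rightarrow> (nat \<Rightarrow> 'a) \<Rightarrow> bool" where
  "quantum_symmetric_algebra N q A x \<longleftrightarrow>
     presented_algebra N
       {word [i, j] - fscale (q i j) (word [j, i]) | i j. i \<in> {1..N} \<and> j \<in> {1..N}} A x"

definition exterior_ideal :: "nat \<Rightarrow> (nat \<Rightarrow> nat \<Rightarrow> 'k::field) \<Rightarrow> (nat list \<Rightarrow>\<^sub>0 'k) set" where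
  "exterior_ideal N q =
     free_ideal N {word [i, j] + fscale (q i j) (word [j, i]) | i j. i \<in> {1..N} \<and> j \<in> {1..N}}"

text \<open>An exponent vector \<open>\<beta>\<close> in \<open>{0,1}\<^sup>N\<close> is represented by its support, a subset of \<open>{1..N}\<close>. The
  number \<open>ext_coeff N q I J K\<close> is the coefficient of \<open>x\<^sup>\<and>\<^sup>K\<close> in the product of \<open>x\<^sup>\<and>\<^sup>I\<close> and \<open>x\<^sup>\<and>\<^sup>J\<close> in
  the quantum exterior algebra, the quotient of the tensor algebra by \<open>exterior_ideal N q\<close>.\<close>

definition ext_coeff ::
  "nat \<Rightarrow> (nat \<Rightarrow> nat \<Rightarrow> 'k::field) \<Rightarrow> nat set \<Rightarrow> nat set \<Rightarrow> nat set \<Rightarrow> 'k" where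
  "ext_coeff N q I J =
     (THE c. (\<forall>K. \<not> K \<subseteq> {1..N} \<longrightarrow> c K = 0) \<and>
        word (sorted_list_of_set I @ sorted_list_of_set J)
          - (\<Sum>K\<in>Pow {1..N}. fscale (c K) (word (sorted_list_of_set K))) \<in> exterior_ideal N q)"

text \<open>The tensor product of \<open>B\<close> and the quantum exterior algebra with parameters \<open>q\<close>; a function \<open>u\<close>
  stands for the sum of the \<open>u J \<otimes> x\<^sup>\<and>\<^sup>J\<close>.\<close>

definition tensor_ext_mult ::
  "nat \<Rightarrow> (nat \<Rightarrow> nat \<Rightarrow> 'k::field) \<Rightarrow> ('k, 'b::ab_group_add) alg
     \<Rightarrow> (nat set \<Rightarrow> 'b) \<Rightarrow> (nat set \<Rightarrow> 'b) \<Rightarrow> nat set \<Rightarrow> 'b" where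
  "tensor_ext_mult N q B u v K =
     (\<Sum>I\<in>Pow {1..N}. \<Sum>J\<in>Pow {1..N}. smul B (ext_coeff N q I J K) (mul B (u I) (v J)))"

definition tensor_ext ::
  "nat \<Rightarrow> (nat \<Rightarrow> nat \<Rightarrow> 'k::field) \<Rightarrow> ('k, 'b::ab_group_add) alg \<Rightarrow> (nat set \<Rightarrow> 'b) ring" where
  "tensor_ext N q B =
     \<lparr>carrier = {u. \<forall>J. \<not> J \<subseteq> {1..N} \<longrightarrow> u J = 0},
      monoid.mult = tensor_ext_mult N q B,
      one = (\<lambda>J. if J = {} then unity B else 0),
      zero = (\<lambda>_. 0),
      add = (\<lambda>u v J. u J + v J)\<rparr>"


subsection \<open>The complex of the Koszul resolution\<close>

text \<open>Coefficient at \<open>J\<close> of the differential, the summand for \<open>i\<close> coming from \<open>\<beta> = J - {i}\<close>.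
  The bimodule (with scalar multiplication \<open>s\<close> and actions \<open>l\<close>, \<open>r\<close>) is a parameter: besides \<open>B\<close>, it
  is also used for the bar resolution, to express that a map out of the Koszul resolution is a chain
  map.\<close>

definition koszul_diff ::
  "nat \<Rightarrow> (nat \<Rightarrow> nat \<Rightarrow> 'k::field) \<Rightarrow> (nat \<Rightarrow> 'a) \<Rightarrow> ('k \<Rightarrow> 'm \<Rightarrow> 'm) \<Rightarrow> ('a \<Rightarrow> 'm \<Rightarrow> 'm) \<Rightarrow> ('m \<Rightarrow> 'a \<Rightarrow> 'm)
     \<Rightarrow> (nat set \<Rightarrow> 'm) \<Rightarrow> nat set \<Rightarrow> 'm::ab_group_add" where
  "koszul_diff N q x s l r u J =
     (if J \<subseteq> {1..N} then
        \<Sum>i\<in>J. s ((- 1) ^ card {t \<in> J - {i}. t \<le> i})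
          (s (\<Prod>t\<in>{t \<in> J - {i}. t \<le> i}. q t i) (l (x i) (u (J - {i})))
           - s (\<Prod>t\<in>{t \<in> J - {i}. i \<le> t}. q i t) (r (u (J - {i})) (x i)))
      else 0)"

definition koszul_cocycles where
  "koszul_cocycles N q x B l r =
     {u \<in> carrier (tensor_ext N (\<lambda>i j. inverse (q i j)) B).
        koszul_diff N q x (smul B) l r u = (\<lambda>_. 0)}"

definition koszul_coboundaries where
  "koszul_coboundaries N q x B l r =
     koszul_diff N q x (smul B) l r ` carrier (tensor_ext N (\<lambda>i j. inverse (q i j)) B)"


subsection \<open>The bar resolution and Hochschild cohomology\<close>

text \<open>An element of a tensor power of \<open>A\<close> is represented by a formal linear combination of lists, the
  list \<open>[a\<^sub>0, \<dots>, a\<^sub>n]\<close> standing for \<open>a\<^sub>0 \<otimes> \<dots> \<otimes> a\<^sub>n\<close>; two combinations represent the same element if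
  they differ by an element of \<open>tensor_null A\<close>.\<close>

definition tensor_null :: "('k::field, 'a::ab_group_add) alg \<Rightarrow> ('a list \<Rightarrow>\<^sub>0 'k) set" where
  "tensor_null A =
     fspan ({word (us @ [a + a'] @ vs) - word (us @ [a] @ vs) - word (us @ [a'] @ vs) | us a a' vs. True}
            \<union> {word (us @ [smul A c a] @ vs) - fscale c (word (us @ [a] @ vs)) | us c a vs. True})"

definition merge_at :: "('k, 'a) alg \<Rightarrow> nat \<Rightarrow> 'a list \<Rightarrow> 'a list" where
  "merge_at A i as = take i as @ [mul A (as ! i) (as ! Suc i)] @ drop (Suc (Suc i)) as"

definition bar_boundary :: "('k::field, 'a) alg \<Rightarrow> ('a list \<Rightarrow>\<^sub>0 'k) \<Rightarrow> ('a list \<Rightarrow>\<^sub>0 'k)" where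
  "bar_boundary A =
     lin_ext fscale (\<lambda>as. \<Sum>i<length as - 1. fscale ((- 1) ^ i) (word (merge_at A i as)))"

definition tensor_lact :: "('k::field, 'a) alg \<Rightarrow> 'a \<Rightarrow> ('a list \<Rightarrow>\<^sub>0 'k) \<Rightarrow> ('a list \<Rightarrow>\<^sub>0 'k)" where
  "tensor_lact A a = lin_ext fscale (\<lambda>as. word (mul A a (hd as) # tl as))"

definition tensor_ract :: "('k::field, 'a) alg \<Rightarrow> ('a list \<Rightarrow>\<^sub>0 'k) \<Rightarrow> 'a \<Rightarrow> ('a list \<Rightarrow>\<^sub>0 'k)" where
  "tensor_ract A p a = lin_ext fscale (\<lambda>as. word (butlast as @ [mul A (last as) a])) p"

text \<open>The direct sum over \<open>m\<close> of the spaces of bimodule homomorphisms from the tensor power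
  \<open>A\<^sup>\<otimes>\<^sup>(\<^sup>m\<^sup>+\<^sup>2\<^sup>)\<close> to \<open>B\<close>, each homomorphism being given by its values on pure tensors: the component of
  degree \<open>m\<close> of a cochain is its restriction to the lists of length \<open>m + 2\<close>.\<close>

definition bar_cochains ::
  "('k::field, 'a::ab_group_add) alg \<Rightarrow> ('k, 'b::ab_group_add) alg \<Rightarrow> ('a \<Rightarrow> 'b \<Rightarrow> 'b) \<Rightarrow> ('b \<Rightarrow> 'a \<Rightarrow> 'b)
     \<Rightarrow> ('a list \<Rightarrow> 'b) set" where
  "bar_cochains A B l r =
     {f. (\<forall>as. length as < 2 \<longrightarrow> f as = 0) \<and>
         (\<exists>M. \<forall>as. length as > M \<longrightarrow> f as = 0) \<and>
         (\<forall>us vs a a'. f (us @ [a + a'] @ vs) = f (us @ [a] @ vs) + f (us @ [a'] @ vs)) \<and>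
         (\<forall>us vs c a. f (us @ [smul A c a] @ vs) = smul B c (f (us @ [a] @ vs))) \<and>
         (\<forall>a a' as. as \<noteq> [] \<longrightarrow> f (mul A a a' # as) = l a (f (a' # as))) \<and>
         (\<forall>a a' as. as \<noteq> [] \<longrightarrow> f (as @ [mul A a' a]) = r (f (as @ [a'])) a)}"

definition bar_diff ::
  "('k::field, 'a) alg \<Rightarrow> ('k, 'b::ab_group_add) alg \<Rightarrow> ('a list \<Rightarrow> 'b) \<Rightarrow> 'a list \<Rightarrow> 'b" where
  "bar_diff A B f as = (\<Sum>i<length as - 1. smul B ((- 1) ^ i) (f (merge_at A i as)))"

text \<open>For homogeneous \<open>f\<close> of degree \<open>m\<close>, only the summand \<open>k = m + 1\<close> can be nonzero.\<close>

definition cup ::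
  "('k, 'a) alg \<Rightarrow> ('k, 'b::ab_group_add) alg \<Rightarrow> ('a list \<Rightarrow> 'b) \<Rightarrow> ('a list \<Rightarrow> 'b) \<Rightarrow> 'a list \<Rightarrow> 'b" where
  "cup A B f g as =
     (\<Sum>k\<in>{1..<length as}. mul B (f (take k as @ [unity A])) (g (unity A # drop k as)))"

definition bar_ring where
  "bar_ring A B l r =
     \<lparr>carrier = bar_cochains A B l r,
      monoid.mult = cup A B,
      one = (\<lambda>as. if length as = 2 then r (l (as ! 0) (unity B)) (as ! 1) else 0),
      zero = (\<lambda>_. 0),
      add = (\<lambda>f g as. f as + g as)\<rparr>"

definition bar_cocycles where
  "bar_cocycles A B l r = {f \<in> bar_cochains A B l r. bar_diff A B f = (\<lambda>_. 0)}"

definition bar_coboundaries where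
  "bar_coboundaries A B l r = bar_diff A B ` bar_cochains A B l r"

text \<open>The cup product of cochains induces a product on cohomology.\<close>

definition cup_descends where
  "cup_descends A B l r \<longleftrightarrow>
     subring (bar_cocycles A B l r) (bar_ring A B l r) \<and>
     ideal (bar_coboundaries A B l r) (bar_ring A B l r\<lparr>carrier := bar_cocycles A B l r\<rparr>)"

definition HH where
  "HH A B l r = bar_ring A B l r\<lparr>carrier := bar_cocycles A B l r\<rparr> Quot bar_coboundaries A B l r"

definition koszul_subquotient where
  "koszul_subquotient N q x B l r =
     tensor_ext N (\<lambda>i j. inverse (q i j)) B\<lparr>carrier := koszul_cocycles N q x B l r\<rparr>
       Quot koszul_coboundaries N q x B l r"


subsection \<open>Comparison of the two resolutions\<close>

text \<open>A chain map of bimodule complexes from the Koszul resolution to the bar resolution that lifts the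
  identity of \<open>A\<close>, given by the images \<open>\<phi> J\<close> of the free generators \<open>1 \<otimes> 1 \<otimes> x\<^sup>\<and>\<^sup>J\<close>.\<close>

definition comparison_map ::
  "nat \<Rightarrow> (nat \<Rightarrow> nat \<Rightarrow> 'k::field) \<Rightarrow> ('k, 'a::ab_group_add) alg \<Rightarrow> (nat \<Rightarrow> 'a)
     \<Rightarrow> (nat set \<Rightarrow> ('a list \<Rightarrow>\<^sub>0 'k)) \<Rightarrow> bool" where
  "comparison_map N q A x \<phi> \<longleftrightarrow>
     (\<forall>J\<subseteq>{1..N}. \<forall>as\<in>Poly_Mapping.keys (\<phi> J). length as = card J + 2) \<and>
     lin_ext (smul A) (\<lambda>as. mul A (as ! 0) (as ! 1)) (\<phi> {}) = unity A \<and>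
     (\<forall>J\<subseteq>{1..N}. J \<noteq> {} \<longrightarrow>
        bar_boundary A (\<phi> J) - koszul_diff N q x fscale (tensor_lact A) (tensor_ract A) \<phi> J
          \<in> tensor_null A)"

text \<open>Composition of cochains with a comparison map, and the map induced on cohomology. The degree is
  preserved, since \<open>\<phi> J\<close> consists of lists of length \<open>card J + 2\<close>.\<close>

definition pullback ::
  "nat \<Rightarrow> ('k::field, 'b::ab_group_add) alg \<Rightarrow> (nat set \<Rightarrow> ('a list \<Rightarrow>\<^sub>0 'k)) \<Rightarrow> ('a list \<Rightarrow> 'b)
     \<Rightarrow> nat set \<Rightarrow> 'b" where
  "pullback N B \<phi> f J = (if J \<subseteq> {1..N} then lin_ext (smul B) f (\<phi> J) else 0)"

definition induced_map where
  "induced_map N q x B l r \<phi> X =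
     (\<Union>f\<in>X. koszul_coboundaries N q x B l r
               +>\<^bsub>tensor_ext N (\<lambda>i j. inverse (q i j)) B\<^esub> pullback N B \<phi> f)"

end

theory Submission
  imports Defs "HOL-Combinatorics.Multiset_Permutations"
begin

text \<open>The antisymmetrization map \<open>phi0\<close> sends \<open>x\<^sup>\<and>\<^sup>J\<close> to the \<open>q\<close>-signed sum of the tensors
  \<open>1 \<otimes> x\<^sub>w\<^sub>1 \<otimes> \<dots> \<otimes> x\<^sub>w\<^sub>m \<otimes> 1\<close> over the orderings \<open>w\<close> of \<open>J\<close>; it is a chain map from the Koszul
  resolution to the bar resolution. Monomials give a contracting homotopy \<open>h\<close> of the Koszul
  resolution, and \<open>psi (\<dots> \<otimes> a \<otimes> b) = \<plusminus> h (psi (\<dots> \<otimes> a)) b\<close> recursively defines a chain map in the other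
  direction with \<open>psi \<circ> phi0 = id\<close>, which among the tensors of generators sees only the descending ones.
  Therefore the cup product of two cochains pulled back along \<open>psi\<close>, evaluated on \<open>phi0 (x\<^sup>\<and>\<^sup>K)\<close>, is a sum
  over shuffles, and it equals their product in the tensor product with the quantum exterior algebra
  already on the level of cochains. The homotopies \<open>phi0 \<circ> psi \<sim> id\<close> and \<open>\<phi> \<sim> phi0\<close>, for any other
  comparison map \<open>\<phi>\<close>, come from the contraction of the bar resolution.

  No tensor products are formed: all maps are described by their effect on left \<open>A\<close>-linear
  functionals with values in \<open>B\<close>.\<close>

subsection \<open>Formal linear combinations\<close>

text \<open>Both contractions, \<open>h\<close> for the Koszul complex and the appended unit for the
  bar complex, are linear over \<open>A\<close> on the left only. A cochain composed with one of
  them is no longer a bimodule map. This is why left linear functionals are used, on which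
  precomposition reverses the order of all maps. Right linearity is restored by construction: each
  recursion first moves the last tensor factor into the functional (\<open>rsh\<close>,
  \<open>shr\<close>). Moreover every operator commutes with left module endomorphisms of
  \<open>B\<close>. Scalars and right multiplications are such endomorphisms, so a single naturality
  lemma per operator serves both.

  That \<open>psi\<close> followed back by \<open>phi0\<close> is the identity on the nose, and not
  only up to homotopy, makes multiplicativity an identity of cochains whose proof involves no
  Leibniz rule. Hence balance matters only for the cup product to descend, and the remaining
  multiplicative statements take \<open>cup_descends\<close> as their hypothesis.

  Division by 2 occurs twice: to kill repeated letters in the exterior algebra, and to cancel
  orderings of \<open>J\<close> in pairs.\<close>

interpretation formal: vector_space "fscale :: 'k::field \<Rightarrow> ('w \<Rightarrow>\<^sub>0 'k) \<Rightarrow> _"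
  by (rule vector_space_fscale)

lemma fscale_single [simp]: "fscale c (Poly_Mapping.single w d) = Poly_Mapping.single w (c * d)"
  by (rule poly_mapping_eqI) (simp add: lookup_fscale lookup_single when_def)

lemma lin_ext_hom:
  fixes P :: "'w \<Rightarrow>\<^sub>0 'k::zero"
  assumes "p 0 = 0" "\<And>u v. p (u + v) = p u + p v" "\<And>c u. p (s c u) = s' c (p u)"
  shows "p (lin_ext s g P) = lin_ext s' (\<lambda>w. p (g w)) P"
proof -
  have "p (\<Sum>w\<in>W. s (Poly_Mapping.lookup P w) (g w))
      = (\<Sum>w\<in>W. s' (Poly_Mapping.lookup P w) (p (g w)))" for W
    by (induction W rule: infinite_finite_induct) (simp_all only: assms sum.infinite sum.empty
        sum.insert not_False_eq_True)
  then show ?thesis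
    unfolding lin_ext_def .
qed

lemma lin_ext_cong:
  assumes "\<And>w. w \<in> Poly_Mapping.keys P \<Longrightarrow> g w = g' w"
  shows "lin_ext s g P = lin_ext s g' P"
  unfolding lin_ext_def using assms by (intro sum.cong) auto

context vector_space
begin

lemma lin_ext_superset:
  assumes "finite S" "Poly_Mapping.keys P \<subseteq> S"
  shows "lin_ext scale g P = (\<Sum>w\<in>S. scale (Poly_Mapping.lookup P w) (g w))"
  unfolding lin_ext_def using assms by (intro sum.mono_neutral_left) (auto simp: in_keys_iff)

lemma lin_ext_0 [simp]: "lin_ext scale g 0 = 0"
  by (simp add: lin_ext_def)

lemma lin_ext_single [simp]: "lin_ext scale g (Poly_Mapping.single w c) = scale c (g w)"
  using lin_ext_superset[of "{w}" "Poly_Mapping.single w c" g]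
  by (cases "c = 0") auto

lemma lin_ext_add: "lin_ext scale g (P + P') = lin_ext scale g P + lin_ext scale g P'"
proof -
  let ?S = "Poly_Mapping.keys P \<union> Poly_Mapping.keys P'"
  have "Poly_Mapping.keys (P + P') \<subseteq> ?S"
    by (rule Poly_Mapping.keys_add)
  then show ?thesis
    by (simp add: lin_ext_superset[of ?S] lookup_add scale_left_distrib sum.distrib)
qed

lemma lin_ext_fscale: "lin_ext scale g (fscale c P) = scale c (lin_ext scale g P)"
proof -
  have "Poly_Mapping.keys (fscale c P) \<subseteq> Poly_Mapping.keys P"
    by (auto simp: in_keys_iff lookup_fscale)
  then show ?thesis
    by (simp add: lin_ext_superset[of "Poly_Mapping.keys P"] lookup_fscale scale_sum_right)
qed

lemma lin_ext_uminus: "lin_ext scale g (- P) = - lin_ext scale g P"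
  by (rule minus_unique[symmetric]) (simp flip: lin_ext_add)

lemma lin_ext_diff: "lin_ext scale g (P - P') = lin_ext scale g P - lin_ext scale g P'"
  using lin_ext_add[of g P "- P'"] by (simp add: lin_ext_uminus)

lemma lin_ext_sum: "lin_ext scale g (sum f W) = (\<Sum>w\<in>W. lin_ext scale g (f w))"
  by (induction W rule: infinite_finite_induct) (simp_all add: lin_ext_add)

lemmas lin_ext_linear = lin_ext_add lin_ext_fscale lin_ext_uminus lin_ext_diff lin_ext_sum

lemma lin_ext_lin_ext:
  "lin_ext scale g (lin_ext fscale f P) = lin_ext scale (\<lambda>w. lin_ext scale g (f w)) P"
  by (rule lin_ext_hom) (simp_all add: lin_ext_linear)

lemma lin_ext_fspan:
  assumes "P \<in> fspan R" and "\<And>P. P \<in> R \<Longrightarrow> lin_ext scale g P = 0"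
  shows "lin_ext scale g P = 0"
  using assms(1) unfolding fspan_def
  by (rule formal.span_induct)
    (auto simp: formal.subspace_def lin_ext_linear assms(2))

lemma lin_ext_fun_add:
  "lin_ext scale (\<lambda>w. g w + g' w) P = lin_ext scale g P + lin_ext scale g' P"
  by (simp add: lin_ext_def scale_right_distrib sum.distrib)

lemma lin_ext_fun_diff:
  "lin_ext scale (\<lambda>w. g w - g' w) P = lin_ext scale g P - lin_ext scale g' P"
  by (simp add: lin_ext_def scale_right_diff_distrib sum_subtractf)

end

lemma lin_ext_word: "lin_ext fscale word P = (P :: 'w \<Rightarrow>\<^sub>0 'k::field)"
  by (rule poly_mapping_eqI)
    (simp add: lin_ext_def lookup_sum lookup_single when_def in_keys_iff)

lemmas fspan_add = formal.span_add[folded fspan_def]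
  and fspan_diff = formal.span_diff[folded fspan_def]
  and fspan_fscale = formal.span_scale[folded fspan_def]
  and fspan_0 = formal.span_zero[folded fspan_def]
  and fspan_base = formal.span_base[folded fspan_def]
  and fspan_sum = formal.span_sum[folded fspan_def]


subsection \<open>Inversion coefficients of words\<close>

text \<open>If \<open>x\<^sub>i x\<^sub>j = s i j \<cdot> x\<^sub>j x\<^sub>i\<close>, then \<open>inv_coeff s w\<close> is the scalar by which a word \<open>w\<close> differs from
  its sorted version, and \<open>cross_coeff s u v\<close> is the scalar produced by moving \<open>v\<close> past \<open>u\<close>.\<close>

definition cross_coeff :: "(nat \<Rightarrow> nat \<Rightarrow> 'k::field) \<Rightarrow> nat list \<Rightarrow> nat list \<Rightarrow> 'k" where
  "cross_coeff s u v = (\<Prod>a\<leftarrow>u. \<Prod>b\<leftarrow>v. if b < a then s a b else 1)"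

primrec inv_coeff :: "(nat \<Rightarrow> nat \<Rightarrow> 'k::field) \<Rightarrow> nat list \<Rightarrow> 'k" where
  "inv_coeff s [] = 1"
| "inv_coeff s (i # w) = (\<Prod>t\<leftarrow>w. if t < i then s i t else 1) * inv_coeff s w"

lemma prod_list_map_mset: "mset u = mset v \<Longrightarrow> prod_list (map f u) = (prod_list (map f v) :: 'k::comm_monoid_mult)"
  by (metis mset_map prod_mset_prod_list)

lemma prod_list_map_mult:
  "(\<Prod>a\<leftarrow>u. f a * g a) = (\<Prod>a\<leftarrow>u. f a) * (\<Prod>a\<leftarrow>u. g a :: 'k::comm_monoid_mult)"
  by (induction u) (simp_all add: ac_simps)

lemma prod_list_map_one: "(\<And>a. a \<in> set u \<Longrightarrow> f a = 1) \<Longrightarrow> (\<Prod>a\<leftarrow>u. f a) = (1 :: 'k::comm_monoid_mult)"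
  by (induction u) simp_all

lemma cross_coeff_Nil [simp]: "cross_coeff s [] v = 1" "cross_coeff s u [] = 1"
  by (simp_all add: cross_coeff_def prod_list_map_one)

lemma cross_coeff_Cons_left:
  "cross_coeff s (a # u) v = (\<Prod>b\<leftarrow>v. if b < a then s a b else 1) * cross_coeff s u v"
  by (simp add: cross_coeff_def)

lemma cross_coeff_append_left: "cross_coeff s (u @ u') v = cross_coeff s u v * cross_coeff s u' v"
  by (simp add: cross_coeff_def)

lemma cross_coeff_append_right: "cross_coeff s u (v @ v') = cross_coeff s u v * cross_coeff s u v'"
  by (simp add: cross_coeff_def prod_list_map_mult)

lemma cross_coeff_mset:
  assumes "mset u = mset u'" "mset v = mset v'"
  shows "cross_coeff s u v = cross_coeff s u' v'"
proof -
  have "cross_coeff s u v = (\<Prod>a\<leftarrow>u'. \<Prod>b\<leftarrow>v. if b < a then s a b else 1)"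
    unfolding cross_coeff_def by (rule prod_list_map_mset[OF assms(1)])
  also have "\<dots> = cross_coeff s u' v'"
    unfolding cross_coeff_def by (intro arg_cong[of _ _ prod_list] map_cong refl prod_list_map_mset[OF assms(2)])
  finally show ?thesis .
qed

lemma inv_coeff_append: "inv_coeff s (u @ v) = inv_coeff s u * inv_coeff s v * cross_coeff s u v"
  by (induction u) (simp_all add: cross_coeff_Cons_left ac_simps)

text \<open>The factors linking the pair to \<open>u\<close> and \<open>v\<close> depend only on
  multisets, so only the inversion inside the pair changes. Since \<open>s i j * s j i = 1\<close>,
  the formula is the same whichever letter is smaller.\<close>

lemma inv_coeff_swap:
  assumes "i \<noteq> j" "s i j * s j i = 1"
  shows "inv_coeff s (u @ [i, j] @ v) = s i j * inv_coeff s (u @ [j, i] @ v)"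
proof -
  have "cross_coeff s u ([i, j] @ v) = cross_coeff s u ([j, i] @ v)"
       "cross_coeff s [i, j] v = cross_coeff s [j, i] v"
    by (auto intro!: cross_coeff_mset)
  moreover have "inv_coeff s [i, j] = s i j * inv_coeff s [j, i]"
    using assms by (cases i j rule: linorder_cases) (auto simp: ac_simps)
  ultimately show ?thesis
    by (simp only: inv_coeff_append) (simp add: mult_ac)
qed

lemma inv_coeff_sorted: "sorted w \<Longrightarrow> inv_coeff s w = 1"
proof (induction w)
  case (Cons a w)
  have "(\<Prod>t\<leftarrow>w. if t < a then s a t else 1) = 1"
    by (rule prod_list_map_one) (use Cons.prems in auto)
  then show ?case using Cons by simp
qed simp

lemma inv_coeff_nonzero:
  assumes "\<And>i j. i \<in> set w \<Longrightarrow> j \<in> set w \<Longrightarrow> s i j \<noteq> 0"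
  shows "inv_coeff s w \<noteq> 0"
  using assms by (induction w) (auto simp: prod_list_zero_iff split: if_splits)


subsection \<open>Ideals of the free algebra\<close>

lemma lin_ext_context:
  "lin_ext fscale (\<lambda>w. word (u @ w @ v)) (lin_ext fscale (\<lambda>w. word (u' @ w @ v')) P)
     = lin_ext fscale (\<lambda>w. word ((u @ u') @ w @ (v' @ v))) P"
  by (simp add: formal.lin_ext_lin_ext)

lemma free_ideal_context:
  assumes "P \<in> free_ideal N R" "set u \<subseteq> {1..N}" "set v \<subseteq> {1..N}"
  shows "lin_ext fscale (\<lambda>w. word (u @ w @ v)) P \<in> free_ideal N R"
  using assms(1) unfolding free_ideal_def fspan_def
proof (rule formal.span_induct)
  show "formal.subspace {P. lin_ext fscale (\<lambda>w. word (u @ w @ v)) P \<in> formal.span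
      {lin_ext fscale (\<lambda>w. word (u @ w @ v)) P | u P v. P \<in> R \<and> set u \<subseteq> {1..N} \<and> set v \<subseteq> {1..N}}}"
    by (auto simp: formal.subspace_def formal.lin_ext_linear
        intro: formal.span_zero formal.span_add formal.span_scale)
next
  fix P assume "P \<in> {lin_ext fscale (\<lambda>w. word (u @ w @ v)) P | u P v.
      P \<in> R \<and> set u \<subseteq> {1..N} \<and> set v \<subseteq> {1..N}}"
  then obtain u' P' v' where P: "P = lin_ext fscale (\<lambda>w. word (u' @ w @ v')) P'" "P' \<in> R"
    and uv: "set u' \<subseteq> {1..N}" "set v' \<subseteq> {1..N}"
    by blast
  show "lin_ext fscale (\<lambda>w. word (u @ w @ v)) P \<in> formal.span
      {lin_ext fscale (\<lambda>w. word (u @ w @ v)) P | u P v. P \<in> R \<and> set u \<subseteq> {1..N} \<and> set v \<subseteq> {1..N}}"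
    unfolding P(1) lin_ext_context using P(2) uv assms(2,3)
    by (intro formal.span_base CollectI exI[of _ "u @ u'"] exI[of _ P'] exI[of _ "v' @ v"]) auto
qed

lemma free_ideal_base:
  "P \<in> R \<Longrightarrow> set u \<subseteq> {1..N} \<Longrightarrow> set v \<subseteq> {1..N} \<Longrightarrow>
     lin_ext fscale (\<lambda>w. word (u @ w @ v)) P \<in> free_ideal N R"
  unfolding free_ideal_def by (rule fspan_base) blast

text \<open>This is how a linear map given on words is shown to descend to a presented algebra: each
  relation is tested inside every context \<open>u\<close>, \<open>v\<close>.\<close>

lemma (in vector_space) lin_ext_free_ideal:
  assumes "P \<in> free_ideal N R"
    and "\<And>P u v. P \<in> R \<Longrightarrow> set u \<subseteq> {1..N} \<Longrightarrow> set v \<subseteq> {1..N} \<Longrightarrow>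
          lin_ext scale (\<lambda>w. g (u @ w @ v)) P = 0"
  shows "lin_ext scale g P = 0"
  using assms(1) unfolding free_ideal_def
  by (rule lin_ext_fspan) (use assms(2) in \<open>auto simp: lin_ext_lin_ext\<close>)

lemma free_algebra_word: "set w \<subseteq> {1..N} \<Longrightarrow> word w \<in> free_algebra N"
  by (simp add: free_algebra_def)

lemma free_algebra_add: "P \<in> free_algebra N \<Longrightarrow> P' \<in> free_algebra N \<Longrightarrow> P + P' \<in> free_algebra N"
  using Poly_Mapping.keys_add[of P P'] unfolding free_algebra_def by blast

lemma free_algebra_fscale: "P \<in> free_algebra N \<Longrightarrow> fscale c P \<in> free_algebra N"
  by (auto simp: free_algebra_def in_keys_iff lookup_fscale)

lemma free_algebra_diff: "P \<in> free_algebra N \<Longrightarrow> P' \<in> free_algebra N \<Longrightarrow> P - P' \<in> free_algebra N"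
  using free_algebra_add[of P N "fscale (- 1) P'"] free_algebra_fscale[of P' N "- 1"] by simp


subsection \<open>Structure constants of the quantum exterior algebra\<close>

text \<open>Separate from the parameters of the symmetric algebra because it is instantiated with
  the inverse scalars.\<close>

locale exterior_parameters =
  fixes N :: nat and Q :: "nat \<Rightarrow> nat \<Rightarrow> 'k::field_char_0"
  assumes parameters: "quantum_parameters N Q"
begin

abbreviation "ext_ideal \<equiv> exterior_ideal N Q"

text \<open>Extended linearly, this projects onto the strictly increasing words. Killing the ideal
  gives their independence, being congruent to the identity gives that they span.\<close>

definition ext_nf :: "nat list \<Rightarrow> (nat list \<Rightarrow>\<^sub>0 'k)" where
  "ext_nf w = (if distinct w then Poly_Mapping.single (sort w) (inv_coeff (\<lambda>i j. - Q i j) w) else 0)"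

lemma Q_nonzero: "i \<in> {1..N} \<Longrightarrow> j \<in> {1..N} \<Longrightarrow> Q i j \<noteq> 0"
  and Q_inverse: "i \<in> {1..N} \<Longrightarrow> j \<in> {1..N} \<Longrightarrow> Q j i = inverse (Q i j)"
  and Q_diag: "i \<in> {1..N} \<Longrightarrow> Q i i = 1"
  using parameters unfolding quantum_parameters_def by blast+

text \<open>For distinct letters a swap multiplies the inversion coefficient by
  \<open>- Q i j\<close>; for equal letters both words contain a repetition and are sent to
  0.\<close>

lemma ext_nf_ideal:
  assumes "P \<in> ext_ideal"
  shows "lin_ext fscale ext_nf P = 0"
  using assms unfolding exterior_ideal_def
proof (rule formal.lin_ext_free_ideal)
  fix P :: "nat list \<Rightarrow>\<^sub>0 'k" and u v
  assume "P \<in> {word [i, j] + fscale (Q i j) (word [j, i]) | i j. i \<in> {1..N} \<and> j \<in> {1..N}}"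
  then obtain i j where ij: "i \<in> {1..N}" "j \<in> {1..N}"
    and P: "P = word [i, j] + fscale (Q i j) (word [j, i])"
    by blast
  have "ext_nf (u @ [i, j] @ v) + fscale (Q i j) (ext_nf (u @ [j, i] @ v)) = 0"
  proof (cases "i = j")
    case True
    then show ?thesis by (simp add: ext_nf_def)
  next
    case False
    have "sort (u @ [i, j] @ v) = sort (u @ [j, i] @ v)"
      by (rule properties_for_sort) (simp_all add: ac_simps)
    moreover have "inv_coeff (\<lambda>i j. - Q i j) (u @ [i, j] @ v)
        = - Q i j * inv_coeff (\<lambda>i j. - Q i j) (u @ [j, i] @ v)"
      by (rule inv_coeff_swap) (use False ij Q_nonzero Q_inverse[of i j] in auto)
    moreover have "distinct (u @ [i, j] @ v) = distinct (u @ [j, i] @ v)"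
      by auto
    ultimately show ?thesis
      by (simp add: ext_nf_def flip: single_add)
  qed
  then show "lin_ext fscale (\<lambda>w. ext_nf (u @ w @ v)) P = 0"
    by (simp add: P formal.lin_ext_linear flip: fscale_single)
qed

lemma ext_ideal_diff: "P \<in> ext_ideal \<Longrightarrow> P' \<in> ext_ideal \<Longrightarrow> P - P' \<in> ext_ideal"
  unfolding exterior_ideal_def free_ideal_def by (rule fspan_diff)

lemma ext_ideal_add: "P \<in> ext_ideal \<Longrightarrow> P' \<in> ext_ideal \<Longrightarrow> P + P' \<in> ext_ideal"
  unfolding exterior_ideal_def free_ideal_def by (rule fspan_add)

lemma ext_ideal_fscale: "P \<in> ext_ideal \<Longrightarrow> fscale c P \<in> ext_ideal"
  unfolding exterior_ideal_def free_ideal_def by (rule fspan_fscale)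

lemma ext_ideal_0: "0 \<in> ext_ideal"
  unfolding exterior_ideal_def free_ideal_def by (rule fspan_0)

lemma ext_ideal_Cons:
  assumes "P \<in> ext_ideal" "i \<in> {1..N}"
  shows "lin_ext fscale (\<lambda>w. word (i # w)) P \<in> ext_ideal"
  using free_ideal_context[of P N _ "[i]" "[]"] assms unfolding exterior_ideal_def by simp

lemma ext_ideal_swap:
  assumes "i \<in> {1..N}" "j \<in> {1..N}" "set w \<subseteq> {1..N}"
  shows "word (i # j # w) + fscale (Q i j) (word (j # i # w)) \<in> ext_ideal"
proof -
  have "lin_ext fscale (\<lambda>v. word ([] @ v @ w)) (word [i, j] + fscale (Q i j) (word [j, i])) \<in> ext_ideal"
    unfolding exterior_ideal_def by (rule free_ideal_base) (use assms in auto)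
  then show ?thesis
    by (simp add: formal.lin_ext_linear)
qed

text \<open>One step of insertion sort modulo the ideal. A letter that meets its own copy on the way
  annihilates the word.\<close>

lemma ext_nf_insort:
  assumes "i \<in> {1..N}" "set w \<subseteq> {1..N}" "sorted_wrt (<) w"
  shows "word (i # w) - (if i \<in> set w then 0
      else fscale (\<Prod>t\<leftarrow>w. if t < i then - Q i t else 1) (word (insort i w))) \<in> ext_ideal"
  using assms(2,3)
proof (induction w)
  case Nil
  then show ?case by (simp add: ext_ideal_0)
next
  case (Cons j w)
  then have j: "j \<in> {1..N}" and w: "set w \<subseteq> {1..N}" and jw: "\<forall>t\<in>set w. j < t"
    by auto
  consider "i < j" | "i = j" | "j < i" by linarith
  then show ?case
  proof cases
    case 1
    then have "(\<Prod>t\<leftarrow>w. if t < i then - Q i t else 1) = 1"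
      by (intro prod_list_map_one) (use jw in auto)
    then show ?thesis using 1 jw by (auto simp: ext_ideal_0)
  next
    case 2
    \<comment> \<open>As \<open>Q i i = 1\<close>, the relation for equal letters yields twice the
      word, hence the factor 1/2.\<close>
    have "fscale (1/2) (word (i # i # w) + fscale (Q i i) (word (i # i # w))) \<in> ext_ideal"
      using ext_ideal_swap[OF assms(1) assms(1) w] ext_ideal_fscale by blast
    then show ?thesis
      using 2 assms(1) by (simp add: Q_diag flip: single_add)
  next
    case 3
    define R where "R = (if i \<in> set w then 0
      else fscale (\<Prod>t\<leftarrow>w. if t < i then - Q i t else 1) (word (insort i w)))"
    have "word (i # w) - R \<in> ext_ideal"
      using Cons w by (auto simp: R_def)
    then have "lin_ext fscale (\<lambda>w. word (j # w)) (word (i # w) - R) \<in> ext_ideal"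
      using ext_ideal_Cons j by blast
    then have "word (j # i # w) - lin_ext fscale (\<lambda>w. word (j # w)) R \<in> ext_ideal"
      by (simp add: formal.lin_ext_linear)
    from ext_ideal_diff[OF ext_ideal_swap[OF assms(1) j w] ext_ideal_fscale[OF this, of "Q i j"]]
    have "word (i # j # w) + fscale (Q i j) (lin_ext fscale (\<lambda>w. word (j # w)) R) \<in> ext_ideal"
      by (simp add: formal.scale_right_diff_distrib del: fscale_single)
    moreover have "fscale (Q i j) (lin_ext fscale (\<lambda>w. word (j # w)) R)
        = - (if i \<in> set (j # w) then 0
      else fscale (\<Prod>t\<leftarrow>j # w. if t < i then - Q i t else 1) (word (insort i (j # w))))"
      using 3 by (auto simp: R_def formal.lin_ext_linear single_uminus)
    ultimately show ?thesis by simp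
  qed
qed

lemma ext_nf_cong:
  assumes "set w \<subseteq> {1..N}"
  shows "word w - ext_nf w \<in> ext_ideal"
  using assms
proof (induction w)
  case Nil
  then show ?case by (simp add: ext_nf_def ext_ideal_0)
next
  case (Cons i w)
  then have i: "i \<in> {1..N}" and w: "set w \<subseteq> {1..N}" and IH: "word w - ext_nf w \<in> ext_ideal"
    by auto
  have *: "word (i # w) - lin_ext fscale (\<lambda>w. word (i # w)) (ext_nf w) \<in> ext_ideal"
    using ext_ideal_Cons[OF IH i] by (simp add: formal.lin_ext_linear)
  have "lin_ext fscale (\<lambda>w. word (i # w)) (ext_nf w) - ext_nf (i # w) \<in> ext_ideal"
  proof (cases "distinct w")
    case True
    have "sorted_wrt (<) (sort w)"
      using True by (simp add: strict_sorted_iff)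
    from ext_ideal_fscale[OF ext_nf_insort[OF i _ this], of "inv_coeff (\<lambda>i j. - Q i j) w"] w
    have "fscale (inv_coeff (\<lambda>i j. - Q i j) w) (word (i # sort w) - (if i \<in> set w then 0
      else fscale (\<Prod>t\<leftarrow>sort w. if t < i then - Q i t else 1) (word (insort i (sort w))))) \<in> ext_ideal"
      by simp
    moreover have "(\<Prod>t\<leftarrow>sort w. if t < i then - Q i t else 1) = (\<Prod>t\<leftarrow>w. if t < i then - Q i t else 1)"
      by (rule prod_list_map_mset) simp
    ultimately show ?thesis
      using True by (auto simp: ext_nf_def formal.scale_right_diff_distrib ac_simps split: if_splits)
  next
    case False
    then show ?thesis by (simp add: ext_nf_def ext_ideal_0)
  qed
  from ext_ideal_add[OF * this] show ?case by simp
qed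

text \<open>The description by \<open>THE\<close> is legitimate because increasing words form a
  basis of the quotient: \<open>ext_nf_cong\<close> gives existence of the coefficients, and
  applying \<open>ext_nf\<close> to a second candidate gives uniqueness.\<close>

theorem ext_coeff_eq:
  assumes "I \<subseteq> {1..N}" "J \<subseteq> {1..N}"
  shows "ext_coeff N Q I J K = (if I \<inter> J = {} \<and> K = I \<union> J
    then cross_coeff (\<lambda>i j. - Q i j) (sorted_list_of_set I) (sorted_list_of_set J) else 0)"
proof -
  have fin: "finite I" "finite J" using assms finite_subset by auto
  define w where "w = sorted_list_of_set I @ sorted_list_of_set J"
  define c where "c K = (if I \<inter> J = {} \<and> K = I \<union> J then inv_coeff (\<lambda>i j. - Q i j) w else 0)" for K
  have dw: "distinct w \<longleftrightarrow> I \<inter> J = {}"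
    using fin by (simp add: w_def)
  have sw: "sort w = sorted_list_of_set (I \<union> J)" if "I \<inter> J = {}"
    using fin that by (intro sorted_distinct_set_unique) (auto simp: w_def)
  have sum: "(\<Sum>K\<in>Pow {1..N}. fscale (c K) (word (sorted_list_of_set K))) = ext_nf w"
  proof -
    have "(\<Sum>K\<in>Pow {1..N}. fscale (c K) (word (sorted_list_of_set K)))
        = (\<Sum>K\<in>{I \<union> J}. fscale (c K) (word (sorted_list_of_set K)))"
      by (rule sum.mono_neutral_right) (use assms in \<open>auto simp: c_def\<close>)
    then show ?thesis
      using dw sw by (auto simp: c_def ext_nf_def)
  qed
  have "ext_coeff N Q I J = c"
    unfolding ext_coeff_def w_def[symmetric]
  proof (rule the_equality)
    show "(\<forall>K. \<not> K \<subseteq> {1..N} \<longrightarrow> c K = 0) \<and>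
      word w - (\<Sum>K\<in>Pow {1..N}. fscale (c K) (word (sorted_list_of_set K))) \<in> ext_ideal"
      unfolding sum using ext_nf_cong[of w] assms fin by (auto simp: c_def w_def)
  next
    fix c' assume c': "(\<forall>K. \<not> K \<subseteq> {1..N} \<longrightarrow> c' K = 0) \<and>
      word w - (\<Sum>K\<in>Pow {1..N}. fscale (c' K) (word (sorted_list_of_set K))) \<in> ext_ideal"
    define D where "D = (\<Sum>K\<in>Pow {1..N}. fscale (c' K) (word (sorted_list_of_set K)))"
    have nf: "ext_nf (sorted_list_of_set K) = word (sorted_list_of_set K)" for K
      by (cases "finite K") (simp_all add: ext_nf_def inv_coeff_sorted sorted_sort_id)
    have "word w - ext_nf w - (word w - D) \<in> ext_ideal"
    proof (rule ext_ideal_diff)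
      show "word w - ext_nf w \<in> ext_ideal"
        using assms fin by (intro ext_nf_cong) (auto simp: w_def)
      show "word w - D \<in> ext_ideal"
        using c' unfolding D_def by blast
    qed
    then have "lin_ext fscale ext_nf (D - ext_nf w) = 0"
      by (intro ext_nf_ideal) simp
    then have "D = ext_nf w"
      by (simp add: D_def formal.lin_ext_linear nf sum[symmetric])
    then have eq: "D = (\<Sum>K\<in>Pow {1..N}. fscale (c K) (word (sorted_list_of_set K)))"
      by (rule trans[OF _ sum[symmetric]])
    \<comment> \<open>Distinct subsets have distinct sorted lists, so the coefficients can be read
      off from the formal sum.\<close>
    have look: "Poly_Mapping.lookup (\<Sum>K\<in>Pow {1..N}. fscale (d K) (word (sorted_list_of_set K)))
        (sorted_list_of_set K) = d K" if "K \<subseteq> {1..N}" for d :: "nat set \<Rightarrow> 'k" and K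
    proof -
      have "(sorted_list_of_set L = sorted_list_of_set K) = (L = K)" if "L \<subseteq> {1..N}" for L
        using that \<open>K \<subseteq> _\<close> by (metis finite_atLeastAtMost finite_subset set_sorted_list_of_set)
      then have "Poly_Mapping.lookup (\<Sum>K\<in>Pow {1..N}. fscale (d K) (word (sorted_list_of_set K)))
        (sorted_list_of_set K) = (\<Sum>L\<in>Pow {1..N}. if L = K then d L else 0)"
        by (auto simp: lookup_sum lookup_single when_def intro!: sum.cong)
      then show ?thesis using that by simp
    qed
    show "c' = c"
    proof
      fix K
      show "c' K = c K"
      proof (cases "K \<subseteq> {1..N}")
        case True
        then show ?thesis using look[OF True, of c'] look[OF True, of c] eq D_def by simp
      next
        case False
        then show ?thesis using c' assms by (auto simp: c_def)
      qed
    qed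
  qed
  then show ?thesis
    by (simp add: c_def w_def inv_coeff_append inv_coeff_sorted)
qed

end


subsection \<open>Normal forms in the quantum symmetric algebra\<close>

sublocale unital_algebra \<subseteq> V: vector_space "smul A"
  by (rule vector_space)

context unital_algebra
begin

lemma mul_0_left [simp]: "mul A 0 b = 0"
  using mul_add_left[of 0 0 b] by simp

lemma mul_0_right [simp]: "mul A a 0 = 0"
  using mul_add_right[of a 0 0] by simp

lemma mul_uminus_left: "mul A (- a) b = - mul A a b"
  by (rule minus_unique[symmetric]) (simp flip: mul_add_left)

lemma mul_uminus_right: "mul A a (- b) = - mul A a b"
  by (rule minus_unique[symmetric]) (simp flip: mul_add_right)

lemma mul_diff_left: "mul A (a - a') b = mul A a b - mul A a' b"
  using mul_add_left[of a "- a'" b] by (simp add: mul_uminus_left)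

lemma mul_diff_right: "mul A a (b - b') = mul A a b - mul A a b'"
  using mul_add_right[of a b "- b'"] by (simp add: mul_uminus_right)

lemma mul_sum_left: "mul A (sum f I) b = (\<Sum>i\<in>I. mul A (f i) b)"
  by (induction I rule: infinite_finite_induct) (simp_all add: mul_add_left)

lemma mul_sum_right: "mul A a (sum f I) = (\<Sum>i\<in>I. mul A a (f i))"
  by (induction I rule: infinite_finite_induct) (simp_all add: mul_add_right)

end

locale quantum_symmetric =
  fixes N :: nat and q :: "nat \<Rightarrow> nat \<Rightarrow> 'k::field_char_0"
    and A :: "('k, 'a::ab_group_add) alg" and x :: "nat \<Rightarrow> 'a"
  assumes parameters: "quantum_parameters N q"
    and symmetric: "quantum_symmetric_algebra N q A x"
begin

sublocale A: unital_algebra A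
  using symmetric unfolding quantum_symmetric_algebra_def presented_algebra_def by blast

lemma q_nonzero: "i \<in> {1..N} \<Longrightarrow> j \<in> {1..N} \<Longrightarrow> q i j \<noteq> 0"
  and q_inverse: "i \<in> {1..N} \<Longrightarrow> j \<in> {1..N} \<Longrightarrow> q j i = inverse (q i j)"
  and q_diag: "i \<in> {1..N} \<Longrightarrow> q i i = 1"
  using parameters unfolding quantum_parameters_def by blast+

lemma q_mult: "i \<in> {1..N} \<Longrightarrow> j \<in> {1..N} \<Longrightarrow> q i j * q j i = 1"
  by (simp add: q_inverse[of i j] q_nonzero)

abbreviation "relations \<equiv> {word [i, j] - fscale (q i j) (word [j, i]) | i j. i \<in> {1..N} \<and> j \<in> {1..N}}"

abbreviation "ev \<equiv> eval_free A x"

definition mon :: "nat list \<Rightarrow> 'a" where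
  "mon w = foldr (\<lambda>i a. mul A (x i) a) w (unity A)"

lemma mon_Nil [simp]: "mon [] = unity A"
  and mon_Cons [simp]: "mon (i # w) = mul A (x i) (mon w)"
  by (simp_all add: mon_def)

lemma ev_eq: "ev = lin_ext (smul A) mon"
  unfolding eval_free_def mon_def ..

lemma ev_surj: "\<exists>P\<in>free_algebra N. ev P = a"
  using symmetric unfolding quantum_symmetric_algebra_def presented_algebra_def
  by (metis UNIV_I image_iff)

lemma ev_eq_0_iff: "P \<in> free_algebra N \<Longrightarrow> ev P = 0 \<longleftrightarrow> P \<in> free_ideal N relations"
  using symmetric unfolding quantum_symmetric_algebra_def presented_algebra_def by blast

lemma x_commute:
  assumes "i \<in> {1..N}" "j \<in> {1..N}"
  shows "mul A (x i) (x j) = smul A (q i j) (mul A (x j) (x i))"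
proof -
  let ?P = "word [i, j] - fscale (q i j) (word [j, i]) :: nat list \<Rightarrow>\<^sub>0 'k"
  have "lin_ext fscale (\<lambda>w. word ([] @ w @ [])) ?P \<in> free_ideal N relations"
    by (rule free_ideal_base) (use assms in auto)
  moreover have "?P \<in> free_algebra N"
    using assms by (intro free_algebra_diff free_algebra_fscale free_algebra_word) auto
  ultimately have "ev ?P = 0"
    by (simp add: ev_eq_0_iff lin_ext_word)
  then show ?thesis
    by (simp add: ev_eq A.V.lin_ext_linear A.mul_unity del: fscale_single)
qed

lemma x_commute_mul:
  assumes "i \<in> {1..N}" "j \<in> {1..N}"
  shows "mul A (x i) (mul A (x j) a) = smul A (q i j) (mul A (x j) (mul A (x i) a))"
  by (metis A.mul_assoc A.mul_smul_left assms x_commute)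

lemma mon_insort:
  assumes "i \<in> {1..N}" "set w \<subseteq> {1..N}" "sorted w"
  shows "mon (i # w) = smul A (\<Prod>t\<leftarrow>w. if t < i then q i t else 1) (mon (insort i w))"
  using assms(2,3)
proof (induction w)
  case Nil
  then show ?case by simp
next
  case (Cons j w)
  show ?case
  proof (cases "i \<le> j")
    case True
    then have "(\<Prod>t\<leftarrow>j # w. if t < i then q i t else 1) = 1"
      by (intro prod_list_map_one) (use Cons.prems in auto)
    then show ?thesis using True by simp
  next
    case False
    then show ?thesis using Cons assms(1)
      by (simp add: x_commute_mul A.mul_smul_right)
  qed
qed

lemma mon_sort: "set w \<subseteq> {1..N} \<Longrightarrow> mon w = smul A (inv_coeff q w) (mon (sort w))"
proof (induction w)
  case Nil
  then show ?case by simp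
next
  case (Cons i w)
  have "(\<Prod>t\<leftarrow>sort w. if t < i then q i t else 1) = (\<Prod>t\<leftarrow>w. if t < i then q i t else 1)"
    by (rule prod_list_map_mset) simp
  then show ?case
    using Cons mon_insort[of i "sort w"] by (simp add: A.mul_smul_right mult.commute)
qed

definition word_nf :: "nat list \<Rightarrow> (nat list \<Rightarrow>\<^sub>0 'k)" where
  "word_nf w = Poly_Mapping.single (sort w) (inv_coeff q w)"

text \<open>The independence half of the basis theorem for sorted monomials. The normal form is
  prescribed on all words at once, so invariance under each relation replaces a confluence
  argument.\<close>

lemma word_nf_ideal:
  assumes "P \<in> free_ideal N relations"
  shows "lin_ext fscale word_nf P = 0"
  using assms
proof (rule formal.lin_ext_free_ideal)
  fix P :: "nat list \<Rightarrow>\<^sub>0 'k" and u v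
  assume "P \<in> relations"
  then obtain i j where ij: "i \<in> {1..N}" "j \<in> {1..N}"
    and P: "P = word [i, j] - fscale (q i j) (word [j, i])"
    by blast
  have "word_nf (u @ [i, j] @ v) = fscale (q i j) (word_nf (u @ [j, i] @ v))"
  proof (cases "i = j")
    case True
    then show ?thesis using ij q_diag by (simp add: word_nf_def)
  next
    case False
    have "sort (u @ [i, j] @ v) = sort (u @ [j, i] @ v)"
      by (rule properties_for_sort) (simp_all add: ac_simps)
    moreover have "inv_coeff q (u @ [i, j] @ v) = q i j * inv_coeff q (u @ [j, i] @ v)"
      by (rule inv_coeff_swap) (use False ij q_mult in auto)
    ultimately show ?thesis
      by (simp add: word_nf_def)
  qed
  then show "lin_ext fscale (\<lambda>w. word_nf (u @ w @ v)) P = 0"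
    by (simp add: P formal.lin_ext_linear del: fscale_single)
qed

text \<open>Coordinates with respect to sorted monomials. The chosen representative is irrelevant by
  \<open>nf_ev\<close>.\<close>

definition nf :: "'a \<Rightarrow> (nat list \<Rightarrow>\<^sub>0 'k)" where
  "nf a = lin_ext fscale word_nf (SOME P. P \<in> free_algebra N \<and> ev P = a)"

lemma nf_ev:
  assumes "P \<in> free_algebra N"
  shows "nf (ev P) = lin_ext fscale word_nf P"
proof -
  define P' where "P' = (SOME P'. P' \<in> free_algebra N \<and> ev P' = ev P)"
  have P': "P' \<in> free_algebra N \<and> ev P' = ev P"
    unfolding P'_def by (rule someI[of _ P]) (simp add: assms)
  have "P' - P \<in> free_ideal N relations"
    using P' assms by (subst ev_eq_0_iff[symmetric])
      (simp_all add: free_algebra_diff ev_eq A.V.lin_ext_linear)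
  then have "lin_ext fscale word_nf (P' - P) = 0"
    by (rule word_nf_ideal)
  then show ?thesis
    by (simp add: nf_def P'_def formal.lin_ext_linear)
qed

lemma nf_add: "nf (a + b) = nf a + nf b"
proof -
  obtain P P' where "P \<in> free_algebra N" "P' \<in> free_algebra N" "ev P = a" "ev P' = b"
    using ev_surj by metis
  then show ?thesis
    using nf_ev[of "P + P'"] nf_ev[of P] nf_ev[of P']
    by (simp add: free_algebra_add ev_eq A.V.lin_ext_linear formal.lin_ext_linear)
qed

lemma nf_smul: "nf (smul A c a) = fscale c (nf a)"
proof -
  obtain P where "P \<in> free_algebra N" "ev P = a"
    using ev_surj by metis
  then show ?thesis
    using nf_ev[of "fscale c P"] nf_ev[of P]
    by (simp add: free_algebra_fscale ev_eq A.V.lin_ext_linear formal.lin_ext_linear)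
qed

definition sorted_words :: "nat list set" where
  "sorted_words = {w. sorted w \<and> set w \<subseteq> {1..N}}"

lemma nf_mon:
  assumes "w \<in> sorted_words"
  shows "nf (mon w) = word w"
  using nf_ev[of "word w"] assms
  by (simp add: sorted_words_def free_algebra_word ev_eq word_nf_def inv_coeff_sorted sorted_sort_id)

lemma keys_nf: "Poly_Mapping.keys (nf a) \<subseteq> sorted_words"
proof -
  obtain P where P: "P \<in> free_algebra N" "ev P = a"
    using ev_surj by metis
  have "Poly_Mapping.lookup (nf a) v = 0" if "v \<notin> sorted_words" for v
  proof -
    have "Poly_Mapping.lookup (word_nf w) v = 0" if "w \<in> Poly_Mapping.keys P" for w
    proof -
      have "set w \<subseteq> {1..N}"
        using P(1) that by (auto simp: free_algebra_def)
      then have "sort w \<in> sorted_words"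
        by (simp add: sorted_words_def)
      then show ?thesis
        using \<open>v \<notin> sorted_words\<close> by (auto simp: word_nf_def lookup_single when_def)
    qed
    then show ?thesis
      using nf_ev[OF P(1)] P(2)
      by (simp add: lin_ext_def lookup_sum lookup_fscale)
  qed
  then show ?thesis by (auto simp: in_keys_iff)
qed

text \<open>Together with \<open>nf_mon\<close> and \<open>keys_nf\<close>: the sorted monomials are
  a basis of \<open>A\<close>, so linear maps on \<open>A\<close> may be defined by their values on
  them.\<close>

lemma ev_nf: "lin_ext (smul A) mon (nf a) = a"
proof -
  obtain P where P: "P \<in> free_algebra N" "ev P = a"
    using ev_surj by metis
  have "lin_ext (smul A) mon (nf a) = lin_ext (smul A) (\<lambda>w. lin_ext (smul A) mon (word_nf w)) P"
    using nf_ev[OF P(1)] P(2) by (simp add: A.V.lin_ext_lin_ext)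
  also have "\<dots> = lin_ext (smul A) mon P"
    by (rule lin_ext_cong) (use P(1) in \<open>auto simp: word_nf_def free_algebra_def mon_sort[symmetric]\<close>)
  finally show ?thesis using P(2) by (simp add: ev_eq)
qed

end


subsection \<open>The bar differential on functions of lists\<close>

text \<open>A sign without scalars, so that the bar differential makes sense for functions into any
  abelian group, formal sums and \<open>B\<close> alike.\<close>

definition alt :: "nat \<Rightarrow> 'c::ab_group_add \<Rightarrow> 'c" where
  "alt n y = (if even n then y else - y)"

lemma alt_Suc [simp]: "alt (Suc n) y = - alt n y"
  and alt_0 [simp]: "alt 0 y = y"
  and alt_zero [simp]: "alt n 0 = 0"
  and alt_alt [simp]: "alt n (alt n y) = y"
  and alt_add: "alt n (y + z) = alt n y + alt n z"
  and alt_diff: "alt n (y - z) = alt n y - alt n z"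
  and alt_uminus: "alt n (- y) = - alt n y"
  by (simp_all add: alt_def)

lemma (in vector_space) scale_alt: "scale ((- 1) ^ n) y = alt n y"
  by (cases "even n") (simp_all add: alt_def)

text \<open>The bar differential acting on functionals by precomposition, in all degrees at once.
  Stripping the first factor turns arguments about merge positions into inductions on lists;
  \<open>bd_eq\<close> recovers the alternating sum.\<close>

fun bd :: "('k, 'a) alg \<Rightarrow> ('a list \<Rightarrow> 'c::ab_group_add) \<Rightarrow> 'a list \<Rightarrow> 'c" where
  "bd A g (a # b # as) = g (mul A a b # as) - bd A (\<lambda>l. g (a # l)) (b # as)"
| "bd A g [a] = 0"
| "bd A g [] = 0"

lemma merge_at_0: "merge_at A 0 (a # b # as) = mul A a b # as"
  and merge_at_Suc: "merge_at A (Suc i) (a # as) = a # merge_at A i as"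
  by (simp_all add: merge_at_def)

lemma (in vector_space) bd_eq:
  "(\<Sum>i<length as - 1. scale ((- 1) ^ i) (g (merge_at A i as))) = bd A g as"
proof (induction A g as rule: bd.induct)
  case (1 A g a b as)
  have "(\<Sum>i<length (a # b # as) - 1. scale ((- 1) ^ i) (g (merge_at A i (a # b # as))))
      = g (mul A a b # as) - (\<Sum>i<length as. scale ((- 1) ^ i) (g (a # merge_at A i (b # as))))"
    by (simp add: sum.lessThan_Suc_shift merge_at_0 merge_at_Suc sum_negf del: sum.lessThan_Suc)
  then show ?case using 1 by simp
qed simp_all

lemma bd_cong:
  "(\<And>l. Suc (length l) = length as \<Longrightarrow> g l = g' l) \<Longrightarrow> bd A g as = bd A g' as"
  by (induction A g as arbitrary: g' rule: bd.induct) (simp_all, blast?)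

lemma bd_hom:
  assumes "\<And>u v. p (u - v) = p u - p v"
  shows "p (bd A g as) = bd A (\<lambda>l. p (g l)) as"
proof -
  have "p 0 = 0" using assms[of 0 0] by simp
  then show ?thesis
    by (induction A g as rule: bd.induct) (simp_all add: assms)
qed

lemma bd_add: "bd A (\<lambda>l. g l + g' l) as = bd A g as + bd A g' as"
  by (induction A g as arbitrary: g' rule: bd.induct) simp_all

lemma bd_diff: "bd A (\<lambda>l. g l - g' l) as = bd A g as - bd A g' as"
  by (induction A g as arbitrary: g' rule: bd.induct) simp_all

lemma bd_alt: "bd A (\<lambda>l. alt n (g l)) as = alt n (bd A g as)"
  by (rule bd_hom[symmetric]) (simp add: alt_diff)

lemma bd_zero [simp]: "bd A (\<lambda>l. 0) as = 0"
  using bd_diff[of A "\<lambda>l. 0" "\<lambda>l. 0" as] by simp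

text \<open>The recursion of \<open>bd\<close> works at the left end, whereas the contraction and
  the chain map to the Koszul resolution work at the right end; this identity mediates.\<close>

lemma bd_snoc:
  "bd A g (as @ [c, a]) = bd A (\<lambda>l. g (l @ [a])) (as @ [c]) + alt (length as) (g (as @ [mul A c a]))"
proof (induction as arbitrary: g)
  case (Cons b as)
  then show ?case by (cases as) simp_all
qed simp

text \<open>Precomposition with the contraction of the bar resolution. The sign absorbs the
  alternation of the last face, which makes the homotopy identity free of signs.\<close>

definition tapp :: "('k, 'a) alg \<Rightarrow> ('a list \<Rightarrow> 'c::ab_group_add) \<Rightarrow> 'a list \<Rightarrow> 'c" where
  "tapp A g as = alt (length as - 1) (g (as @ [unity A]))"

text \<open>Precomposition with right multiplication by \<open>a\<close>. Only nonempty lists are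
  ever passed to \<open>g\<close>, so functionals that agree there have equal shifts.\<close>

definition rsh :: "('k, 'a) alg \<Rightarrow> 'a \<Rightarrow> ('a list \<Rightarrow> 'c) \<Rightarrow> 'a list \<Rightarrow> 'c" where
  "rsh A a g as = g (butlast as @ [mul A (last as) a])"

lemma rsh_snoc [simp]: "rsh A a g (as @ [b]) = g (as @ [mul A b a])"
  by (simp add: rsh_def)

context unital_algebra
begin

text \<open>Merging the appended unit with the last factor returns the list; all other merges take
  place inside it.\<close>

lemma tapp_contraction:
  assumes "as \<noteq> []"
  shows "tapp A (bd A g) as = g as - bd A (tapp A g) as"
proof -
  obtain bs c where as: "as = bs @ [c]"
    using assms rev_exhaust by blast
  have "bd A (tapp A g) as = - alt (length bs) (bd A (\<lambda>l. g (l @ [unity A])) as)"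
  proof (cases "bs = []")
    case False
    have "bd A (tapp A g) as = bd A (\<lambda>l. alt (length bs - 1) (g (l @ [unity A]))) as"
      by (rule bd_cong) (simp add: as tapp_def)
    then show ?thesis using False
      by (cases "length bs") (simp_all add: bd_alt)
  qed (simp add: as)
  then show ?thesis
    by (simp add: as tapp_def bd_snoc mul_unity alt_add)
qed

lemma rsh_rsh: "rsh A a (rsh A b g) = rsh A (mul A a b) g"
  by (rule ext) (simp add: rsh_def mul_assoc)

lemma bd_rsh:
  assumes "length as \<ge> 2"
  shows "bd A (rsh A a g) as = rsh A a (bd A g) as"
proof -
  obtain bs c d where as: "as = bs @ [c, d]"
  proof -
    from assms obtain cs d where cs: "as = cs @ [d]" by (cases as rule: rev_cases) auto
    with assms obtain bs c where "cs = bs @ [c]" by (cases cs rule: rev_cases) auto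
    with cs show ?thesis using that by simp
  qed
  have "bd A (rsh A a g) as = bd A (\<lambda>l. g (l @ [mul A d a])) (bs @ [c]) + alt (length bs) (g (bs @ [mul A (mul A c d) a]))"
    unfolding as bd_snoc by simp
  also have "\<dots> = bd A g (bs @ [c, mul A d a])"
    unfolding bd_snoc by (simp add: mul_assoc)
  finally show ?thesis
    using rsh_snoc[of A a "bd A g" "bs @ [c]" d] by (simp add: as)
qed

text \<open>Induction on length instead of cancellation in a double sum. The last factor is shifted
  into \<open>g\<close>, leaving a trailing unit, that is, a value of the contraction. Two uses of
  \<open>tapp_contraction\<close> then reduce the claim to the same one for \<open>tapp A ?g\<close>
  on a shorter list.\<close>

lemma bd_bd: "bd A (bd A g) as = 0"
proof (induction "length as" arbitrary: as g)
  case 0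
  then show ?case by simp
next
  case (Suc n)
  then obtain bs a where as: "as = bs @ [a]"
    by (cases as rule: rev_cases) auto
  consider "length bs \<le> 1" | "length bs \<ge> 2" by linarith
  then show ?case
  proof cases
    case 1
    have "bd A (bd A g) as = bd A (\<lambda>l. 0) as"
    proof (rule bd_cong)
      fix l :: "'a list" assume "Suc (length l) = length as"
      then have "length l \<le> 1" using 1 by (simp add: as)
      then have "l = [] \<or> (\<exists>a. l = [a])" by (cases l) auto
      then show "bd A g l = 0" by auto
    qed
    then show ?thesis by simp
  next
    case 2
    let ?g = "rsh A a g"
    have "bd A (bd A g) as = rsh A a (bd A (bd A g)) (bs @ [unity A])"
      by (simp add: as unity_mul)
    also have "\<dots> = bd A (rsh A a (bd A g)) (bs @ [unity A])"
      using 2 by (subst bd_rsh) simp_all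
    also have "\<dots> = bd A (bd A ?g) (bs @ [unity A])"
      by (rule bd_cong, rule bd_rsh[symmetric]) (use 2 in simp)
    also have "\<dots> = alt (length bs - 1) (tapp A (bd A (bd A ?g)) bs)"
      by (simp add: tapp_def)
    also have "tapp A (bd A (bd A ?g)) bs = bd A ?g bs - bd A (tapp A (bd A ?g)) bs"
      using 2 by (intro tapp_contraction) auto
    also have "bd A (tapp A (bd A ?g)) bs = bd A (\<lambda>l. ?g l - bd A (tapp A ?g) l) bs"
      by (rule bd_cong, rule tapp_contraction) (use 2 in auto)
    also have "\<dots> = bd A ?g bs"
      using Suc.hyps(1)[of bs "tapp A ?g"] Suc.hyps(2) by (simp add: bd_diff as)
    finally show ?thesis by simp
  qed
qed

end


subsection \<open>Left linear functionals\<close>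

context bimodule_algebra
begin

lemma l_0_left [simp]: "l 0 b = 0"
  using l_add_left[of 0 0 b] by simp

lemma l_0_right [simp]: "l a 0 = 0"
  using l_add_right[of a 0 0] by simp

lemma r_0_left [simp]: "r 0 a = 0"
  using r_add_left[of 0 0 a] by simp

lemma r_0_right [simp]: "r b 0 = 0"
  using r_add_right[of b 0 0] by simp

lemma l_uminus_right: "l a (- b) = - l a b"
  by (rule minus_unique[symmetric]) (simp flip: l_add_right)

lemma r_uminus_left: "r (- b) a = - r b a"
  by (rule minus_unique[symmetric]) (simp flip: r_add_left)

lemma l_diff_right: "l a (b - b') = l a b - l a b'"
  using l_add_right[of a b "- b'"] by (simp add: l_uminus_right)

lemma r_diff_left: "r (b - b') a = r b a - r b' a"
  using r_add_left[of b "- b'" a] by (simp add: r_uminus_left)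

lemma l_sum_right: "l a (sum f I) = (\<Sum>i\<in>I. l a (f i))"
  by (induction I rule: infinite_finite_induct) (simp_all add: l_add_right)

lemma r_sum_left: "r (sum f I) a = (\<Sum>i\<in>I. r (f i) a)"
  by (induction I rule: infinite_finite_induct) (simp_all add: r_add_left)

definition lin :: "('a \<Rightarrow> 'b) \<Rightarrow> bool" where
  "lin p \<longleftrightarrow> (\<forall>a a'. p (a + a') = p a + p a') \<and> (\<forall>c a. p (smul A c a) = smul B c (p a))"

lemma linI:
  "(\<And>a a'. p (a + a') = p a + p a') \<Longrightarrow> (\<And>c a. p (smul A c a) = smul B c (p a)) \<Longrightarrow> lin p"
  by (simp add: lin_def)

lemma lin_add: "lin p \<Longrightarrow> p (a + a') = p a + p a'"
  and lin_smul: "lin p \<Longrightarrow> p (smul A c a) = smul B c (p a)"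
  by (simp_all add: lin_def)

lemma lin_0: "lin p \<Longrightarrow> p 0 = 0"
  using lin_add[of p 0 0] by simp

lemma lin_lin_ext: "lin p \<Longrightarrow> p (lin_ext (smul A) g P) = lin_ext (smul B) (\<lambda>w. p (g w)) P"
  by (rule lin_ext_hom) (simp_all add: lin_0 lin_add lin_smul)

text \<open>Endomorphisms of \<open>B\<close> as a left module. The instances that matter are
  scalars and \<open>r _ a\<close>: commuting with all of these makes an operator linear and
  compatible with the right action.\<close>

definition left_hom :: "('b \<Rightarrow> 'b) \<Rightarrow> bool" where
  "left_hom p \<longleftrightarrow> (\<forall>b b'. p (b + b') = p b + p b') \<and> (\<forall>c b. p (smul B c b) = smul B c (p b))
     \<and> (\<forall>a b. p (l a b) = l a (p b))"

lemma left_hom_add: "left_hom p \<Longrightarrow> p (b + b') = p b + p b'"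
  and left_hom_smul: "left_hom p \<Longrightarrow> p (smul B c b) = smul B c (p b)"
  and left_hom_l: "left_hom p \<Longrightarrow> p (l a b) = l a (p b)"
  by (simp_all add: left_hom_def)

lemma left_hom_0: "left_hom p \<Longrightarrow> p 0 = 0"
  using left_hom_add[of p 0 0] by simp

lemma left_hom_uminus: "left_hom p \<Longrightarrow> p (- b) = - p b"
  by (rule minus_unique[symmetric]) (simp add: left_hom_0 flip: left_hom_add)

lemma left_hom_diff: "left_hom p \<Longrightarrow> p (b - b') = p b - p b'"
  using left_hom_add[of p b "- b'"] by (simp add: left_hom_uminus)

lemma left_hom_alt: "left_hom p \<Longrightarrow> p (alt n b) = alt n (p b)"
  by (simp add: alt_def left_hom_uminus)

lemma left_hom_sum: "left_hom p \<Longrightarrow> p (sum f I) = (\<Sum>i\<in>I. p (f i))"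
  by (induction I rule: infinite_finite_induct) (simp_all add: left_hom_0 left_hom_add)

lemma left_hom_lin_ext: "left_hom p \<Longrightarrow> p (lin_ext (smul B) g P) = lin_ext (smul B) (\<lambda>w. p (g w)) P"
  by (rule lin_ext_hom) (simp_all add: left_hom_0 left_hom_add left_hom_smul)

lemma left_hom_r: "left_hom (\<lambda>b. r b a)"
  by (simp add: left_hom_def r_add_left r_smul_left l_r)

lemma left_hom_smulI: "left_hom (smul B c)"
  by (simp add: left_hom_def B.V.scale_right_distrib l_smul_right mult.commute)

definition multilinear :: "('a list \<Rightarrow> 'b) \<Rightarrow> bool" where
  "multilinear g \<longleftrightarrow> (\<forall>us vs. lin (\<lambda>a. g (us @ [a] @ vs)))"

lemma multilinearD: "multilinear g \<Longrightarrow> lin (\<lambda>a. g (us @ [a] @ vs))"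
  by (simp add: multilinear_def)

lemma multilinear_Cons: "multilinear g \<Longrightarrow> multilinear (\<lambda>l. g (a # l))"
  using multilinearD[of g "a # _"] by (simp add: multilinear_def)

text \<open>Lists of length one are included: they carry the augmentation term \<open>A\<close> of
  the bar complex. Cochains vanish there, but functionals produced by \<open>tapp\<close> need
  not.\<close>

definition left_linear :: "('a list \<Rightarrow> 'b) \<Rightarrow> bool" where
  "left_linear g \<longleftrightarrow> multilinear g \<and> (\<forall>a a' as. g (mul A a a' # as) = l a (g (a' # as)))"

lemma left_linear_multilinear: "left_linear g \<Longrightarrow> multilinear g"
  and left_linearD: "left_linear g \<Longrightarrow> g (mul A a a' # as) = l a (g (a' # as))"
  by (simp_all add: left_linear_def)

lemma lin_fun_add: "lin p \<Longrightarrow> lin p' \<Longrightarrow> lin (\<lambda>a. p a + p' a)"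
  by (simp add: lin_def B.V.scale_right_distrib)

lemma lin_fun_diff: "lin p \<Longrightarrow> lin p' \<Longrightarrow> lin (\<lambda>a. p a - p' a)"
  by (simp add: lin_def B.V.scale_right_diff_distrib)

lemma lin_fun_zero: "lin (\<lambda>a. 0)"
  by (simp add: lin_def)

lemma lin_fun_sum: "(\<And>i. i \<in> I \<Longrightarrow> lin (p i)) \<Longrightarrow> lin (\<lambda>a. \<Sum>i\<in>I. p i a)"
  by (induction I rule: infinite_finite_induct) (simp_all add: lin_fun_zero lin_fun_add)

lemma lin_left_hom: "left_hom h \<Longrightarrow> lin p \<Longrightarrow> lin (\<lambda>a. h (p a))"
  by (simp add: lin_def left_hom_add left_hom_smul)

lemma lin_l: "lin p \<Longrightarrow> lin (\<lambda>a. l c (p a))"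
  by (simp add: lin_def l_add_right l_smul_right)

lemma lin_mul_left: "lin p \<Longrightarrow> lin (\<lambda>a. p (mul A c a))"
  by (simp add: lin_def A.mul_add_right A.mul_smul_right)

lemma lin_mul_right: "lin p \<Longrightarrow> lin (\<lambda>a. p (mul A a c))"
  by (simp add: lin_def A.mul_add_left A.mul_smul_left)

lemma lin_r_right: "lin (r b)"
  by (simp add: lin_def r_add_right r_smul_right)

lemma lin_alt: "lin p \<Longrightarrow> lin (\<lambda>a. alt n (p a))"
  by (cases "even n") (simp_all add: lin_def alt_def B.V.scale_minus_right)

lemma multilinear_bd:
  assumes "multilinear g"
  shows "multilinear (bd A g)"
proof -
  have "lin (\<lambda>a. bd A g (us @ [a] @ vs))" for us vs
    using assms
  proof (induction us arbitrary: g)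
    case Nil
    have "g ((a + a') # l) = g (a # l) + g (a' # l)" "g (smul A c a # l) = smul B c (g (a # l))" for a a' c l
      using multilinearD[OF Nil, of "[]" l] by (simp_all add: lin_def)
    then have "lin (\<lambda>a. bd A (\<lambda>l. g (a # l)) (v # vs'))" for v vs'
      by (intro linI)
        (simp_all add: bd_add bd_hom[of "smul B _"] B.V.scale_right_diff_distrib)
    moreover have "lin (\<lambda>a. g (mul A a v # vs'))" for v vs'
      using lin_mul_right[OF multilinearD[OF Nil, of "[]" vs']] by simp
    ultimately show ?case
      by (cases vs) (simp_all add: lin_fun_zero lin_fun_diff)
  next
    case (Cons u us)
    have IH: "lin (\<lambda>a. bd A (\<lambda>l. g (u # l)) (us @ [a] @ vs))"
      using Cons by (blast intro: multilinear_Cons)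
    show ?case
    proof (cases us)
      case Nil
      then show ?thesis
        using IH lin_mul_left[OF multilinearD[OF Cons.prems, of "[]" vs], of u]
        by (simp add: lin_fun_diff)
    next
      case (Cons u' us')
      then show ?thesis
        using IH multilinearD[OF \<open>multilinear g\<close>, of "mul A u u' # us'" vs]
        by (simp add: lin_fun_diff)
    qed
  qed
  then show ?thesis by (simp add: multilinear_def)
qed

lemma left_linear_bd:
  assumes "left_linear g"
  shows "left_linear (bd A g)"
  unfolding left_linear_def
proof (intro conjI allI)
  show "multilinear (bd A g)"
    using assms by (simp add: multilinear_bd left_linear_multilinear)
  fix a a' as
  show "bd A g (mul A a a' # as) = l a (bd A g (a' # as))"
    by (cases as)
      (simp_all add: A.mul_assoc left_linearD[OF assms] l_diff_right bd_hom[of "l a"])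
qed

lemma multilinear_tapp: "multilinear g \<Longrightarrow> multilinear (tapp A g)"
  unfolding multilinear_def tapp_def using lin_alt by (simp add: )

lemma left_linear_tapp: "left_linear g \<Longrightarrow> left_linear (tapp A g)"
  by (simp add: left_linear_def multilinear_tapp) (simp add: tapp_def alt_def l_uminus_right)

lemma multilinear_rsh:
  assumes "multilinear g"
  shows "multilinear (rsh A c g)"
  unfolding multilinear_def
proof (intro allI)
  fix us vs
  show "lin (\<lambda>a. rsh A c g (us @ [a] @ vs))"
  proof (cases vs rule: rev_cases)
    case Nil
    then show ?thesis
      using lin_mul_right[OF multilinearD[OF assms, of us "[]"]] by simp
  next
    case (snoc vs' v)
    then show ?thesis
      using multilinearD[OF assms, of us "vs' @ [mul A v c]"]
      using rsh_snoc[of A c g "us @ _ # vs'" v] by simp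
  qed
qed

lemma left_linear_rsh:
  assumes "left_linear g"
  shows "left_linear (rsh A c g)"
  unfolding left_linear_def
proof (intro conjI allI)
  show "multilinear (rsh A c g)"
    using assms by (simp add: multilinear_rsh left_linear_multilinear)
  fix a a' as
  show "rsh A c g (mul A a a' # as) = l a (rsh A c g (a' # as))"
    by (simp add: rsh_def A.mul_assoc left_linearD[OF assms])
qed

lemma left_linear_left_hom: "left_hom p \<Longrightarrow> left_linear g \<Longrightarrow> left_linear (\<lambda>l. p (g l))"
  by (auto simp: left_linear_def multilinear_def left_hom_l intro: lin_left_hom)

lemma left_linear_add: "left_linear g \<Longrightarrow> left_linear g' \<Longrightarrow> left_linear (\<lambda>l. g l + g' l)"
  by (auto simp: left_linear_def multilinear_def l_add_right intro: lin_fun_add)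

lemma left_linear_diff: "left_linear g \<Longrightarrow> left_linear g' \<Longrightarrow> left_linear (\<lambda>l. g l - g' l)"
  by (auto simp: left_linear_def multilinear_def l_diff_right intro: lin_fun_diff)

lemma rsh_add: "multilinear g \<Longrightarrow> rsh A (a + a') g = (\<lambda>l. rsh A a g l + rsh A a' g l)"
  and rsh_smul: "multilinear g \<Longrightarrow> rsh A (smul A c a) g = (\<lambda>l. smul B c (rsh A a g l))"
  by (rule ext, simp add: rsh_def A.mul_add_right A.mul_smul_right
      lin_add[OF multilinearD[of g _ "[]", simplified]] lin_smul[OF multilinearD[of g _ "[]", simplified]])+

text \<open>Multilinear functionals factor through the tensor power, so congruences modulo
  \<open>tensor_null\<close> become equalities of values.\<close>

lemma lin_ext_tensor_null:
  assumes "multilinear g" "P \<in> tensor_null A"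
  shows "lin_ext (smul B) g P = 0"
  using assms(2) unfolding tensor_null_def
proof (rule B.V.lin_ext_fspan)
  fix P assume "P \<in> {word (us @ [a + a'] @ vs) - word (us @ [a] @ vs) - word (us @ [a'] @ vs) | us a a' vs. True}
            \<union> {word (us @ [smul A c a] @ vs) - fscale c (word (us @ [a] @ vs)) | us c a vs. True}"
  then show "lin_ext (smul B) g P = 0"
    using lin_add[OF multilinearD[OF assms(1)]] lin_smul[OF multilinearD[OF assms(1)]]
    by (auto simp: B.V.lin_ext_linear simp del: fscale_single)
qed

lemma bar_diff_eq: "bar_diff A B f = bd A f"
  unfolding bar_diff_def by (rule ext) (rule B.V.bd_eq)

lemma lin_ext_tensor_ract: "lin_ext (smul B) g (tensor_ract A P a) = lin_ext (smul B) (rsh A a g) P"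
  by (simp add: tensor_ract_def B.V.lin_ext_lin_ext rsh_def[abs_def])

lemma lin_ext_tensor_lact:
  assumes "left_linear g" "\<And>as. as \<in> Poly_Mapping.keys P \<Longrightarrow> as \<noteq> []"
  shows "lin_ext (smul B) g (tensor_lact A a P) = l a (lin_ext (smul B) g P)"
proof -
  have "lin_ext (smul B) g (tensor_lact A a P) = lin_ext (smul B) (\<lambda>as. l a (g as)) P"
    unfolding tensor_lact_def B.V.lin_ext_lin_ext
    by (rule lin_ext_cong) (use assms in \<open>auto simp: left_linearD neq_Nil_conv\<close>)
  also have "\<dots> = l a (lin_ext (smul B) g P)"
    by (rule lin_ext_hom[symmetric]) (simp_all add: l_add_right l_smul_right)
  finally show ?thesis .
qed

end

lemma bar_boundary_eq: "bar_boundary A = lin_ext fscale (bd A word)"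
  unfolding bar_boundary_def formal.bd_eq[where g = word] ..

lemma (in bimodule_algebra) lin_ext_bar_boundary:
  "lin_ext (smul B) g (bar_boundary A P) = lin_ext (smul B) (bd A g) P"
  by (simp add: bar_boundary_eq B.V.lin_ext_lin_ext bd_hom[of "lin_ext (smul B) g"] B.V.lin_ext_linear)


subsection \<open>A contracting homotopy of the Koszul resolution\<close>

text \<open>Sign and scalar of the differential combined factor by factor. Inserting an index
  smaller than \<open>i\<close> thus changes the coefficient by a single factor, as the homotopy
  computation requires.\<close>

definition left_coeff :: "(nat \<Rightarrow> nat \<Rightarrow> 'k::field) \<Rightarrow> nat \<Rightarrow> nat set \<Rightarrow> 'k" where
  "left_coeff q i J = (\<Prod>t\<in>J - {i}. if t < i then - q t i else 1)"

text \<open>The indices below \<open>i\<close> carry the sign and those above carry the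
  scalars.\<close>

definition right_coeff :: "(nat \<Rightarrow> nat \<Rightarrow> 'k::field) \<Rightarrow> nat \<Rightarrow> nat set \<Rightarrow> 'k" where
  "right_coeff q i J = (\<Prod>t\<in>J - {i}. if i < t then q i t else - 1)"

lemma left_coeff_eq:
  assumes "finite J"
  shows "(- 1) ^ card {t \<in> J - {i}. t \<le> i} * (\<Prod>t\<in>{t \<in> J - {i}. t \<le> i}. q t i) = left_coeff q i J"
proof -
  have "(- 1) ^ card {t \<in> J - {i}. t \<le> i} * (\<Prod>t\<in>{t \<in> J - {i}. t \<le> i}. q t i)
      = (\<Prod>t\<in>{t \<in> J - {i}. t \<le> i}. - q t i)"
    using prod.distrib[of "\<lambda>t. - 1" "\<lambda>t. q t i" "{t \<in> J - {i}. t \<le> i}"] by simp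
  also have "\<dots> = (\<Prod>t\<in>J - {i}. if t \<le> i then - q t i else 1)"
    using assms by (intro prod.inter_filter) simp
  also have "\<dots> = left_coeff q i J"
    unfolding left_coeff_def by (rule prod.cong) auto
  finally show ?thesis .
qed

lemma right_coeff_eq:
  assumes "finite J"
  shows "(- 1) ^ card {t \<in> J - {i}. t \<le> i} * (\<Prod>t\<in>{t \<in> J - {i}. i \<le> t}. q i t) = right_coeff q i J"
proof -
  have "(- 1) ^ card {t \<in> J - {i}. t \<le> i} = (\<Prod>t\<in>{t \<in> J - {i}. t \<le> i}. - 1 :: 'a)"
    by simp
  also have "\<dots> = (\<Prod>t\<in>J - {i}. if t \<le> i then - 1 else 1)"
    using assms by (intro prod.inter_filter) simp
  moreover have "(\<Prod>t\<in>{t \<in> J - {i}. i \<le> t}. q i t) = (\<Prod>t\<in>J - {i}. if i \<le> t then q i t else 1)"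
    using assms by (intro prod.inter_filter) simp
  moreover have "(\<Prod>t\<in>J - {i}. (if t \<le> i then - 1 else 1) * (if i \<le> t then q i t else 1)) = right_coeff q i J"
    unfolding right_coeff_def by (rule prod.cong) auto
  ultimately show ?thesis
    by (simp only: prod.distrib)
qed

lemma (in vector_space) koszul_diff_eq:
  assumes "J \<subseteq> {1..N}"
  shows "koszul_diff N q x scale l r u J = (\<Sum>i\<in>J. scale (left_coeff q i J) (l (x i) (u (J - {i})))
      - scale (right_coeff q i J) (r (u (J - {i})) (x i)))"
  using assms finite_subset[OF assms finite_atLeastAtMost]
  by (simp only: koszul_diff_def if_True scale_right_diff_distrib scale_scale left_coeff_eq right_coeff_eq)

locale quantum_bimodule = quantum_symmetric N q A x + bimodule_algebra A B l r
  for N :: nat and q :: "nat \<Rightarrow> nat \<Rightarrow> 'k::field_char_0" and A :: "('k, 'a::ab_group_add) alg" and x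
    and B :: "('k, 'b::ab_group_add) alg" and l r
begin

text \<open>A function \<open>F\<close> stands for the left \<open>A\<close>-linear map from the Koszul resolution to \<open>B\<close> sending
  the element \<open>1 \<otimes> x\<^sup>\<and>\<^sup>J \<otimes> b\<close> to \<open>F J b\<close>.\<close>

definition linear_family :: "(nat set \<Rightarrow> 'a \<Rightarrow> 'b) \<Rightarrow> bool" where
  "linear_family F \<longleftrightarrow> (\<forall>J. lin (F J))"

text \<open>Precomposition with the Koszul differential. The right action of \<open>x i\<close> on a
  generator is absorbed by the coefficient \<open>b\<close>, which explains
  \<open>mul A (x i) b\<close>.\<close>

definition Kd :: "(nat set \<Rightarrow> 'a \<Rightarrow> 'b) \<Rightarrow> nat set \<Rightarrow> 'a \<Rightarrow> 'b" where
  "Kd F J b = (if J \<subseteq> {1..N} then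
     \<Sum>i\<in>J. smul B (left_coeff q i J) (l (x i) (F (J - {i}) b))
       - smul B (right_coeff q i J) (F (J - {i}) (mul A (x i) b)) else 0)"

abbreviation "rho k J \<equiv> \<Prod>t\<in>J. q k t"

text \<open>The homotopy is found by solving \<open>dh + hd = id\<close> for \<open>h (1 \<otimes> x\<^sup>\<and>\<^sup>J \<otimes> x\<^sub>k b)\<close>, where \<open>k\<close> is smaller
  than the elements of \<open>J\<close> and than the letters of \<open>b\<close>, and letting \<open>h\<close> vanish otherwise.\<close>

primrec Hw :: "(nat set \<Rightarrow> 'a \<Rightarrow> 'b) \<Rightarrow> nat set \<Rightarrow> nat list \<Rightarrow> 'b" where
  "Hw F J [] = 0"
| "Hw F J (k # w) = (if \<forall>t\<in>J. k < t
     then smul B (inverse (rho k J)) (l (x k) (Hw F J w) - F (insert k J) (mon w)) else 0)"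

definition H :: "(nat set \<Rightarrow> 'a \<Rightarrow> 'b) \<Rightarrow> nat set \<Rightarrow> 'a \<Rightarrow> 'b" where
  "H F J a = lin_ext (smul B) (Hw F J) (nf a)"

lemma lin_H: "lin (H F J)"
  by (simp add: lin_def H_def nf_add nf_smul B.V.lin_ext_linear)

lemma linear_family_H: "linear_family (H F)"
  by (simp add: linear_family_def lin_H)

lemma lin_Kd: "linear_family F \<Longrightarrow> lin (Kd F J)"
  unfolding Kd_def linear_family_def
  by (cases "J \<subseteq> {1..N}")
    (auto intro!: lin_fun_sum lin_fun_diff lin_l lin_mul_left lin_left_hom[OF left_hom_smulI] simp: lin_fun_zero)

lemma lin_eqI:
  assumes "lin p" "lin p'" "\<And>w. w \<in> sorted_words \<Longrightarrow> p (mon w) = p' (mon w)"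
  shows "p a = p' a"
proof -
  have "p a = lin_ext (smul B) (\<lambda>w. p (mon w)) (nf a)" "p' a = lin_ext (smul B) (\<lambda>w. p' (mon w)) (nf a)"
    using lin_lin_ext[OF assms(1), of mon "nf a"] lin_lin_ext[OF assms(2), of mon "nf a"]
    by (simp_all add: ev_nf)
  moreover have "lin_ext (smul B) (\<lambda>w. p (mon w)) (nf a) = lin_ext (smul B) (\<lambda>w. p' (mon w)) (nf a)"
    by (rule lin_ext_cong) (use keys_nf assms(3) in blast)
  ultimately show ?thesis by simp
qed

lemma H_mon: "w \<in> sorted_words \<Longrightarrow> H F J (mon w) = Hw F J w"
  by (simp add: H_def nf_mon)

lemma x_mon:
  assumes "i \<in> {1..N}" "w \<in> sorted_words"
  obtains c where "mul A (x i) (mon w) = smul A c (mon (insort i w))" "insort i w \<in> sorted_words"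
  using that mon_insort[of i w] assms
  by (auto simp: sorted_words_def set_insort_key sorted_insort)

text \<open>The first letter of \<open>w\<close> is not below \<open>j\<close>, so the condition in
  \<open>Hw\<close> fails.\<close>

lemma H_vanish:
  assumes "w \<in> sorted_words" "j \<in> J" "\<And>t. t \<in> set w \<Longrightarrow> j \<le> t"
  shows "H F J (mon w) = 0"
  unfolding H_mon[OF assms(1)] using assms(2,3) by (cases w) force+

lemma H_vanish_x:
  assumes "w \<in> sorted_words" "j \<in> J" "\<And>t. t \<in> set w \<Longrightarrow> j \<le> t" "i \<in> {1..N}" "j \<le> i"
  shows "H F J (mul A (x i) (mon w)) = 0"
proof -
  obtain c where c: "mul A (x i) (mon w) = smul A c (mon (insort i w))" "insort i w \<in> sorted_words"
    using x_mon assms by blast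
  have "H F J (mon (insort i w)) = 0"
    by (rule H_vanish[OF c(2) assms(2)]) (use assms in \<open>auto simp: set_insort_key\<close>)
  then show ?thesis
    by (simp add: c(1) lin_smul[OF lin_H])
qed

lemma H_step:
  assumes "w \<in> sorted_words" "k \<in> {1..N}" "\<And>t. t \<in> set w \<Longrightarrow> k \<le> t" "\<And>t. t \<in> J \<Longrightarrow> k < t"
  shows "H F J (mul A (x k) (mon w))
    = smul B (inverse (rho k J)) (l (x k) (H F J (mon w)) - F (insert k J) (mon w))"
proof -
  have "k # w \<in> sorted_words"
    using assms by (auto simp: sorted_words_def)
  from H_mon[OF this] show ?thesis
    using assms by (simp add: H_mon)
qed

text \<open>Since \<open>k\<close> does not exceed \<open>i\<close>, sorting \<open>x i\<close> into
  \<open>w\<close> leaves \<open>k\<close> as the smallest letter and costs only a scalar, which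
  linearity carries through the recursion.\<close>

lemma H_step_x:
  assumes "linear_family F" "w \<in> sorted_words" "k \<in> {1..N}" "\<And>t. t \<in> set w \<Longrightarrow> k \<le> t"
    "\<And>t. t \<in> J \<Longrightarrow> k < t" "i \<in> {1..N}" "k \<le> i"
  shows "H F J (mul A (x k) (mul A (x i) (mon w)))
    = smul B (inverse (rho k J)) (l (x k) (H F J (mul A (x i) (mon w)))
        - F (insert k J) (mul A (x i) (mon w)))"
proof -
  obtain c where c: "mul A (x i) (mon w) = smul A c (mon (insort i w))" "insort i w \<in> sorted_words"
    using x_mon assms by blast
  have F: "lin (F (insert k J))"
    using assms(1) by (simp add: linear_family_def)
  have "H F J (mul A (x k) (mon (insort i w))) = smul B (inverse (rho k J))
      (l (x k) (H F J (mon (insort i w))) - F (insert k J) (mon (insort i w)))"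
    by (rule H_step) (use assms c in \<open>auto simp: set_insort_key\<close>)
  then show ?thesis
    by (simp add: c(1) A.mul_smul_right lin_smul[OF lin_H] lin_smul[OF F] l_smul_right
        mult.commute flip: B.V.scale_right_diff_distrib)
qed

text \<open>The case in which \<open>h\<close> vanishes on the basis element itself and only
  \<open>hd\<close> remains. After removing any index other than \<open>j\<close>, the index
  \<open>j\<close> still blocks \<open>h\<close>. Removing \<open>j\<close> makes \<open>x j\<close>
  an admissible first letter, and the recursion of \<open>h\<close> was chosen so that this term
  returns the element.\<close>

lemma homotopy_mon_vanishing:
  assumes J: "J \<subseteq> {1..N}" and w: "w \<in> sorted_words" and j: "j \<in> J" "\<And>t. t \<in> J \<Longrightarrow> j \<le> t"
    "\<And>t. t \<in> set w \<Longrightarrow> j \<le> t"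
  shows "Kd (H F) J (mon w) = F J (mon w)"
proof -
  have fin: "finite J" using J finite_subset by auto
  have jN: "j \<in> {1..N}" using J j by auto
  define T where "T i = smul B (left_coeff q i J) (l (x i) (H F (J - {i}) (mon w)))
       - smul B (right_coeff q i J) (H F (J - {i}) (mul A (x i) (mon w)))" for i
  have "T i = 0" if "i \<in> J" "i \<noteq> j" for i
  proof -
    have "H F (J - {i}) (mon w) = 0"
      by (rule H_vanish[of _ j]) (use w j that in auto)
    moreover have "H F (J - {i}) (mul A (x i) (mon w)) = 0"
      by (rule H_vanish_x[of _ j]) (use w j that J in auto)
    ultimately show ?thesis by (simp add: T_def)
  qed
  then have "(\<Sum>i\<in>J. T i) = T j"
    using sum.remove[OF fin j(1), of T] by simp
  moreover have "left_coeff q j J = 1"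
    unfolding left_coeff_def by (rule prod.neutral) (use j(2) in fastforce)
  moreover have "right_coeff q j J = rho j (J - {j})"
    unfolding right_coeff_def by (rule prod.cong) (use j(2) in \<open>auto simp: le_less\<close>)
  moreover have "rho j (J - {j}) \<noteq> 0"
    using fin J jN q_nonzero by (auto simp: prod_zero_iff)
  moreover have "H F (J - {j}) (mul A (x j) (mon w)) = smul B (inverse (rho j (J - {j})))
      (l (x j) (H F (J - {j}) (mon w)) - F (insert j (J - {j})) (mon w))"
  proof (rule H_step[OF w jN])
    show "j < t" if "t \<in> J - {j}" for t
      using that j(2)[of t] by auto
  qed (use j in auto)
  ultimately have "(\<Sum>i\<in>J. T i) = F J (mon w)"
    using j by (simp add: T_def insert_absorb)
  then show ?thesis
    using J by (simp add: Kd_def T_def)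
qed

text \<open>Prefixing a letter \<open>k\<close> below \<open>J\<close>. The defect \<open>D\<close>
  of the homotopy identity is carried along so that one induction covers the augmented degree: it is
  0 for nonempty \<open>J\<close>, and for empty \<open>J\<close> the scalar is 1 and
  \<open>x k\<close> accumulates on the left.\<close>

lemma homotopy_mon_step:
  assumes F: "linear_family F" and J: "J \<subseteq> {1..N}" and w: "k # w \<in> sorted_words"
    and k: "\<And>t. t \<in> J \<Longrightarrow> k < t"
    and IH: "H (Kd F) J (mon w) + Kd (H F) J (mon w) = F J (mon w) - D"
  shows "H (Kd F) J (mon (k # w)) + Kd (H F) J (mon (k # w))
    = F J (mon (k # w)) - smul B (inverse (rho k J)) (l (x k) D)"
proof -
  have fin: "finite J" using J finite_subset by auto
  have kN: "k \<in> {1..N}" and w': "w \<in> sorted_words" and kw: "\<And>t. t \<in> set w \<Longrightarrow> k \<le> t"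
    using w by (auto simp: sorted_words_def)
  have kJ: "k \<notin> J" using k by blast
  let ?\<rho> = "rho k J"
  have \<rho>: "?\<rho> \<noteq> 0" using fin J kN q_nonzero by (auto simp: prod_zero_iff)
  define T where "T i = smul B (left_coeff q i J) (l (x i) (H F (J - {i}) (mon w)))
       - smul B (right_coeff q i J) (H F (J - {i}) (mul A (x i) (mon w)))" for i
  \<comment> \<open>These are the terms of the differential at \<open>insert k J\<close> that remove
    some \<open>i\<close> in \<open>J\<close>. They occur in both composites with opposite signs and
    cancel.\<close>
  define U where "U i = smul B (right_coeff q i J) (F (insert k (J - {i})) (mul A (x i) (mon w)))
       - smul B (q k i * left_coeff q i J) (l (x i) (F (insert k (J - {i})) (mon w)))" for i
  have 1: "smul B (left_coeff q i J) (l (x i) (H F (J - {i}) (mon (k # w))))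
       - smul B (right_coeff q i J) (H F (J - {i}) (mul A (x i) (mon (k # w))))
     = smul B (inverse ?\<rho>) (l (x k) (T i) + U i)" if "i \<in> J" for i
  proof -
    have iN: "i \<in> {1..N}" and ki: "k < i" using that J k by auto
    have 0: "?\<rho> = q k i * rho k (J - {i})"
      using fin that by (rule prod.remove)
    have q0: "q k i \<noteq> 0" "q i k \<noteq> 0" and qq: "q i k = inverse (q k i)"
      using q_nonzero iN kN q_inverse[OF kN iN] by blast+
    have \<rho>': "inverse (rho k (J - {i})) = inverse ?\<rho> * q k i"
      using q0 by (simp add: 0)
    have H1: "H F (J - {i}) (mul A (x k) (mon w)) = smul B (inverse ?\<rho> * q k i)
      (l (x k) (H F (J - {i}) (mon w)) - F (insert k (J - {i})) (mon w))"
      unfolding \<rho>'[symmetric] by (rule H_step) (use w' kN kw k in auto)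
    have "H F (J - {i}) (mul A (x i) (mul A (x k) (mon w)))
        = smul B (q i k) (H F (J - {i}) (mul A (x k) (mul A (x i) (mon w))))"
      by (simp add: x_commute_mul[OF iN kN] lin_smul[OF lin_H])
    also have "H F (J - {i}) (mul A (x k) (mul A (x i) (mon w))) = smul B (inverse ?\<rho> * q k i)
      (l (x k) (H F (J - {i}) (mul A (x i) (mon w))) - F (insert k (J - {i})) (mul A (x i) (mon w)))"
      unfolding \<rho>'[symmetric] by (rule H_step_x) (use F w' kN kw k iN ki in auto)
    finally have H2: "H F (J - {i}) (mul A (x i) (mul A (x k) (mon w))) = smul B (inverse ?\<rho>)
      (l (x k) (H F (J - {i}) (mul A (x i) (mon w))) - F (insert k (J - {i})) (mul A (x i) (mon w)))"
      using q0 by (simp add: qq)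
    have lx: "l (x i) (l (x k) b) = smul B (q i k) (l (x k) (l (x i) b))" for b
      using arg_cong[OF x_commute[OF iN kN], of "\<lambda>a. l a b"] by (simp add: l_mul l_smul_left)
    show ?thesis
      using q0 unfolding mon_Cons H1 H2 T_def U_def
      by (simp add: l_smul_right l_diff_right lx B.V.scale_right_diff_distrib
          B.V.scale_right_distrib qq ac_simps)
  qed
  have "Kd (H F) J (mon (k # w)) = smul B (inverse ?\<rho>) (l (x k) (\<Sum>i\<in>J. T i) + (\<Sum>i\<in>J. U i))"
    using J 1 by (simp add: Kd_def l_sum_right B.V.scale_sum_right sum.distrib B.V.scale_right_distrib)
  moreover have "(\<Sum>i\<in>J. T i) = Kd (H F) J (mon w)"
    using J by (simp add: Kd_def T_def)
  moreover have "H (Kd F) J (mon (k # w)) = smul B (inverse ?\<rho>)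
      (l (x k) (H (Kd F) J (mon w)) - Kd F (insert k J) (mon w))"
    unfolding mon_Cons by (rule H_step) (use w' kN kw k in auto)
  moreover have "Kd F (insert k J) (mon w)
      = l (x k) (F J (mon w)) - smul B ?\<rho> (F J (mon (k # w))) + (\<Sum>i\<in>J. U i)"
  proof -
    have "left_coeff q k (insert k J) = 1"
      unfolding left_coeff_def by (rule prod.neutral) (use k in fastforce)
    moreover have "right_coeff q k (insert k J) = ?\<rho>"
      unfolding right_coeff_def by (rule prod.cong) (use k kJ in auto)
    moreover have "smul B (left_coeff q i (insert k J)) (l (x i) (F (insert k J - {i}) (mon w)))
       - smul B (right_coeff q i (insert k J)) (F (insert k J - {i}) (mul A (x i) (mon w))) = U i"
      if "i \<in> J" for i
    proof -
      have "k < i" using that k by blast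
      then have 2: "insert k J - {i} = insert k (J - {i})" by auto
      have "left_coeff q i (insert k J) = - (q k i * left_coeff q i J)"
        "right_coeff q i (insert k J) = - right_coeff q i J"
        unfolding left_coeff_def right_coeff_def 2
        using fin kJ \<open>k < i\<close> by (simp_all add: prod.insert)
      then show ?thesis
        unfolding U_def 2 by (simp add: B.V.scale_minus_left)
    qed
    ultimately show ?thesis
      using J kN fin kJ unfolding Kd_def by simp
  qed
  ultimately have "H (Kd F) J (mon (k # w)) + Kd (H F) J (mon (k # w))
     = smul B (inverse ?\<rho>) (l (x k) (H (Kd F) J (mon w) + Kd (H F) J (mon w))
        - l (x k) (F J (mon w)) + smul B ?\<rho> (F J (mon (k # w))))"
    by (simp only: l_add_right B.V.scale_right_distrib B.V.scale_right_diff_distrib)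
      (simp add: algebra_simps)
  also have "\<dots> = F J (mon (k # w)) - smul B (inverse ?\<rho>) (l (x k) D)"
    unfolding IH using \<rho> by (simp add: l_diff_right B.V.scale_right_diff_distrib)
  finally show ?thesis .
qed

text \<open>The correction in degree 0 is the augmentation followed by its left linear section:
  \<open>1 \<otimes> a\<close> goes to \<open>a\<close> and then to
  \<open>a \<otimes> 1\<close>.\<close>

theorem koszul_homotopy:
  assumes F: "linear_family F" and J: "J \<subseteq> {1..N}"
  shows "H (Kd F) J a + Kd (H F) J a = F J a - (if J = {} then l a (F {} (unity A)) else 0)"
proof (rule lin_eqI[of "\<lambda>a. H (Kd F) J a + Kd (H F) J a"])
  show "lin (\<lambda>a. H (Kd F) J a + Kd (H F) J a)"
    by (intro lin_fun_add lin_H lin_Kd linear_family_H)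
  have "lin (\<lambda>a. l a b)" for b
    by (simp add: lin_def l_add_left l_smul_left)
  then show "lin (\<lambda>a. F J a - (if J = {} then l a (F {} (unity A)) else 0))"
    using F by (cases "J = {}") (auto intro!: lin_fun_diff lin_fun_zero simp: linear_family_def)
next
  fix w assume "w \<in> sorted_words"
  then show "H (Kd F) J (mon w) + Kd (H F) J (mon w)
      = F J (mon w) - (if J = {} then l (mon w) (F {} (unity A)) else 0)"
  proof (induction w)
    case Nil
    show ?case
    proof (cases "J = {}")
      case True
      then show ?thesis using Nil H_mon[OF Nil] by (simp add: Kd_def l_unity)
    next
      case False
      then have "Kd (H F) J (mon []) = F J (mon [])"
        using J Nil finite_subset[OF J] by (intro homotopy_mon_vanishing[of J "[]" "Min J"]) auto
      then show ?thesis using H_mon[OF Nil, of "Kd F" J] False by simp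
    qed
  next
    case (Cons k w)
    then have w: "w \<in> sorted_words" by (auto simp: sorted_words_def)
    show ?case
    proof (cases "\<forall>t\<in>J. k < t")
      case True
      then show ?thesis
        using homotopy_mon_step[OF F J Cons.prems _ Cons.IH[OF w]] by (auto simp: l_mul)
    next
      case False
      then obtain t where t: "t \<in> J" "t \<le> k" by (auto simp: not_less)
      \<comment> \<open>Some index of \<open>J\<close> is at most \<open>k\<close>, so
        \<open>Min J\<close> is at most every letter of the sorted word and \<open>h\<close>
        vanishes on it.\<close>
      then have "Min J \<le> k" using finite_subset[OF J] Min_le by (meson finite_atLeastAtMost order_trans)
      moreover have "Min J \<in> J"
        using t finite_subset[OF J] by (intro Min_in) auto
      ultimately have "Kd (H F) J (mon (k # w)) = F J (mon (k # w))"
        using J Cons.prems t finite_subset[OF J]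
        by (intro homotopy_mon_vanishing[of J _ "Min J"]) (auto simp: sorted_words_def)
      then show ?thesis using H_mon[OF Cons.prems, of "Kd F" J] False t by auto
    qed
  qed
qed

end


subsection \<open>A chain map from the bar resolution to the Koszul resolution\<close>

text \<open>Follows the recursion of \<open>Psi\<close>, which removes the last factor as long as at
  least three factors are present.\<close>

lemma snoc_induct2 [case_names Nil single pair snoc]:
  assumes "P []" "\<And>a. P [a]" "\<And>a b. P [a, b]"
    and step: "\<And>as b a. as \<noteq> [] \<Longrightarrow> P (as @ [b]) \<Longrightarrow> P (as @ [b, a])"
  shows "P as"
proof (induction "length as" arbitrary: as)
  case 0
  then show ?case using assms by simp
next
  case (Suc n)
  then obtain cs a where as: "as = cs @ [a]" by (cases as rule: rev_cases) auto
  show ?case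
  proof (cases cs rule: rev_cases)
    case Nil
    then show ?thesis using as assms by simp
  next
    case (snoc ds b)
    show ?thesis
    proof (cases "ds = []")
      case True
      then show ?thesis using as snoc assms by simp
    next
      case False
      have "P (ds @ [b])" using Suc as snoc by simp
      from step[OF False this] show ?thesis using as snoc by simp
    qed
  qed
qed

context quantum_symmetric
begin

text \<open>The exchange scalars of the dual generators in the quantum exterior algebra with
  parameters \<open>inverse (q i j)\<close>. On indices in range they equal
  \<open>- q j i\<close>.\<close>

abbreviation "e \<equiv> \<lambda>i j. - inverse (q i j)"

lemma inverse_q: "i \<in> {1..N} \<Longrightarrow> j \<in> {1..N} \<Longrightarrow> inverse (q i j) = q j i"
  using q_inverse by (rule sym)

end

context quantum_bimodule
begin

definition shr :: "'a \<Rightarrow> (nat set \<Rightarrow> 'a \<Rightarrow> 'b) \<Rightarrow> nat set \<Rightarrow> 'a \<Rightarrow> 'b" where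
  "shr a F J b = F J (mul A b a)"

lemma linear_family_shr: "linear_family F \<Longrightarrow> linear_family (shr a F)"
  by (simp add: linear_family_def shr_def[abs_def] lin_mul_right)

lemma shr_shr: "shr b (shr a F) = shr (mul A b a) F"
  by (intro ext) (simp add: shr_def A.mul_assoc)

lemma shr_Kd: "shr a (Kd F) = Kd (shr a F)"
  by (intro ext) (simp add: shr_def Kd_def A.mul_assoc)

lemma H_left_hom:
  assumes "left_hom p"
  shows "H (\<lambda>J b. p (F J b)) J a = p (H F J a)"
proof -
  have "Hw (\<lambda>J b. p (F J b)) J w = p (Hw F J w)" for w
    by (induction w) (simp_all add: left_hom_0[OF assms] left_hom_l[OF assms]
        left_hom_smul[OF assms] left_hom_diff[OF assms])
  then have "Hw (\<lambda>J b. p (F J b)) J = (\<lambda>w. p (Hw F J w))"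
    by blast
  then show ?thesis
    by (simp add: H_def left_hom_lin_ext[OF assms])
qed

lemma H_add: "H (\<lambda>J b. F J b + F' J b) J a = H F J a + H F' J a"
proof -
  have "Hw (\<lambda>J b. F J b + F' J b) J w = Hw F J w + Hw F' J w" for w
    by (induction w) (simp_all add: l_add_right algebra_simps flip: B.V.scale_right_distrib)
  then have "Hw (\<lambda>J b. F J b + F' J b) J = (\<lambda>w. Hw F J w + Hw F' J w)"
    by blast
  then show ?thesis
    by (simp add: H_def B.V.lin_ext_fun_add)
qed

text \<open>\<open>H F\<close> at \<open>J\<close> sees \<open>F\<close> only at sets with one more
  element: the homotopy raises the degree by one.\<close>

lemma H_eq_0:
  assumes "\<And>k b. k \<in> {1..N} \<Longrightarrow> k \<notin> J \<Longrightarrow> F (insert k J) b = 0"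
  shows "H F J a = 0"
proof -
  have "Hw F J w = 0" if "set w \<subseteq> {1..N}" for w
    using that by (induction w) (use assms in auto)
  then have "H F J a = lin_ext (smul B) (\<lambda>w. 0) (nf a)"
    unfolding H_def by (intro lin_ext_cong) (use keys_nf in \<open>auto simp: sorted_words_def\<close>)
  then show ?thesis by (simp add: lin_ext_def)
qed

text \<open>Reversed lists let pattern matching reach the last tensor factor, which is shifted into
  \<open>F\<close> before the homotopy is applied. The clause for two factors is degree 0.\<close>

fun Psi_rev :: "(nat set \<Rightarrow> 'a \<Rightarrow> 'b) \<Rightarrow> 'a list \<Rightarrow> 'b" where
  "Psi_rev F [a, b] = l b (F {} a)"
| "Psi_rev F (a # b # c # w) = alt (Suc (length w)) (Psi_rev (H (shr a F)) (b # c # w))"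
| "Psi_rev F [a] = 0"
| "Psi_rev F [] = 0"

definition Psi :: "(nat set \<Rightarrow> 'a \<Rightarrow> 'b) \<Rightarrow> 'a list \<Rightarrow> 'b" where
  "Psi F as = Psi_rev F (rev as)"

lemma Psi_Nil [simp]: "Psi F [] = 0"
  and Psi_single [simp]: "Psi F [a] = 0"
  and Psi_pair [simp]: "Psi F [b, a] = l b (F {} a)"
  by (simp_all add: Psi_def)

lemma Psi_snoc:
  assumes "as \<noteq> []"
  shows "Psi F (as @ [b, a]) = alt (length as) (Psi (H (shr a F)) (as @ [b]))"
proof -
  obtain cs c where "as = cs @ [c]" using assms rev_exhaust by blast
  then show ?thesis by (simp add: Psi_def)
qed

lemma Psi_left_hom: "left_hom p \<Longrightarrow> Psi (\<lambda>J b. p (F J b)) as = p (Psi F as)"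
proof (induction as arbitrary: F rule: snoc_induct2)
  case (snoc as b a)
  have "H (shr a (\<lambda>J b. p (F J b))) = (\<lambda>J b. p (H (shr a F) J b))"
    by (intro ext) (simp add: shr_def[abs_def] H_left_hom[OF snoc.prems])
  then show ?case
    using snoc by (simp add: Psi_snoc left_hom_alt)
qed (simp_all add: left_hom_0 left_hom_l)

lemma Psi_add: "Psi (\<lambda>J b. F J b + F' J b) as = Psi F as + Psi F' as"
proof (induction as arbitrary: F F' rule: snoc_induct2)
  case (snoc as b a)
  have "H (shr a (\<lambda>J b. F J b + F' J b)) = (\<lambda>J b. H (shr a F) J b + H (shr a F') J b)"
    by (intro ext) (simp add: shr_def[abs_def] H_add)
  then show ?case
    using snoc by (simp add: Psi_snoc alt_add)
qed (simp_all add: l_add_right)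

lemma Psi_diff: "Psi (\<lambda>J b. F J b - F' J b) as = Psi F as - Psi F' as"
  using Psi_add[of "\<lambda>J b. F J b - F' J b" F' as] by simp

text \<open>Each removed factor costs one application of \<open>H\<close>, hence one index. It
  allows an identity of functionals to be used when it holds only in one Koszul degree.\<close>

lemma Psi_degree:
  assumes "length as = m + 2" "\<And>J b. J \<subseteq> {1..N} \<Longrightarrow> card J = m \<Longrightarrow> F J b = 0"
  shows "Psi F as = 0"
  using assms
proof (induction as arbitrary: F m rule: snoc_induct2)
  case (snoc as b a)
  then obtain n where n: "m = Suc n" by (cases m) (auto simp: neq_Nil_conv)
  have "Psi (H (shr a F)) (as @ [b]) = 0"
  proof (rule snoc.IH)
    show "length (as @ [b]) = n + 2" using snoc.prems n by simp
    fix J b assume J: "J \<subseteq> {1..N}" "card J = n"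
    then have "finite J" using finite_subset by auto
    then show "H (shr a F) J b = 0"
      by (intro H_eq_0) (use J snoc.prems n in \<open>auto simp: shr_def\<close>)
  qed
  then show ?case using snoc by (simp add: Psi_snoc)
qed simp_all

lemma Psi_cong:
  assumes "\<And>J b. J \<subseteq> {1..N} \<Longrightarrow> F J b = F' J b"
  shows "Psi F as = Psi F' as"
proof (cases "length as < 2")
  case True
  then have "as = [] \<or> (\<exists>a. as = [a])" by (cases as) auto
  then show ?thesis by auto
next
  case False
  then have "length as = (length as - 2) + 2" by simp
  from Psi_degree[OF this, of "\<lambda>J b. F J b - F' J b"] assms show ?thesis
    by (simp add: Psi_diff)
qed

lemma Psi_shr: "Psi (shr a F) (as @ [b]) = Psi F (as @ [mul A b a])"
proof (cases as rule: rev_cases)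
  case (snoc cs c)
  then show ?thesis
    by (cases "cs = []") (simp_all add: shr_def Psi_snoc shr_shr)
qed simp

lemma lin_Psi_last:
  assumes "linear_family F"
  shows "lin (\<lambda>a. Psi F (us @ [a]))"
proof (cases us rule: rev_cases)
  case Nil
  then show ?thesis by (simp add: lin_fun_zero)
next
  case (snoc us' b)
  show ?thesis
  proof (cases "us' = []")
    case True
    then show ?thesis
      using assms snoc by (auto simp: linear_family_def intro: lin_l)
  next
    case False
    have "shr (a + a') F = (\<lambda>J b. shr a F J b + shr a' F J b)"
      "shr (smul A c a) F = (\<lambda>J b. smul B c (shr a F J b))" for a a' c
      using assms by (auto simp: linear_family_def shr_def fun_eq_iff A.mul_add_right
          A.mul_smul_right lin_add lin_smul)
    then have "lin (\<lambda>a. Psi (H (shr a F)) (us' @ [b]))"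
      by (intro linI)
        (simp_all add: H_add[abs_def] Psi_add H_left_hom[OF left_hom_smulI, abs_def]
          Psi_left_hom[OF left_hom_smulI])
    then show ?thesis
      using snoc False by (simp add: Psi_snoc lin_alt)
  qed
qed

lemma multilinear_Psi:
  assumes "linear_family F"
  shows "multilinear (Psi F)"
proof -
  have "lin (\<lambda>a. Psi F (us @ [a] @ vs))" for us vs
    using assms
  proof (induction vs arbitrary: F rule: rev_induct)
    case Nil
    then show ?case using lin_Psi_last by simp
  next
    case (snoc v vs)
    show ?case
    proof (cases "us @ vs = []")
      case True
      then show ?thesis
        by (simp add: lin_def l_add_left l_smul_left)
    next
      case False
      have "Psi F (us @ [a] @ vs @ [v]) = alt (length (us @ vs)) (Psi (H (shr v F)) (us @ [a] @ vs))" for a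
      proof (cases vs rule: rev_cases)
        case Nil
        then show ?thesis using Psi_snoc[of us F a v] False by simp
      next
        case (snoc vs' b)
        then show ?thesis using Psi_snoc[of "us @ [a] @ vs'" F b v] False by simp
      qed
      then show ?thesis
        using snoc.IH[OF linear_family_H] by (simp add: lin_alt)
    qed
  qed
  then show ?thesis by (simp add: multilinear_def)
qed

lemma left_linear_Psi:
  assumes "linear_family F"
  shows "left_linear (Psi F)"
  unfolding left_linear_def
proof (intro conjI allI)
  show "multilinear (Psi F)" by (rule multilinear_Psi[OF assms])
  fix a a' as
  show "Psi F (mul A a a' # as) = l a (Psi F (a' # as))"
  proof (induction as arbitrary: F rule: rev_induct)
    case Nil
    then show ?case by simp
  next
    case (snoc c cs)
    show ?case
    proof (cases cs rule: rev_cases)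
      case Nil
      then show ?thesis by (simp add: l_mul)
    next
      case (snoc ds d)
      then show ?thesis
        using Psi_snoc[of "mul A a a' # ds" F d c] Psi_snoc[of "a' # ds" F d c]
          \<open>\<And>F. Psi F (mul A a a' # cs) = l a (Psi F (a' # cs))\<close>[of "H (shr c F)"]
        by (simp add: alt_def l_uminus_right)
    qed
  qed
qed

text \<open>With the last factor shifted into \<open>G\<close>, the homotopy identity replaces
  \<open>H (Kd G)\<close> by \<open>G - Kd (H G)\<close> up to the degree 0 correction. The term
  \<open>G\<close> matches the last face of the bar differential, and the induction hypothesis for
  \<open>H G\<close> yields the other faces.\<close>

theorem Psi_Kd:
  assumes "linear_family F"
  shows "Psi (Kd F) as = bd A (Psi F) as"
  using assms
proof (induction as arbitrary: F rule: snoc_induct2)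
  case (pair a b)
  then show ?case by (simp add: Kd_def)
next
  case (snoc as b a)
  define G where "G = shr a F"
  define D where "D J y = (if J = {} then l y (G {} (unity A)) else 0)" for J :: "nat set" and y
  have G: "linear_family G"
    using snoc.prems by (simp add: G_def linear_family_shr)
  have "Psi (H (Kd G)) (as @ [b]) = Psi (\<lambda>J y. G J y - Kd (H G) J y - D J y) (as @ [b])"
  proof (rule Psi_cong)
    fix J y assume "J \<subseteq> {1..N}"
    from koszul_homotopy[OF G this, of y]
    show "H (Kd G) J y = G J y - Kd (H G) J y - D J y"
      by (simp add: D_def algebra_simps)
  qed
  also have "\<dots> = Psi G (as @ [b]) - Psi (Kd (H G)) (as @ [b]) - Psi D (as @ [b])"
    by (simp add: Psi_diff)
  finally have L: "Psi (Kd F) (as @ [b, a])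
      = alt (length as) (Psi G (as @ [b]) - Psi (Kd (H G)) (as @ [b]) - Psi D (as @ [b]))"
    using snoc.hyps by (simp add: Psi_snoc shr_Kd G_def)
  have R: "bd A (Psi F) (as @ [b, a])
      = bd A (\<lambda>l. Psi F (l @ [a])) (as @ [b]) + alt (length as) (Psi G (as @ [b]))"
    unfolding G_def Psi_shr by (rule bd_snoc)
  obtain cs c where as: "as = cs @ [c]" using snoc.hyps rev_exhaust by blast
  show ?case
  proof (cases "cs = []")
    case True
    then show ?thesis
      using as unfolding L R by (simp add: D_def Kd_def G_def shr_def A.unity_mul l_mul)
  next
    case False
    \<comment> \<open>\<open>D\<close> lives on the empty set, which no \<open>insert k J\<close>
      is, so the correction survives only for lists of three factors, the case treated
      before.\<close>
    have "H (shr b D) = (\<lambda>J y. 0)"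
      by (intro ext H_eq_0) (simp add: D_def shr_def)
    then have "Psi D (as @ [b]) = alt (length cs) (Psi (\<lambda>J y. 0) (cs @ [c]))"
      using False Psi_snoc[of cs D c b] by (simp add: as)
    then have D: "Psi D (as @ [b]) = 0"
      using Psi_diff[of "\<lambda>J y. 0" "\<lambda>J y. 0" "cs @ [c]"] by simp
    have "bd A (\<lambda>l. Psi F (l @ [a])) (as @ [b]) = bd A (\<lambda>l. alt (length as - 1) (Psi (H G) l)) (as @ [b])"
    proof (rule bd_cong)
      fix l' :: "'a list" assume len: "Suc (length l') = length (as @ [b])"
      then obtain ds d where l': "l' = ds @ [d]" by (cases l' rule: rev_cases) (auto simp: as)
      moreover have "ds \<noteq> []" "length ds = length as - 1" using len l' False as by auto
      ultimately show "Psi F (l' @ [a]) = alt (length as - 1) (Psi (H G) l')"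
        using Psi_snoc[of ds F d a] by (simp add: G_def)
    qed
    also have "\<dots> = - alt (length as) (Psi (Kd (H G)) (as @ [b]))"
      unfolding bd_alt snoc.IH[OF linear_family_H] by (cases as) simp_all
    finally show ?thesis
      unfolding L R D by (simp add: alt_diff)
  qed
qed simp_all

text \<open>At each stage \<open>H\<close> is evaluated on a single generator \<open>x k\<close>,
  where \<open>Hw\<close> has just one term, and this term is 0 unless \<open>k\<close> lies below
  all letters before it.\<close>

lemma Psi_generators:
  assumes "distinct w" "set w \<subseteq> {1..N}"
  shows "Psi F (unity A # map x w @ [b])
    = (if sorted_wrt (>) w then smul B (inverse (inv_coeff e w)) (F (set w) b) else 0)"
  using assms
proof (induction w arbitrary: F b rule: rev_induct)
  case Nil
  then show ?case by (simp add: l_unity)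
next
  case (snoc k w)
  have k: "k \<in> {1..N}" and w: "set w \<subseteq> {1..N}" "distinct w" using snoc.prems by auto
  have "[k] \<in> sorted_words" using k by (simp add: sorted_words_def)
  from H_mon[OF this, of "shr b F" "set w"]
  have Hk: "H (shr b F) (set w) (x k) = (if \<forall>t\<in>set w. k < t
     then - smul B (inverse (rho k (set w))) (F (insert k (set w)) b) else 0)"
    by (simp add: A.mul_unity shr_def A.unity_mul B.V.scale_minus_right)
  have "Psi F (unity A # map x (w @ [k]) @ [b])
      = alt (Suc (length w)) (Psi (H (shr b F)) (unity A # map x w @ [x k]))"
    using Psi_snoc[of "unity A # map x w" F "x k" b] by simp
  also have "\<dots> = (if sorted_wrt (>) (w @ [k]) then
      alt (length w) (smul B (inverse (inv_coeff e w) * inverse (rho k (set w))) (F (insert k (set w)) b)) else 0)"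
    unfolding snoc.IH[OF w(2,1)] Hk by (auto simp: sorted_wrt_append B.V.scale_minus_right alt_uminus)
  also have "\<dots> = (if sorted_wrt (>) (w @ [k]) then
      smul B (inverse (inv_coeff e (w @ [k]))) (F (set (w @ [k])) b) else 0)"
  proof (cases "sorted_wrt (>) (w @ [k])")
    case True
    then have kw: "k < t" if "t \<in> set w" for t using that by (simp add: sorted_wrt_append)
    \<comment> \<open>Every letter of \<open>w\<close> exceeds \<open>k\<close>, so all pairs are
      inversions; their signs match those collected by \<open>Psi\<close>, and the rest is
      \<open>rho\<close>.\<close>
    have "cross_coeff e w [k] = (\<Prod>t\<leftarrow>w. e t k)"
      unfolding cross_coeff_def using kw by (intro arg_cong[of _ _ prod_list] map_cong) auto
    also have "\<dots> = (\<Prod>t\<in>set w. e t k)"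
      using w(2) by (rule prod.distinct_set_conv_list[symmetric])
    also have "\<dots> = (\<Prod>t\<in>set w. - 1 * q k t)"
    proof (rule prod.cong[OF refl])
      fix t assume "t \<in> set w"
      then have "q k t = inverse (q t k)" using w(1) k by (intro q_inverse) auto
      then show "e t k = - 1 * q k t" by simp
    qed
    also have "\<dots> = (- 1) ^ length w * rho k (set w)"
      unfolding prod.distrib by (simp add: distinct_card[OF w(2)])
    finally have "inverse (inv_coeff e (w @ [k]))
        = (- 1) ^ length w * (inverse (inv_coeff e w) * inverse (rho k (set w)))"
      by (simp add: inv_coeff_append ac_simps power_inverse[symmetric])
    then show ?thesis using True
      by (simp add: B.V.scale_alt[symmetric])
  qed simp
  finally show ?case .
qed

end


subsection \<open>The antisymmetrization map from the Koszul resolution to the bar resolution\<close>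

lemma sum_permutations_of_set_Cons:
  assumes "finite J" "J \<noteq> {}"
  shows "(\<Sum>w\<in>permutations_of_set J. f (hd w) (tl w))
    = (\<Sum>i\<in>J. \<Sum>w\<in>permutations_of_set (J - {i}). f i w)"
proof -
  have "(\<Sum>i\<in>J. \<Sum>w\<in>permutations_of_set (J - {i}). f i w)
      = (\<Sum>p\<in>(SIGMA i:J. permutations_of_set (J - {i})). f (fst p) (snd p))"
    using assms by (subst sum.Sigma) (auto simp: split_beta)
  also have "\<dots> = (\<Sum>w\<in>permutations_of_set J. f (hd w) (tl w))"
  proof (rule sum.reindex_bij_witness[of _ "\<lambda>w. (hd w, tl w)" "\<lambda>p. fst p # snd p"])
    fix w assume "w \<in> permutations_of_set J"
    then have w: "set w = J" "distinct w" by (simp_all add: permutations_of_set_def)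
    then obtain i v where v: "w = i # v" using assms(2) by (cases w) auto
    show "fst (hd w, tl w) # snd (hd w, tl w) = w" by (simp add: v)
    show "(hd w, tl w) \<in> (SIGMA i:J. permutations_of_set (J - {i}))"
      using w by (auto simp: permutations_of_set_def v)
  next
    fix p assume "p \<in> (SIGMA i:J. permutations_of_set (J - {i}))"
    then show "fst p # snd p \<in> permutations_of_set J"
      by (cases p) (simp add: permutations_of_set_def insert_absorb)
  qed simp_all
  finally show ?thesis ..
qed

lemma sum_permutations_of_set_snoc:
  assumes "finite J" "J \<noteq> {}"
  shows "(\<Sum>w\<in>permutations_of_set J. f (last w) (butlast w))
    = (\<Sum>i\<in>J. \<Sum>w\<in>permutations_of_set (J - {i}). f i w)"
proof -
  have rev: "(\<Sum>w\<in>permutations_of_set K. g (rev w)) = (\<Sum>w\<in>permutations_of_set K. g w)"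
    for g :: "'a list \<Rightarrow> 'b" and K
    by (rule sum.reindex_bij_witness[of _ rev rev]) (auto simp: permutations_of_set_def)
  have "(\<Sum>w\<in>permutations_of_set J. f (last w) (butlast w))
      = (\<Sum>w\<in>permutations_of_set J. f (hd w) (rev (tl w)))"
    using rev[of "\<lambda>w. f (hd w) (rev (tl w))" J]
    by (simp add: hd_rev flip: butlast_rev)
  also have "\<dots> = (\<Sum>i\<in>J. \<Sum>w\<in>permutations_of_set (J - {i}). f i (rev w))"
    by (rule sum_permutations_of_set_Cons[OF assms])
  finally show ?thesis by (simp add: rev)
qed

definition swap_at :: "nat \<Rightarrow> 'c list \<Rightarrow> 'c list" where
  "swap_at i w = take i w @ [w ! Suc i, w ! i] @ drop (Suc (Suc i)) w"

lemma swap_at_append: "swap_at (length u) (u @ [a, b] @ v) = u @ [b, a] @ v"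
  by (simp add: swap_at_def nth_append)

lemma split_at:
  assumes "Suc i < length w"
  obtains u a b v where "w = u @ [a, b] @ v" "length u = i"
proof
  show "w = take i w @ [w ! i, w ! Suc i] @ drop (Suc (Suc i)) w"
    using assms by (simp add: Cons_nth_drop_Suc)
qed (use assms in simp)

context quantum_symmetric
begin

definition phi0 :: "nat set \<Rightarrow> ('a list \<Rightarrow>\<^sub>0 'k)" where
  "phi0 J = (\<Sum>w\<in>permutations_of_set J.
     fscale (inv_coeff e w) (word (unity A # map x w @ [unity A])))"

text \<open>The orderings \<open>w\<close> and \<open>swap_at i w\<close> have the same merged
  product up to the scalar of the commutation relation, and their coefficients in
  \<open>phi0\<close> are chosen so that the two terms cancel.\<close>

lemma middle_terms_cancel:
  assumes J: "J \<subseteq> {1..N}" and i: "Suc i < card J"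
  shows "(\<Sum>w\<in>permutations_of_set J. fscale (inv_coeff e w)
      (word (unity A # merge_at A i (map x w) @ [unity A]))) \<in> tensor_null A"
proof -
  define G where "G w = fscale (inv_coeff e w)
      (word (unity A # merge_at A i (map x w) @ [unity A]))" for w
  have split: "\<exists>u a b v. w = u @ [a, b] @ v \<and> length u = i \<and> swap_at i w = u @ [b, a] @ v"
    if w: "w \<in> permutations_of_set J" for w
  proof -
    have "length w = card J" using w by (metis length_finite_permutations_of_set)
    with i obtain u a b v where "w = u @ [a, b] @ v" "length u = i" using split_at by metis
    then show ?thesis using swap_at_append[of u a b v] by blast
  qed
  have pair: "G w + G (swap_at i w) \<in> tensor_null A" if perm: "w \<in> permutations_of_set J" for w
  proof -
    obtain u a b v where w: "w = u @ [a, b] @ v" "length u = i" and s: "swap_at i w = u @ [b, a] @ v"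
      using split[OF perm] by blast
    have ab: "a \<in> {1..N}" "b \<in> {1..N}" "a \<noteq> b"
      using perm J unfolding w by (auto simp: permutations_of_set_def)
    let ?us = "unity A # map x u" and ?vs = "map x v @ [unity A]" and ?y = "mul A (x b) (x a)"
    have m: "merge_at A i (map x w) = map x u @ [mul A (x a) (x b)] @ map x v"
      "merge_at A i (map x (swap_at i w)) = map x u @ [?y] @ map x v"
      using w(2) unfolding s unfolding w(1) by (simp_all add: merge_at_def nth_append)
    have "inv_coeff e w = e a b * inv_coeff e (swap_at i w)"
      unfolding s unfolding w(1) by (rule inv_coeff_swap) (use ab q_mult[of a b] inverse_q[of a b] inverse_q[of b a] in \<open>auto simp: mult.commute\<close>)
    then have c: "inv_coeff e (swap_at i w) = - (inv_coeff e w * q a b)"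
      using ab q_nonzero[of a b] by simp
    have "fscale (inv_coeff e w) (word (?us @ [smul A (q a b) ?y] @ ?vs)
        - fscale (q a b) (word (?us @ [?y] @ ?vs))) \<in> tensor_null A"
      unfolding tensor_null_def by (intro fspan_fscale fspan_base) blast
    moreover have "G w + G (swap_at i w) = fscale (inv_coeff e w)
        (word (?us @ [smul A (q a b) ?y] @ ?vs) - fscale (q a b) (word (?us @ [?y] @ ?vs)))"
      unfolding G_def m c x_commute[OF ab(1,2)]
      by (simp add: formal.scale_right_diff_distrib single_uminus flip: single_uminus)
    ultimately show ?thesis by simp
  qed
  have "sum G (permutations_of_set J) = (\<Sum>w\<in>permutations_of_set J. G (swap_at i w))"
  proof (rule sum.reindex_bij_witness[of _ "swap_at i" "swap_at i"])
    fix w assume w: "w \<in> permutations_of_set J"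
    obtain u a b v where u: "w = u @ [a, b] @ v" "length u = i" and s: "swap_at i w = u @ [b, a] @ v"
      using split[OF w] by blast
    show "swap_at i (swap_at i w) = w"
      unfolding s using swap_at_append[of u b a v] u by simp
    then show "swap_at i (swap_at i w) = w" "G (swap_at i (swap_at i w)) = G w" by simp_all
    show "swap_at i w \<in> permutations_of_set J" "swap_at i w \<in> permutations_of_set J"
      using w unfolding s unfolding u by (auto simp: permutations_of_set_def)
  qed
  \<comment> \<open>Summing over all orderings counts each pair twice; halving avoids choosing a
    representative of each pair.\<close>
  then have "sum G (permutations_of_set J)
      = fscale (1/2) (\<Sum>w\<in>permutations_of_set J. G w + G (swap_at i w))"
    by (simp add: sum.distrib formal.scale_right_distrib flip: formal.scale_left_distrib)
  moreover have "\<dots> \<in> tensor_null A"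
    using pair unfolding tensor_null_def by (intro fspan_fscale fspan_sum) auto
  ultimately show ?thesis by (simp add: G_def)
qed

text \<open>The outer faces absorb a unit and become the two actions of a generator; the remaining
  faces multiply adjacent generators.\<close>

lemma bd_word_generator:
  assumes "w \<noteq> []"
  shows "bd A word (unity A # map x w @ [unity A]) =
    word (x (hd w) # map x (tl w) @ [unity A])
    - alt (length w - 1) (word (unity A # map x (butlast w) @ [x (last w)]))
    - (bd A (\<lambda>l. word (unity A # l @ [unity A])) (map x w) :: 'a list \<Rightarrow>\<^sub>0 'k)"
proof -
  have "bd A word (unity A # map x w @ [unity A]) =
    word (x (hd w) # map x (tl w) @ [unity A]) - (bd A (\<lambda>l. word (unity A # l)) (map x w @ [unity A]) :: 'a list \<Rightarrow>\<^sub>0 'k)"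
    using assms by (cases w) (simp_all add: A.unity_mul)
  moreover have "bd A (\<lambda>l. word (unity A # l)) (map x w @ [unity A])
    = alt (length w - 1) (word (unity A # map x (butlast w) @ [x (last w)]))
    + (bd A (\<lambda>l. word (unity A # l @ [unity A])) (map x w) :: 'a list \<Rightarrow>\<^sub>0 'k)"
  proof -
    obtain v j where "w = v @ [j]" using assms rev_exhaust by blast
    then show ?thesis
      using bd_snoc[of A "\<lambda>l. word (unity A # l) :: 'a list \<Rightarrow>\<^sub>0 'k" "map x v" "x j" "unity A"]
      by (simp add: A.mul_unity add.commute)
  qed
  ultimately show ?thesis by simp
qed

lemma inv_coeff_Cons_perm:
  assumes "i \<in> J" "J \<subseteq> {1..N}" "w \<in> permutations_of_set (J - {i})"
  shows "inv_coeff e (i # w) = left_coeff q i J * inv_coeff e w"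
proof -
  have w: "set w = J - {i}" "distinct w" using assms by (auto simp: permutations_of_set_def)
  have "(\<Prod>t\<leftarrow>w. if t < i then e i t else 1) = (\<Prod>t\<in>set w. if t < i then e i t else 1)"
    using w(2) by (rule prod.distinct_set_conv_list[symmetric])
  also have "\<dots> = left_coeff q i J"
    unfolding left_coeff_def w(1) by (rule prod.cong) (use assms inverse_q[OF subsetD[OF assms(2)] subsetD[OF assms(2)]] in auto)
  finally show ?thesis by simp
qed

text \<open>The power of -1 compensates for the sign of the last face of the bar differential,
  leaving exactly the right coefficient of the Koszul differential.\<close>

lemma inv_coeff_snoc_perm:
  assumes "i \<in> J" "J \<subseteq> {1..N}" "w \<in> permutations_of_set (J - {i})"
  shows "inv_coeff e (w @ [i]) = (- 1) ^ length w * right_coeff q i J * inv_coeff e w"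
proof -
  have w: "set w = J - {i}" "distinct w" using assms by (auto simp: permutations_of_set_def)
  have "cross_coeff e w [i] = (\<Prod>t\<in>set w. if i < t then e t i else 1)"
    unfolding cross_coeff_def prod.distinct_set_conv_list[OF w(2)] by simp
  also have "\<dots> = (\<Prod>t\<in>set w. - 1 * (if i < t then q i t else - 1))"
    by (rule prod.cong) (use assms inverse_q[OF subsetD[OF assms(2)] subsetD[OF assms(2)]] w(1) in auto)
  also have "\<dots> = (- 1) ^ length w * right_coeff q i J"
    unfolding prod.distrib by (simp add: distinct_card[OF w(2)] right_coeff_def flip: w(1))
  finally show ?thesis by (simp add: inv_coeff_append)
qed

lemma tensor_lact_phi0:
  "tensor_lact A a (phi0 J) = (\<Sum>w\<in>permutations_of_set J. fscale (inv_coeff e w) (word (a # map x w @ [unity A])))"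
  by (simp add: tensor_lact_def phi0_def formal.lin_ext_linear A.mul_unity)

lemma tensor_ract_phi0:
  "tensor_ract A (phi0 J) a = (\<Sum>w\<in>permutations_of_set J. fscale (inv_coeff e w) (word (unity A # map x w @ [a])))"
  by (simp add: tensor_ract_def phi0_def formal.lin_ext_linear A.unity_mul butlast_append)

text \<open>Grouped by first or last letter, the outer faces give the Koszul differential exactly;
  only the inner faces need the quotient by \<open>tensor_null\<close>.\<close>

lemma phi0_chain:
  assumes J: "J \<subseteq> {1..N}" "J \<noteq> {}"
  shows "bar_boundary A (phi0 J) - koszul_diff N q x fscale (tensor_lact A) (tensor_ract A) phi0 J
    \<in> tensor_null A"
proof -
  have fin: "finite J" using J finite_subset by auto
  define M where "M w = (bd A (\<lambda>l. word (unity A # l @ [unity A])) (map x w) :: 'a list \<Rightarrow>\<^sub>0 'k)" for w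
  have len: "length w = card J" "w \<noteq> []" if "w \<in> permutations_of_set J" for w
    using that J by (auto simp: length_finite_permutations_of_set permutations_of_set_def)
  let ?P = "permutations_of_set J"
  have sgn: "(- 1) ^ n * ((- 1) ^ n * a * b) = a * (b :: 'k)" for n a b
    by (simp add: mult.assoc[symmetric] flip: power_mult_distrib)
  have "(\<Sum>w\<in>?P. fscale (inv_coeff e w) (word (x (hd w) # map x (tl w) @ [unity A])))
     = (\<Sum>w\<in>?P. fscale (inv_coeff e (hd w # tl w)) (word (x (hd w) # map x (tl w) @ [unity A])))"
    by (rule sum.cong) (use len in auto)
  also have "\<dots> = (\<Sum>i\<in>J. \<Sum>w\<in>permutations_of_set (J - {i}).
      fscale (inv_coeff e (i # w)) (word (x i # map x w @ [unity A])))"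
    by (rule sum_permutations_of_set_Cons[OF fin J(2)])
  also have "\<dots> = (\<Sum>i\<in>J. fscale (left_coeff q i J) (tensor_lact A (x i) (phi0 (J - {i}))))"
    unfolding tensor_lact_phi0 formal.scale_sum_right
    by (intro sum.cong refl) (simp only: inv_coeff_Cons_perm[OF _ J(1)] formal.scale_scale)
  finally have 1: "(\<Sum>w\<in>?P. fscale (inv_coeff e w) (word (x (hd w) # map x (tl w) @ [unity A])))
     = (\<Sum>i\<in>J. fscale (left_coeff q i J) (tensor_lact A (x i) (phi0 (J - {i}))))" .
  have "(\<Sum>w\<in>?P. fscale (inv_coeff e w) (alt (length w - 1) (word (unity A # map x (butlast w) @ [x (last w)]))))
     = (\<Sum>w\<in>?P. fscale ((- 1) ^ length (butlast w) * inv_coeff e (butlast w @ [last w]))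
          (word (unity A # map x (butlast w) @ [x (last w)])))"
    by (rule sum.cong) (use len in \<open>auto simp: ac_simps simp flip: formal.scale_alt\<close>)
  also have "\<dots> = (\<Sum>i\<in>J. \<Sum>w\<in>permutations_of_set (J - {i}).
      fscale ((- 1) ^ length w * inv_coeff e (w @ [i])) (word (unity A # map x w @ [x i])))"
    by (rule sum_permutations_of_set_snoc[OF fin J(2)])
  also have "\<dots> = (\<Sum>i\<in>J. fscale (right_coeff q i J) (tensor_ract A (phi0 (J - {i})) (x i)))"
    unfolding tensor_ract_phi0 formal.scale_sum_right
    by (intro sum.cong refl) (simp only: inv_coeff_snoc_perm[OF _ J(1)] sgn formal.scale_scale)
  finally have 2: "(\<Sum>w\<in>?P. fscale (inv_coeff e w) (alt (length w - 1) (word (unity A # map x (butlast w) @ [x (last w)]))))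
     = (\<Sum>i\<in>J. fscale (right_coeff q i J) (tensor_ract A (phi0 (J - {i})) (x i)))" .
  have "bar_boundary A (phi0 J) = (\<Sum>w\<in>?P. fscale (inv_coeff e w) (bd A word (unity A # map x w @ [unity A])))"
    by (simp add: bar_boundary_eq phi0_def formal.lin_ext_linear del: fscale_single bd.simps)
  also have "\<dots> = (\<Sum>w\<in>?P. fscale (inv_coeff e w) (word (x (hd w) # map x (tl w) @ [unity A]))
     - fscale (inv_coeff e w) (alt (length w - 1) (word (unity A # map x (butlast w) @ [x (last w)])))
     - fscale (inv_coeff e w) (M w))"
    by (rule sum.cong) (use len in \<open>simp_all add: bd_word_generator M_def formal.scale_right_diff_distrib del: fscale_single\<close>)
  also have "\<dots> = koszul_diff N q x fscale (tensor_lact A) (tensor_ract A) phi0 J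
     - (\<Sum>w\<in>?P. fscale (inv_coeff e w) (M w))"
    unfolding formal.koszul_diff_eq[OF J(1)] sum_subtractf 1 2 ..
  finally have "bar_boundary A (phi0 J) - koszul_diff N q x fscale (tensor_lact A) (tensor_ract A) phi0 J
     = fscale (- 1) (\<Sum>w\<in>?P. fscale (inv_coeff e w) (M w))"
    by simp
  also have "(\<Sum>w\<in>?P. fscale (inv_coeff e w) (M w)) = (\<Sum>w\<in>?P. \<Sum>i<card J - 1.
      fscale ((- 1) ^ i) (fscale (inv_coeff e w) (word (unity A # merge_at A i (map x w) @ [unity A]))))"
  proof (rule sum.cong)
    fix w assume "w \<in> ?P"
    then have "M w = (\<Sum>i<card J - 1. fscale ((- 1) ^ i) (word (unity A # merge_at A i (map x w) @ [unity A])))"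
      unfolding M_def formal.bd_eq[symmetric] using len by simp
    then show "fscale (inv_coeff e w) (M w) = (\<Sum>i<card J - 1.
      fscale ((- 1) ^ i) (fscale (inv_coeff e w) (word (unity A # merge_at A i (map x w) @ [unity A]))))"
      by (simp add: formal.scale_sum_right mult.commute)
  qed simp
  also have "\<dots> = (\<Sum>i<card J - 1. fscale ((- 1) ^ i) (\<Sum>w\<in>?P.
      fscale (inv_coeff e w) (word (unity A # merge_at A i (map x w) @ [unity A]))))"
    unfolding formal.scale_sum_right by (rule sum.swap)
  also have "fscale (- 1) \<dots> \<in> tensor_null A"
    unfolding tensor_null_def
    by (rule fspan_fscale, rule fspan_sum, rule fspan_fscale,
        rule middle_terms_cancel[OF J(1), unfolded tensor_null_def]) auto
  finally show ?thesis .
qed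

theorem comparison_map_phi0: "comparison_map N q A x phi0"
  unfolding comparison_map_def
proof (intro conjI allI impI ballI)
  fix J as assume J: "J \<subseteq> {1..N}" and as: "as \<in> Poly_Mapping.keys (phi0 J)"
  from as have "as \<in> (\<Union>w\<in>permutations_of_set J. Poly_Mapping.keys
      (fscale (inv_coeff e w) (word (unity A # map x w @ [unity A]))))"
    unfolding phi0_def by (rule subsetD[OF Poly_Mapping.keys_sum])
  then obtain w where w: "w \<in> permutations_of_set J"
    and "as \<in> Poly_Mapping.keys (fscale (inv_coeff e w) (word (unity A # map x w @ [unity A])))"
    by (rule UN_E)
  then have "as = unity A # map x w @ [unity A]" by (auto split: if_splits)
  then show "length as = card J + 2"
    using w by (simp add: length_finite_permutations_of_set)
next
  show "lin_ext (smul A) (\<lambda>as. mul A (as ! 0) (as ! 1)) (phi0 {}) = unity A"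
    by (simp add: phi0_def A.mul_unity)
qed (rule phi0_chain)

end


subsection \<open>Homotopies between chain maps into the bar resolution\<close>

text \<open>A linear map \<open>T\<close> from left linear functionals on the bar resolution to functionals on a complex
  with generators \<open>X\<close> and differential \<open>D\<close> is dual to a map of bimodules. If this map commutes with
  the differentials, it is null-homotopic: the homotopy \<open>S\<close> is built by recursion on the degree,
  using the contraction of the bar resolution that appends a unit.\<close>

locale bar_homotopy = bimodule_algebra A B l r
  for A :: "('k::field, 'a::ab_group_add) alg" and B :: "('k, 'b::ab_group_add) alg" and l r +
  fixes X :: "'x set" and deg :: "'x \<Rightarrow> nat"
    and T :: "('a list \<Rightarrow> 'b) \<Rightarrow> 'x \<Rightarrow> 'a \<Rightarrow> 'b" and D :: "('x \<Rightarrow> 'a \<Rightarrow> 'b) \<Rightarrow> 'x \<Rightarrow> 'a \<Rightarrow> 'b"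
  assumes T_cong: "x \<in> X \<Longrightarrow> (\<And>as. as \<noteq> [] \<Longrightarrow> g as = g' as) \<Longrightarrow> T g x b = T g' x b"
    and T_add: "T (\<lambda>as. g as + g' as) x b = T g x b + T g' x b"
    and T_hom: "left_hom p \<Longrightarrow> T (\<lambda>as. p (g as)) x b = p (T g x b)"
    and T_rsh: "x \<in> X \<Longrightarrow> T (rsh A a g) x b = T g x (mul A b a)"
    and T_bd: "left_linear g \<Longrightarrow> x \<in> X \<Longrightarrow> T (bd A g) x b = D (T g) x b"
    and D_cong: "x \<in> X \<Longrightarrow> (\<And>y c. y \<in> X \<Longrightarrow> Suc (deg y) = deg x \<Longrightarrow> G y c = G' y c) \<Longrightarrow> D G x b = D G' x b"
    and D_add: "D (\<lambda>y c. G y c + G' y c) x b = D G x b + D G' x b"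
    and D_hom: "left_hom p \<Longrightarrow> D (\<lambda>y c. p (G y c)) x b = p (D G x b)"
    and D_shift: "x \<in> X \<Longrightarrow> D (\<lambda>y c. G y (mul A c a)) x b = D G x (mul A b a)"
    and D_D: "x \<in> X \<Longrightarrow> (\<And>y. lin (G y)) \<Longrightarrow> D (D G) x b = 0"
begin

lemma T_diff: "T (\<lambda>as. g as - g' as) x b = T g x b - T g' x b"
  using T_add[of "\<lambda>as. g as - g' as" g' x b] by simp

lemma D_diff: "D (\<lambda>y c. G y c - G' y c) x b = D G x b - D G' x b"
  using D_add[of "\<lambda>y c. G y c - G' y c" G' x b] by simp

lemma D_zero: "D (\<lambda>y c. 0) x b = 0"
  using D_diff[of "\<lambda>y c. 0" "\<lambda>y c. 0"] by simp

text \<open>Dual of the usual recursion: the next homotopy is the contraction applied to the given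
  map minus the previous homotopy after the differential. The coefficient \<open>b\<close> is
  shifted into \<open>g\<close> and the result is evaluated at the unit, which builds in
  compatibility with right multiplication.\<close>

primrec S :: "nat \<Rightarrow> ('a list \<Rightarrow> 'b) \<Rightarrow> 'x \<Rightarrow> 'a \<Rightarrow> 'b" where
  "S 0 = (\<lambda>g x b. T (tapp A (rsh A b g)) x (unity A))"
| "S (Suc n) = (\<lambda>g x b. T (tapp A (rsh A b g)) x (unity A) - D (S n (tapp A (rsh A b g))) x (unity A))"

lemma tapp_rsh_cong:
  "(\<And>as. as \<noteq> [] \<Longrightarrow> g as = g' as) \<Longrightarrow> tapp A (rsh A b g) = tapp A (rsh A b g')"
  by (rule ext) (simp add: tapp_def rsh_def)

lemma S_cong:
  assumes "\<And>as. as \<noteq> [] \<Longrightarrow> g as = g' as"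
  shows "S n g = S n g'"
proof -
  have "tapp A (rsh A b g) = tapp A (rsh A b g')" for b
    using assms by (rule tapp_rsh_cong)
  then show ?thesis by (cases n) (simp_all only: S.simps)
qed

lemma S_add: "S n (\<lambda>as. g as + g' as) x b = S n g x b + S n g' x b"
proof (induction n arbitrary: g g' x b)
  have *: "tapp A (rsh A b (\<lambda>as. g as + g' as)) = (\<lambda>as. tapp A (rsh A b g) as + tapp A (rsh A b g') as)"
    for g g' :: "'a list \<Rightarrow> 'b" and b
    by (rule ext) (simp add: tapp_def rsh_def alt_add)
  {
    case 0
    show ?case by (simp add: * T_add)
  next
    case (Suc n)
    show ?case by (simp add: * T_add Suc.IH[abs_def] D_add)
  }
qed

lemma S_hom:
  assumes "left_hom p"
  shows "S n (\<lambda>as. p (g as)) x b = p (S n g x b)"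
proof (induction n arbitrary: g x b)
  have *: "tapp A (rsh A b (\<lambda>as. p (g as))) = (\<lambda>as. p (tapp A (rsh A b g) as))"
    for g :: "'a list \<Rightarrow> 'b" and b
    by (rule ext) (simp add: tapp_def rsh_def left_hom_alt[OF assms])
  {
    case 0
    show ?case by (simp add: * T_hom[OF assms])
  next
    case (Suc n)
    show ?case
      by (simp add: * T_hom[OF assms] Suc.IH[abs_def] D_hom[OF assms] left_hom_diff[OF assms])
  }
qed

lemma S_diff: "S n (\<lambda>as. g as - g' as) x b = S n g x b - S n g' x b"
  using S_add[of n "\<lambda>as. g as - g' as" g' x b] by simp

lemma S_zero: "S n (\<lambda>as. 0) x b = 0"
  using S_diff[of n "\<lambda>as. 0" "\<lambda>as. 0"] by simp

lemma S_rsh: "S n (rsh A a g) x b = S n g x (mul A b a)"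
  by (cases n) (simp_all add: A.rsh_rsh)

lemma lin_S:
  assumes "multilinear g"
  shows "lin (S n g x)"
proof -
  have 1: "tapp A (rsh A (b + b') g) = (\<lambda>as. tapp A (rsh A b g) as + tapp A (rsh A b' g) as)" for b b'
    by (rule ext) (simp add: tapp_def rsh_add[OF assms] alt_add)
  have 2: "tapp A (rsh A (smul A c b) g) = (\<lambda>as. smul B c (tapp A (rsh A b g) as))" for c b
    by (rule ext) (simp add: tapp_def rsh_smul[OF assms] left_hom_alt[OF left_hom_smulI])
  show ?thesis
    by (rule linI; cases n)
      (simp_all add: 1 2 T_add S_add[abs_def] D_add T_hom[OF left_hom_smulI] D_hom[OF left_hom_smulI]
        S_hom[OF left_hom_smulI, abs_def] B.V.scale_right_diff_distrib)
qed

text \<open>\<open>tapp\<close> evaluates its argument on lists with one more factor, so right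
  linearity of \<open>f\<close> on at least two factors suffices on all nonempty lists; naturality
  in \<open>left_hom\<close> does the rest.\<close>

lemma S_right:
  assumes "x \<in> X" and f: "\<And>as. length as \<ge> 2 \<Longrightarrow> rsh A a f as = r (f as) a"
  shows "S n f x (mul A b a) = r (S n f x b) a"
proof -
  have h: "tapp A (rsh A b (rsh A a f)) as = r (tapp A (rsh A b f) as) a" if "as \<noteq> []" for as
    using f[of "as @ [b]"] that
    by (cases as) (simp_all add: tapp_def alt_def rsh_def r_uminus_left A.unity_mul)
  have T: "T (tapp A (rsh A b (rsh A a f))) x (unity A) = r (T (tapp A (rsh A b f)) x (unity A)) a"
    unfolding T_hom[OF left_hom_r, symmetric] by (rule T_cong[OF assms(1) h])
  have S: "S m (tapp A (rsh A b (rsh A a f))) = (\<lambda>y c. r (S m (tapp A (rsh A b f)) y c) a)" for m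
    unfolding S_hom[OF left_hom_r, symmetric] using S_cong[OF h] by simp
  show ?thesis
    unfolding S_rsh[symmetric] using T S
    by (cases n) (simp_all add: D_hom[OF left_hom_r] r_diff_left)
qed

lemma tapp_rsh_bd:
  assumes "as \<noteq> []"
  shows "tapp A (rsh A b (bd A g)) as = rsh A b g as - bd A (tapp A (rsh A b g)) as"
proof -
  have "tapp A (rsh A b (bd A g)) as = tapp A (bd A (rsh A b g)) as"
    using assms by (cases as) (simp_all add: tapp_def A.bd_rsh)
  then show ?thesis using A.tapp_contraction[OF assms, of "rsh A b g"] by simp
qed

lemma T_tapp_rsh_bd:
  assumes g: "left_linear g" and x: "x \<in> X"
  shows "T (tapp A (rsh A b (bd A g))) x (unity A) = T g x b - D (T (tapp A (rsh A b g))) x (unity A)"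
proof -
  have "T (tapp A (rsh A b (bd A g))) x (unity A)
      = T (\<lambda>as. rsh A b g as - bd A (tapp A (rsh A b g)) as) x (unity A)"
    by (rule T_cong[OF x tapp_rsh_bd])
  then show ?thesis
    using g x by (simp add: T_diff T_rsh A.unity_mul T_bd left_linear_tapp left_linear_rsh)
qed

text \<open>Contracting \<open>bd A g\<close> splits off \<open>g\<close> itself and leaves the
  boundary of a contracted functional, to which the induction hypothesis applies one degree
  lower.\<close>

theorem homotopy:
  assumes "left_linear g" "x \<in> X"
  shows "S (deg x) (bd A g) x b + (case deg x of 0 \<Rightarrow> 0 | Suc m \<Rightarrow> D (S m g) x b) = T g x b"
  using assms
proof (induction "deg x" arbitrary: g x b)
  case (0 x g b)
  have "D (T (tapp A (rsh A b g))) x (unity A) = D (\<lambda>y c. 0) x (unity A)"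
    by (rule D_cong) (use 0 in auto)
  then show ?case
    using T_tapp_rsh_bd[OF 0(2,3)] by (simp add: D_zero flip: 0(1))
next
  case (Suc m x g b)
  let ?g = "rsh A b g"
  let ?t = "tapp A ?g"
  let ?h = "tapp A (rsh A b (bd A g))"
  have t: "left_linear ?t" using Suc.prems by (simp add: left_linear_tapp left_linear_rsh)
  note T = T_tapp_rsh_bd[OF Suc.prems, of b]
  \<comment> \<open>The lower homotopy term left by the induction hypothesis. It is 0 or itself of
    the form \<open>D (S m' ?t)\<close>, so a further \<open>D\<close> annihilates it.\<close>
  define E where "E y c = (case m of 0 \<Rightarrow> 0 | Suc m' \<Rightarrow> D (S m' ?t) y c)" for y c
  have "D (S m ?h) x (unity A) = D (\<lambda>y c. S m ?g y c - (T ?t y c - E y c)) x (unity A)"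
  proof (rule D_cong[OF Suc.prems(2)])
    fix y c assume y: "y \<in> X" "Suc (deg y) = deg x"
    then have m: "m = deg y" using Suc.hyps(2) by simp
    have "S m ?h y c = S m ?g y c - S m (bd A ?t) y c"
      using S_cong[of ?h "\<lambda>as. ?g as - bd A ?t as" m, OF tapp_rsh_bd] by (simp add: S_diff)
    moreover have "S m (bd A ?t) y c = T ?t y c - E y c"
      using Suc.hyps(1)[OF m t y(1), of c] by (simp add: m E_def eq_diff_eq)
    ultimately show "S m ?h y c = S m ?g y c - (T ?t y c - E y c)"
      by simp
  qed
  also have "\<dots> = D (S m ?g) x (unity A) - (D (T ?t) x (unity A) - D E x (unity A))"
    by (simp add: D_diff)
  also have "D E x (unity A) = 0"
  proof (cases m)
    case 0
    then show ?thesis by (simp add: E_def[abs_def] D_zero)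
  next
    case (Suc m')
    then show ?thesis
      using D_D[OF Suc.prems(2)] lin_S[OF left_linear_multilinear[OF t]]
      by (simp add: E_def[abs_def])
  qed
  also have "D (S m ?g) x (unity A) = D (S m g) x b"
    using D_shift[OF Suc.prems(2), of "S m g" b "unity A"] by (simp add: S_rsh[abs_def] A.unity_mul)
  finally show ?case
    using T by (simp flip: Suc.hyps(2))
qed

corollary homotopy_cocycle:
  assumes "left_linear f" "x \<in> X" "bd A f = (\<lambda>_. 0)"
  shows "T f x b = (case deg x of 0 \<Rightarrow> 0 | Suc m \<Rightarrow> D (S m f) x b)"
  using homotopy[OF assms(1,2), of b] assms(3) S_zero by simp

end


subsection \<open>Pulling back functionals\<close>

context quantum_bimodule
begin

text \<open>Precomposition with the bimodule map determined by \<phi>, evaluated at a generator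
  times \<open>b\<close>.\<close>

definition Phi :: "(nat set \<Rightarrow> ('a list \<Rightarrow>\<^sub>0 'k)) \<Rightarrow> ('a list \<Rightarrow> 'b) \<Rightarrow> nat set \<Rightarrow> 'a \<Rightarrow> 'b" where
  "Phi \<phi> g J b = lin_ext (smul B) (rsh A b g) (\<phi> J)"

lemma Phi_rsh: "Phi \<phi> (rsh A a g) J b = Phi \<phi> g J (mul A b a)"
  by (simp add: Phi_def A.rsh_rsh)

lemma Phi_add: "Phi \<phi> (\<lambda>as. g as + g' as) J b = Phi \<phi> g J b + Phi \<phi> g' J b"
  by (simp add: Phi_def rsh_def[abs_def] B.V.lin_ext_fun_add)

lemma Phi_left_hom: "left_hom p \<Longrightarrow> Phi \<phi> (\<lambda>as. p (g as)) J b = p (Phi \<phi> g J b)"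
  by (simp add: Phi_def rsh_def[abs_def] left_hom_lin_ext)

lemma linear_family_Phi:
  assumes "multilinear g"
  shows "linear_family (Phi \<phi> g)"
  unfolding linear_family_def Phi_def[abs_def]
  by (intro allI linI) (simp_all add: rsh_add[OF assms] rsh_smul[OF assms] B.V.lin_ext_fun_add
      left_hom_lin_ext[OF left_hom_smulI])

lemma Phi_cong:
  assumes "\<And>as. as \<noteq> [] \<Longrightarrow> g as = g' as"
  shows "Phi \<phi> g J b = Phi \<phi> g' J b"
proof -
  have "rsh A b g = rsh A b g'" by (rule ext) (simp add: rsh_def assms)
  then show ?thesis by (simp add: Phi_def)
qed

lemma comparison_map_length:
  "comparison_map N q A x \<phi> \<Longrightarrow> J \<subseteq> {1..N} \<Longrightarrow> as \<in> Poly_Mapping.keys (\<phi> J) \<Longrightarrow> length as = card J + 2"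
  by (simp add: comparison_map_def)

text \<open>The degree 0 face is multiplication, so the condition that \<phi> lifts the identity
  makes every comparison map give the same value. This is why differences of such maps satisfy the
  truncated chain map condition.\<close>

lemma Phi_bd_empty:
  assumes \<phi>: "comparison_map N q A x \<phi>" and g: "left_linear g"
  shows "Phi \<phi> (bd A g) {} b = g [b]"
proof -
  have "Phi \<phi> (bd A g) {} b = lin_ext (smul B) (\<lambda>as. l (mul A (as ! 0) (as ! 1)) (g [b])) (\<phi> {})"
    unfolding Phi_def
  proof (rule lin_ext_cong)
    fix as assume "as \<in> Poly_Mapping.keys (\<phi> {})"
    then have "length as = 2" using comparison_map_length[OF \<phi>] by fastforce
    then obtain a c where "as = [a, c]" by (auto simp: numeral_2_eq_2 length_Suc_conv)
    then show "rsh A b (bd A g) as = l (mul A (as ! 0) (as ! 1)) (g [b])"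
      using left_linearD[OF g, of "mul A a c" b "[]"] by (simp add: rsh_def A.mul_assoc)
  qed
  also have "\<dots> = l (lin_ext (smul A) (\<lambda>as. mul A (as ! 0) (as ! 1)) (\<phi> {})) (g [b])"
    by (rule lin_ext_hom[symmetric]) (simp_all add: l_add_left l_smul_left)
  also have "lin_ext (smul A) (\<lambda>as. mul A (as ! 0) (as ! 1)) (\<phi> {}) = unity A"
    using \<phi> by (simp add: comparison_map_def)
  finally show ?thesis by (simp add: l_unity)
qed

lemma Phi_bd:
  assumes \<phi>: "comparison_map N q A x \<phi>" and g: "left_linear g" and J: "J \<subseteq> {1..N}" "J \<noteq> {}"
  shows "Phi \<phi> (bd A g) J b = Kd (Phi \<phi> g) J b"
proof -
  let ?g = "rsh A b g"
  have g': "left_linear ?g" using g by (rule left_linear_rsh)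
  have "Phi \<phi> (bd A g) J b = lin_ext (smul B) (bd A ?g) (\<phi> J)"
    unfolding Phi_def
    by (rule lin_ext_cong, rule A.bd_rsh[symmetric]) (simp add: comparison_map_length[OF \<phi> J(1)])
  also have "\<dots> = lin_ext (smul B) ?g (bar_boundary A (\<phi> J))"
    by (simp add: lin_ext_bar_boundary)
  also have "\<dots> = lin_ext (smul B) ?g (koszul_diff N q x fscale (tensor_lact A) (tensor_ract A) \<phi> J)"
    using \<phi> J lin_ext_tensor_null[OF left_linear_multilinear[OF g'],
        of "bar_boundary A (\<phi> J) - koszul_diff N q x fscale (tensor_lact A) (tensor_ract A) \<phi> J"]
    by (simp add: comparison_map_def B.V.lin_ext_diff)
  also have "\<dots> = Kd (Phi \<phi> g) J b"
  proof -
    have "lin_ext (smul B) ?g (tensor_lact A (x i) (\<phi> (J - {i}))) = l (x i) (Phi \<phi> g (J - {i}) b)" for i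
      unfolding Phi_def
    proof (rule lin_ext_tensor_lact[OF g'])
      fix as assume "as \<in> Poly_Mapping.keys (\<phi> (J - {i}))"
      then have "length as = card (J - {i}) + 2"
        by (intro comparison_map_length[OF \<phi>]) (use J in auto)
      then show "as \<noteq> []" by auto
    qed
    moreover have "lin_ext (smul B) ?g (tensor_ract A (\<phi> (J - {i})) (x i)) = Phi \<phi> g (J - {i}) (mul A (x i) b)" for i
      by (simp add: lin_ext_tensor_ract Phi_def A.rsh_rsh)
    ultimately show ?thesis
      using J by (simp add: formal.koszul_diff_eq Kd_def B.V.lin_ext_linear)
  qed
  finally show ?thesis .
qed

text \<open>Of all orderings of \<open>J\<close> only the descending one survives
  \<open>Psi\<close>, with the inverse of its coefficient in \<open>phi0\<close>.\<close>

theorem Phi_Psi: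
  assumes "J \<subseteq> {1..N}"
  shows "Phi phi0 (Psi F) J b = F J b"
proof -
  have fin: "finite J" using assms finite_subset by auto
  have "Phi phi0 (Psi F) J b = (\<Sum>w\<in>permutations_of_set J. smul B (inv_coeff e w) (Psi F (unity A # map x w @ [b])))"
    by (simp add: Phi_def phi0_def B.V.lin_ext_linear rsh_def A.unity_mul butlast_append)
  also have "\<dots> = (\<Sum>w\<in>permutations_of_set J. if w = rev (sorted_list_of_set J) then F J b else 0)"
  proof (rule sum.cong)
    fix w assume "w \<in> permutations_of_set J"
    then have w: "set w = J" "distinct w" by (simp_all add: permutations_of_set_def)
    have "sorted_wrt (>) w \<longleftrightarrow> sorted_wrt (<) (rev w)"
      by (simp add: sorted_wrt_rev)
    also have "\<dots> \<longleftrightarrow> rev w = sorted_list_of_set J"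
      using w fin by (auto simp: strict_sorted_iff intro: sorted_distinct_set_unique)
    also have "\<dots> \<longleftrightarrow> w = rev (sorted_list_of_set J)"
      by (metis rev_rev_ident)
    finally have desc: "sorted_wrt (>) w \<longleftrightarrow> w = rev (sorted_list_of_set J)" .
    have "inv_coeff e w \<noteq> 0"
      by (rule inv_coeff_nonzero) (use w q_nonzero[OF subsetD[OF assms] subsetD[OF assms]] in auto)
    moreover have "Psi F (unity A # map x w @ [b])
        = (if w = rev (sorted_list_of_set J) then smul B (inverse (inv_coeff e w)) (F J b) else 0)"
      using Psi_generators[of w F b] w(2) assms unfolding desc w(1) by blast
    ultimately show "smul B (inv_coeff e w) (Psi F (unity A # map x w @ [b]))
        = (if w = rev (sorted_list_of_set J) then F J b else 0)"
      by auto
  qed simp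
  also have "\<dots> = F J b"
  proof -
    have "rev (sorted_list_of_set J) \<in> permutations_of_set J"
      using fin by (simp add: permutations_of_set_def)
    then show ?thesis by simp
  qed
  finally show ?thesis .
qed

text \<open>No computation with coefficients: \<open>Psi\<close> carries \<open>Kd\<close> to
  \<open>bd\<close>, whose square is 0, and \<open>Phi phi0\<close> recovers a family from its image
  under \<open>Psi\<close>.\<close>

lemma Kd_Kd:
  assumes "linear_family F" "J \<subseteq> {1..N}"
  shows "Kd (Kd F) J b = 0"
proof -
  have "linear_family (Kd F)"
    using assms(1) by (simp add: linear_family_def lin_Kd)
  then have "Psi (Kd (Kd F)) as = bd A (Psi (Kd F)) as" for as
    by (rule Psi_Kd)
  moreover have "Psi (Kd F) = bd A (Psi F)"
    by (rule ext) (rule Psi_Kd[OF assms(1)])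
  ultimately have "Psi (Kd (Kd F)) as = bd A (bd A (Psi F)) as" for as
    by simp
  then have "Psi (Kd (Kd F)) = (\<lambda>as. 0)"
    by (simp add: A.bd_bd fun_eq_iff)
  then show ?thesis
    using Phi_Psi[OF assms(2), of "Kd (Kd F)" b] by (simp add: Phi_def rsh_def[abs_def] lin_ext_def)
qed

end


subsection \<open>Comparison of cochains\<close>

context bimodule_algebra
begin

text \<open>\<open>left_linear\<close> also speaks about single factors, where cochains
  vanish.\<close>

lemma bar_cochains_iff:
  "f \<in> bar_cochains A B l r \<longleftrightarrow>
     (\<forall>as. length as < 2 \<longrightarrow> f as = 0) \<and> (\<exists>M. \<forall>as. length as > M \<longrightarrow> f as = 0) \<and> left_linear f \<and>
     (\<forall>a a' as. as \<noteq> [] \<longrightarrow> f (as @ [mul A a' a]) = r (f (as @ [a'])) a)"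
proof -
  have "left_linear f \<longleftrightarrow> multilinear f \<and> (\<forall>a a' as. as \<noteq> [] \<longrightarrow> f (mul A a a' # as) = l a (f (a' # as)))"
    if "\<And>as. length as < 2 \<Longrightarrow> f as = 0"
    unfolding left_linear_def
  proof (intro conj_cong refl iffI allI impI)
    fix a a' as assume "\<forall>a a' as. as \<noteq> [] \<longrightarrow> f (mul A a a' # as) = l a (f (a' # as))"
    then show "f (mul A a a' # as) = l a (f (a' # as))"
      by (cases "as = []") (simp_all add: that)
  qed simp
  then show ?thesis
    unfolding bar_cochains_def mem_Collect_eq multilinear_def lin_def by meson
qed

lemma bar_cochain_small: "f \<in> bar_cochains A B l r \<Longrightarrow> length as < 2 \<Longrightarrow> f as = 0"
  and bar_cochain_left_linear: "f \<in> bar_cochains A B l r \<Longrightarrow> left_linear f"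
  and bar_cochain_right: "f \<in> bar_cochains A B l r \<Longrightarrow> as \<noteq> [] \<Longrightarrow> f (as @ [mul A a' a]) = r (f (as @ [a'])) a"
  and bar_cochain_bound: "f \<in> bar_cochains A B l r \<Longrightarrow> \<exists>M. \<forall>as. length as > M \<longrightarrow> f as = 0"
  by (simp_all add: bar_cochains_iff)

lemma bar_cochain_rsh:
  assumes "f \<in> bar_cochains A B l r" "length as \<ge> 2"
  shows "rsh A a f as = r (f as) a"
proof -
  obtain bs b where as: "as = bs @ [b]" using assms(2) by (cases as rule: rev_cases) auto
  then have "bs \<noteq> []" using assms(2) by auto
  then show ?thesis using bar_cochain_right[OF assms(1)] by (simp add: as)
qed

end

context quantum_bimodule
begin

lemma Kd_add: "Kd (\<lambda>J b. F J b + F' J b) J b = Kd F J b + Kd F' J b"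
  by (simp add: Kd_def l_add_right B.V.scale_right_distrib sum.distrib[symmetric] algebra_simps)

lemma Kd_left_hom: "left_hom p \<Longrightarrow> Kd (\<lambda>J b. p (F J b)) J b = p (Kd F J b)"
  by (simp add: Kd_def left_hom_sum left_hom_diff left_hom_smul left_hom_l left_hom_0)

lemma Kd_cong:
  assumes "\<And>K c. K \<subseteq> {1..N} \<Longrightarrow> Suc (card K) = card J \<Longrightarrow> F K c = F' K c"
  shows "Kd F J b = Kd F' J b"
proof (cases "J \<subseteq> {1..N}")
  case True
  then have "finite J" using finite_subset by auto
  then have "F (J - {i}) c = F' (J - {i}) c" if "i \<in> J" for i c
    using that True card_Suc_Diff1[of J i] by (intro assms) auto
  then show ?thesis by (simp add: Kd_def)
qed (simp add: Kd_def)

lemma bar_homotopy_comparison: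
  assumes "comparison_map N q A x \<phi>" "comparison_map N q A x \<phi>'"
  shows "bar_homotopy A B l r (Pow {1..N}) card (\<lambda>g J b. Phi \<phi> g J b - Phi \<phi>' g J b) Kd"
proof unfold_locales
  fix g g' :: "'a list \<Rightarrow> 'b" and J b
  assume "\<And>as. as \<noteq> [] \<Longrightarrow> g as = g' as"
  then show "Phi \<phi> g J b - Phi \<phi>' g J b = Phi \<phi> g' J b - Phi \<phi>' g' J b"
    using Phi_cong[of g g'] by simp
next
  fix g and J :: "nat set" and b assume g: "left_linear g" and J: "J \<in> Pow {1..N}"
  show "Phi \<phi> (bd A g) J b - Phi \<phi>' (bd A g) J b = Kd (\<lambda>J b. Phi \<phi> g J b - Phi \<phi>' g J b) J b"
  proof (cases "J = {}")
    case True
    then show ?thesis using assms g by (simp add: Phi_bd_empty Kd_def)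
  next
    case False
    then have "Phi \<phi> (bd A g) J b = Kd (\<lambda>J b. (Phi \<phi> g J b - Phi \<phi>' g J b) + Phi \<phi>' g J b) J b"
      using assms g J by (simp add: Phi_bd)
    then show ?thesis
      unfolding Kd_add using False assms g J by (simp add: Phi_bd)
  qed
next
  fix J :: "nat set" and F F' :: "nat set \<Rightarrow> 'a \<Rightarrow> 'b" and b
  assume "\<And>K c. K \<in> Pow {1..N} \<Longrightarrow> Suc (card K) = card J \<Longrightarrow> F K c = F' K c"
  then show "Kd F J b = Kd F' J b" by (intro Kd_cong) auto
next
  fix J :: "nat set" and F a b
  show "Kd (\<lambda>J c. F J (mul A c a)) J b = Kd F J (mul A b a)"
    using shr_Kd[of a F] by (simp add: shr_def[abs_def] fun_eq_iff)
qed (simp_all add: Phi_add Phi_left_hom left_hom_diff Phi_rsh Kd_add Kd_left_hom Kd_Kd linear_family_def)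

text \<open>A nonempty list \<open>as\<close> serves as a generator of degree
  \<open>length as - 1\<close>, with the final factor \<open>b\<close> as its coefficient. In degree
  0 the face onto the augmentation term is cut off.\<close>

definition bar_D :: "('a list \<Rightarrow> 'a \<Rightarrow> 'b) \<Rightarrow> 'a list \<Rightarrow> 'a \<Rightarrow> 'b" where
  "bar_D G as b = (if length as < 2 then 0 else bd A (\<lambda>cs. G (butlast cs) (last cs)) (as @ [b]))"

text \<open>By \<open>Psi_degree\<close> only nonempty \<open>J\<close> contribute, which avoids the
  augmentation term that \<open>Phi phi0 (bd A g)\<close> has at the empty set.\<close>

lemma Psi_Phi_bd:
  assumes g: "left_linear g" and "length as \<ge> 2"
  shows "Psi (Phi phi0 (bd A g)) (as @ [b]) = bd A (Psi (Phi phi0 g)) (as @ [b])"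
proof -
  have F: "linear_family (Phi phi0 g)"
    using g by (simp add: linear_family_Phi left_linear_multilinear)
  have "Psi (\<lambda>J b. Phi phi0 (bd A g) J b - Kd (Phi phi0 g) J b) (as @ [b]) = 0"
  proof (rule Psi_degree)
    show "length (as @ [b]) = (length as - 1) + 2" using assms(2) by simp
    fix J c assume J: "J \<subseteq> {1..N}" "card J = length as - 1"
    then have "J \<noteq> {}" using assms(2) by auto
    then show "Phi phi0 (bd A g) J c - Kd (Phi phi0 g) J c = 0"
      using Phi_bd[OF comparison_map_phi0 g J(1)] by simp
  qed
  then show ?thesis
    using Psi_Kd[OF F] by (simp add: Psi_diff)
qed

text \<open>Makes the bar resolution its own source complex. In degree 0 the identity and the
  composite through the Koszul resolution both induce the identity of \<open>A\<close>, so their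
  difference respects the truncated differential.\<close>

lemma bar_homotopy_bar:
  "bar_homotopy A B l r {as. as \<noteq> []} (\<lambda>as. length as - 1)
     (\<lambda>g as b. g (as @ [b]) - Psi (Phi phi0 g) (as @ [b])) bar_D"
proof unfold_locales
  fix g g' :: "'a list \<Rightarrow> 'b" and as :: "'a list" and b
  assume eq: "\<And>as. as \<noteq> [] \<Longrightarrow> g as = g' as"
  then have "Phi phi0 g = Phi phi0 g'"
    by (intro ext Phi_cong)
  then show "g (as @ [b]) - Psi (Phi phi0 g) (as @ [b]) = g' (as @ [b]) - Psi (Phi phi0 g') (as @ [b])"
    by (simp add: eq)
next
  fix g g' :: "'a list \<Rightarrow> 'b" and as :: "'a list" and b
  show "g (as @ [b]) + g' (as @ [b]) - Psi (Phi phi0 (\<lambda>as. g as + g' as)) (as @ [b])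
      = g (as @ [b]) - Psi (Phi phi0 g) (as @ [b]) + (g' (as @ [b]) - Psi (Phi phi0 g') (as @ [b]))"
    by (simp add: Phi_add[abs_def] Psi_add)
next
  fix p and g :: "'a list \<Rightarrow> 'b" and as :: "'a list" and b assume p: "left_hom p"
  then show "p (g (as @ [b])) - Psi (Phi phi0 (\<lambda>as. p (g as))) (as @ [b])
      = p (g (as @ [b]) - Psi (Phi phi0 g) (as @ [b]))"
    by (simp add: Phi_left_hom[OF p, abs_def] Psi_left_hom left_hom_diff)
next
  fix g :: "'a list \<Rightarrow> 'b" and as :: "'a list" and a b
  have "Phi phi0 (rsh A a g) = shr a (Phi phi0 g)"
    by (intro ext) (simp add: Phi_rsh shr_def)
  then show "rsh A a g (as @ [b]) - Psi (Phi phi0 (rsh A a g)) (as @ [b])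
      = g (as @ [mul A b a]) - Psi (Phi phi0 g) (as @ [mul A b a])"
    by (simp add: Psi_shr)
next
  fix g and as :: "'a list" and b assume g: "left_linear g" and "as \<in> {as. as \<noteq> []}"
  then have as: "as \<noteq> []" by simp
  show "bd A g (as @ [b]) - Psi (Phi phi0 (bd A g)) (as @ [b])
      = bar_D (\<lambda>as b. g (as @ [b]) - Psi (Phi phi0 g) (as @ [b])) as b"
  proof (cases "length as < 2")
    case True
    then obtain a where "as = [a]" using as by (cases as) auto
    then show ?thesis
      using Phi_bd_empty[OF comparison_map_phi0 g] left_linearD[OF g, of a b "[]"]
      by (simp add: bar_D_def)
  next
    case False
    have "bar_D (\<lambda>as b. g (as @ [b]) - Psi (Phi phi0 g) (as @ [b])) as b
        = bd A (\<lambda>cs. g (butlast cs @ [last cs]) - Psi (Phi phi0 g) (butlast cs @ [last cs])) (as @ [b])"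
      using False by (simp add: bar_D_def)
    also have "\<dots> = bd A (\<lambda>cs. g cs - Psi (Phi phi0 g) cs) (as @ [b])"
    proof (rule bd_cong)
      fix cs :: "'a list" assume "Suc (length cs) = length (as @ [b])"
      then have "cs \<noteq> []" using as by auto
      then show "g (butlast cs @ [last cs]) - Psi (Phi phi0 g) (butlast cs @ [last cs])
          = g cs - Psi (Phi phi0 g) cs"
        by simp
    qed
    finally show ?thesis
      using Psi_Phi_bd[OF g, of as b] False by (simp add: bd_diff)
  qed
next
  fix as :: "'a list" and G G' :: "'a list \<Rightarrow> 'a \<Rightarrow> 'b" and b
  assume "\<And>cs c. cs \<in> {as. as \<noteq> []} \<Longrightarrow> Suc (length cs - 1) = length as - 1 \<Longrightarrow> G cs c = G' cs c"
  then have G: "G cs c = G' cs c" if "cs \<noteq> []" "Suc (length cs) = length as" for cs c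
    using that by (cases cs) auto
  show "bar_D G as b = bar_D G' as b"
  proof (cases "length as < 2")
    case False
    have "bd A (\<lambda>cs. G (butlast cs) (last cs)) (as @ [b]) = bd A (\<lambda>cs. G' (butlast cs) (last cs)) (as @ [b])"
    proof (rule bd_cong)
      fix cs :: "'a list" assume "Suc (length cs) = length (as @ [b])"
      then show "G (butlast cs) (last cs) = G' (butlast cs) (last cs)"
        using False by (intro G) (cases cs rule: rev_cases; auto)+
    qed
    then show ?thesis by (simp add: bar_D_def)
  qed (simp add: bar_D_def)
next
  fix G G' :: "'a list \<Rightarrow> 'a \<Rightarrow> 'b" and as :: "'a list" and b
  show "bar_D (\<lambda>cs c. G cs c + G' cs c) as b = bar_D G as b + bar_D G' as b"
    by (simp add: bar_D_def bd_add)
next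
  fix p and G :: "'a list \<Rightarrow> 'a \<Rightarrow> 'b" and as :: "'a list" and b assume "left_hom p"
  then show "bar_D (\<lambda>cs c. p (G cs c)) as b = p (bar_D G as b)"
    using bd_hom[of p A "\<lambda>cs. G (butlast cs) (last cs)" "as @ [b]"]
    by (simp add: bar_D_def left_hom_diff left_hom_0)
next
  fix as :: "'a list" and G :: "'a list \<Rightarrow> 'a \<Rightarrow> 'b" and a b
  have "bar_D (\<lambda>cs c. G cs (mul A c a)) as b = bar_D G as (mul A b a)" if "length as \<ge> 2"
  proof -
    have "bd A (\<lambda>cs. G (butlast cs) (mul A (last cs) a)) (as @ [b])
        = bd A (rsh A a (\<lambda>cs. G (butlast cs) (last cs))) (as @ [b])"
      by (simp add: rsh_def[abs_def])
    then show ?thesis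
      using that by (simp add: bar_D_def A.bd_rsh)
  qed
  then show "bar_D (\<lambda>cs c. G cs (mul A c a)) as b = bar_D G as (mul A b a)"
    by (cases "length as \<ge> 2") (simp_all add: bar_D_def)
next
  fix as :: "'a list" and G :: "'a list \<Rightarrow> 'a \<Rightarrow> 'b" and b
  show "bar_D (bar_D G) as b = 0"
  proof (cases "length as \<ge> 3")
    case True
    have "bd A (\<lambda>cs. bar_D G (butlast cs) (last cs)) (as @ [b])
        = bd A (bd A (\<lambda>cs. G (butlast cs) (last cs))) (as @ [b])"
    proof (rule bd_cong)
      fix cs :: "'a list" assume "Suc (length cs) = length (as @ [b])"
      then have "length (butlast cs) \<ge> 2" "cs \<noteq> []" using True by auto
      then show "bar_D G (butlast cs) (last cs) = bd A (\<lambda>cs. G (butlast cs) (last cs)) cs"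
        by (simp add: bar_D_def)
    qed
    then show ?thesis by (simp add: bar_D_def A.bd_bd)
  next
    case False
    have "bd A (\<lambda>cs. bar_D G (butlast cs) (last cs)) (as @ [b]) = bd A (\<lambda>cs. 0) (as @ [b])"
    proof (rule bd_cong)
      fix cs :: "'a list" assume "Suc (length cs) = length (as @ [b])"
      then have "length (butlast cs) < 2" using False by simp
      then show "bar_D G (butlast cs) (last cs) = 0" by (simp add: bar_D_def)
    qed
    then show ?thesis by (simp add: bar_D_def)
  qed
qed

section \<open>Koszul cochains as right linear families, and pullback along comparison maps\<close>

abbreviation "kd \<equiv> koszul_diff N q x (smul B) l r"

abbreviation "kcarrier \<equiv> carrier (tensor_ext N (\<lambda>i j. inverse (q i j)) B)"

lemma kcarrier_iff: "u \<in> kcarrier \<longleftrightarrow> (\<forall>J. \<not> J \<subseteq> {1..N} \<longrightarrow> u J = 0)"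
  by (simp add: tensor_ext_def)

text \<open>The bimodule map with value \<open>u J\<close> on the generator of \<open>J\<close>; it
  embeds Koszul cochains into the left linear families treated so far.\<close>

definition right_family :: "(nat set \<Rightarrow> 'b) \<Rightarrow> nat set \<Rightarrow> 'a \<Rightarrow> 'b" where
  "right_family u J b = r (u J) b"

lemma linear_right_family: "linear_family (right_family u)"
  by (simp add: linear_family_def right_family_def[abs_def] lin_r_right)

lemma kd_eq:
  "kd u J = (if J \<subseteq> {1..N} then \<Sum>i\<in>J. smul B (left_coeff q i J) (l (x i) (u (J - {i})))
      - smul B (right_coeff q i J) (r (u (J - {i})) (x i)) else 0)"
  by (cases "J \<subseteq> {1..N}") (simp_all only: B.V.koszul_diff_eq if_True if_False, simp add: koszul_diff_def)

lemma Kd_right_family: "Kd (right_family u) = right_family (kd u)"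
  by (intro ext)
    (simp add: Kd_def right_family_def kd_eq r_sum_left r_diff_left r_smul_left l_r r_mul)

lemma kd_carrier: "kd u \<in> kcarrier"
  by (simp add: kcarrier_iff kd_eq)

lemma kd_kd: "kd (kd u) J = 0"
proof (cases "J \<subseteq> {1..N}")
  case True
  have "r (kd (kd u) J) (unity A) = 0"
    using Kd_Kd[OF linear_right_family True, of u "unity A"]
    unfolding Kd_right_family by (simp add: right_family_def)
  then show ?thesis by (simp add: r_unity)
qed (simp add: kd_eq)

lemma kd_add: "kd (\<lambda>J. u J + v J) J = kd u J + kd v J"
  by (simp add: kd_eq l_add_right r_add_left B.V.scale_right_distrib sum.distrib[symmetric] algebra_simps)

lemma kd_smul: "kd (\<lambda>J. smul B c (u J)) J = smul B c (kd u J)"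
  by (simp add: kd_eq l_smul_right r_smul_left B.V.scale_sum_right B.V.scale_right_diff_distrib mult.commute)

abbreviation "pb \<equiv> pullback N B"

lemma pullback_carrier: "pb \<phi> f \<in> kcarrier"
  by (simp add: kcarrier_iff pullback_def)

lemma pullback_eq_Phi:
  assumes \<phi>: "comparison_map N q A x \<phi>" and J: "J \<subseteq> {1..N}"
  shows "pb \<phi> f J = Phi \<phi> f J (unity A)"
proof -
  have "lin_ext (smul B) f (\<phi> J) = lin_ext (smul B) (rsh A (unity A) f) (\<phi> J)"
  proof (rule lin_ext_cong)
    fix as assume "as \<in> Poly_Mapping.keys (\<phi> J)"
    then have "as \<noteq> []" using comparison_map_length[OF \<phi> J] by fastforce
    then show "f as = rsh A (unity A) f as" by (simp add: rsh_def A.mul_unity)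
  qed
  then show ?thesis using J by (simp add: pullback_def Phi_def)
qed

lemma Phi_cochain:
  assumes \<phi>: "comparison_map N q A x \<phi>" and J: "J \<subseteq> {1..N}" and f: "f \<in> bar_cochains A B l r"
  shows "Phi \<phi> f J b = right_family (pb \<phi> f) J b"
proof -
  have "Phi \<phi> f J b = lin_ext (smul B) (\<lambda>as. r (f as) b) (\<phi> J)"
    unfolding Phi_def
    by (rule lin_ext_cong, rule bar_cochain_rsh[OF f]) (simp add: comparison_map_length[OF \<phi> J])
  also have "\<dots> = r (lin_ext (smul B) f (\<phi> J)) b"
    by (rule left_hom_lin_ext[OF left_hom_r, symmetric])
  finally show ?thesis using J by (simp add: right_family_def pullback_def)
qed

lemma pullback_bar_diff:
  assumes \<phi>: "comparison_map N q A x \<phi>" and f: "f \<in> bar_cochains A B l r"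
  shows "pb \<phi> (bar_diff A B f) = kd (pb \<phi> f)"
proof
  fix J
  show "pb \<phi> (bar_diff A B f) J = kd (pb \<phi> f) J"
  proof (cases "J \<subseteq> {1..N}")
    case J: True
    note ll = bar_cochain_left_linear[OF f]
    show ?thesis
    proof (cases "J = {}")
      case True
      then show ?thesis
        using pullback_eq_Phi[OF \<phi> J] Phi_bd_empty[OF \<phi> ll] bar_cochain_small[OF f]
        by (simp add: bar_diff_eq kd_eq)
    next
      case False
      have "pb \<phi> (bar_diff A B f) J = Kd (Phi \<phi> f) J (unity A)"
        using pullback_eq_Phi[OF \<phi> J] Phi_bd[OF \<phi> ll J False] by (simp add: bar_diff_eq)
      also have "\<dots> = Kd (right_family (pb \<phi> f)) J (unity A)"
        by (rule Kd_cong) (rule Phi_cochain[OF \<phi> _ f])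
      finally show ?thesis
        unfolding Kd_right_family by (simp add: right_family_def r_unity)
    qed
  qed (simp add: pullback_def kd_eq)
qed

text \<open>On a cocycle the homotopy gives a right linear family by \<open>S_right\<close>, hence a
  Koszul cochain: its values at the unit form \<open>u\<close>.\<close>

lemma comparison_maps_agree:
  assumes "comparison_map N q A x \<phi>" "comparison_map N q A x \<phi>'" and f: "f \<in> bar_cocycles A B l r"
  obtains u where "u \<in> kcarrier" "\<And>J. pb \<phi> f J - pb \<phi>' f J = kd u J"
proof
  interpret bar_homotopy A B l r "Pow {1..N}" card "\<lambda>g J b. Phi \<phi> g J b - Phi \<phi>' g J b" Kd
    using assms by (intro bar_homotopy_comparison)
  have f': "f \<in> bar_cochains A B l r" and 0: "bd A f = (\<lambda>_. 0)"
    using f by (simp_all add: bar_cocycles_def bar_diff_eq)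
  define u where "u J = (if J \<subseteq> {1..N} then S (card J) f J (unity A) else 0)" for J
  show "u \<in> kcarrier" by (simp add: kcarrier_iff u_def)
  have S: "S (card J) f J b = right_family u J b" if "J \<subseteq> {1..N}" for J b
    using S_right[of J b f "card J" "unity A"] bar_cochain_rsh[OF f'] that
    by (simp add: right_family_def u_def A.unity_mul)
  fix J
  show "pb \<phi> f J - pb \<phi>' f J = kd u J"
  proof (cases "J \<subseteq> {1..N}")
    case J: True
    have *: "pb \<phi> f J - pb \<phi>' f J = (case card J of 0 \<Rightarrow> 0 | Suc m \<Rightarrow> Kd (S m f) J (unity A))"
      using homotopy_cocycle[OF bar_cochain_left_linear[OF f'] _ 0, of J "unity A"] J assms(1,2)
      by (simp add: pullback_eq_Phi)
    show ?thesis
    proof (cases "card J")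
      case 0
      then have "J = {}" using finite_subset[OF J] by simp
      then show ?thesis using * by (simp add: kd_eq)
    next
      case (Suc m)
      have "Kd (S m f) J (unity A) = Kd (right_family u) J (unity A)"
        by (rule Kd_cong) (use Suc S in auto)
      then show ?thesis
        using * Suc unfolding Kd_right_family by (simp add: right_family_def r_unity)
    qed
  qed (simp add: pullback_def kd_eq)
qed

section \<open>From Koszul cochains to bar cochains\<close>

abbreviation "psi u \<equiv> Psi (right_family u)"

text \<open>There are no subsets with more than \<open>N\<close> elements; this provides the bounded
  support demanded of a cochain.\<close>

lemma Psi_large:
  assumes "length as > N + 2"
  shows "Psi F as = 0"
proof (rule Psi_degree)
  show "length as = (length as - 2) + 2" using assms by simp
  fix J b assume "J \<subseteq> {1..N}" "card J = length as - 2"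
  then show "F J b = 0" using assms card_mono[of "{1..N}" J] by simp
qed

lemma psi_bar_cochain: "psi u \<in> bar_cochains A B l r"
  unfolding bar_cochains_iff
proof (intro conjI allI impI exI)
  fix as :: "'a list" assume "length as < 2"
  then have "as = [] \<or> (\<exists>a. as = [a])" by (cases as) auto
  then show "psi u as = 0" by auto
next
  fix a a' and as :: "'a list"
  have "shr a (right_family u) = (\<lambda>J b. r (right_family u J b) a)"
    by (intro ext) (simp add: shr_def right_family_def r_mul)
  then show "psi u (as @ [mul A a' a]) = r (psi u (as @ [a'])) a"
    using Psi_shr[of a "right_family u" as a'] by (simp add: Psi_left_hom[OF left_hom_r])
next
  show "\<And>as. N + 2 < length as \<Longrightarrow> psi u as = 0" by (rule Psi_large)
qed (rule left_linear_Psi[OF linear_right_family])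

lemma bar_diff_psi: "bar_diff A B (psi u) = psi (kd u)"
  using Psi_Kd[OF linear_right_family, of u] by (simp add: bar_diff_eq Kd_right_family fun_eq_iff)

lemma pullback_psi: "u \<in> kcarrier \<Longrightarrow> pb phi0 (psi u) = u"
proof
  fix J assume "u \<in> kcarrier"
  then show "pb phi0 (psi u) J = u J"
    using pullback_eq_Phi[OF comparison_map_phi0, of J "psi u"] Phi_Psi[of J "right_family u" "unity A"]
    by (cases "J \<subseteq> {1..N}") (simp_all add: right_family_def r_unity pullback_def kcarrier_iff)
qed

text \<open>The homotopy \<open>S\<close> separates the last factor from the others, so most of the
  work is to reassemble it into a function of whole lists that is linear in every factor and has
  bounded support.\<close>

lemma psi_pullback_homotopic:
  assumes f: "f \<in> bar_cocycles A B l r"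
  obtains g where "g \<in> bar_cochains A B l r" "\<And>as. f as - psi (pb phi0 f) as = bar_diff A B g as"
proof -
  interpret bar_homotopy A B l r "{as. as \<noteq> []}" "\<lambda>as. length as - 1"
    "\<lambda>g as b. g (as @ [b]) - Psi (Phi phi0 g) (as @ [b])" bar_D
    by (rule bar_homotopy_bar)
  have f': "f \<in> bar_cochains A B l r" and 0: "bd A f = (\<lambda>_. 0)"
    using f by (simp_all add: bar_cocycles_def bar_diff_eq)
  note ll = bar_cochain_left_linear[OF f']
  define LS where "LS m g as = (if length as < 2 then 0 else S m g (butlast as) (last as))" for m g as
  have LS_bd: "bar_D (S m g) as b = bd A (LS m g) (as @ [b])" if ne: "as \<noteq> []" for m g as b
  proof (cases "length as < 2")
    case True
    then obtain a where "as = [a]" using ne by (cases as) auto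
    then show ?thesis by (simp add: bar_D_def LS_def)
  next
    case False
    then have "bd A (\<lambda>cs. S m g (butlast cs) (last cs)) (as @ [b]) = bd A (LS m g) (as @ [b])"
      by (intro bd_cong) (simp add: LS_def)
    then show ?thesis using False by (simp add: bar_D_def)
  qed
  \<comment> \<open>\<open>lin_S\<close> covers the last factor. For the others it is enough that,
    with the last factor fixed, the homotopy is a left linear functional applied to the list with a
    unit appended.\<close>
  have slots: "left_linear (LS m g)"
    if Q: "\<And>b. \<exists>Q. left_linear Q \<and> (\<forall>as. as \<noteq> [] \<longrightarrow> S m g as b = Q (as @ [unity A]))"
      and g: "left_linear g" for m g
    unfolding left_linear_def multilinear_def
  proof (intro conjI allI)
    fix us vs
    show "lin (\<lambda>a. LS m g (us @ [a] @ vs))"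
    proof (cases vs rule: rev_cases)
      case Nil
      then show ?thesis
        using lin_S[OF left_linear_multilinear[OF g], of m us]
        by (cases us) (simp_all add: LS_def lin_fun_zero)
    next
      case (snoc vs' b)
      obtain Q where "left_linear Q" "\<And>as. as \<noteq> [] \<Longrightarrow> S m g as b = Q (as @ [unity A])"
        using Q by blast
      then show ?thesis
        using multilinearD[OF left_linear_multilinear, of Q us "vs' @ [unity A]"] snoc
        by (simp add: LS_def butlast_append)
    qed
  next
    fix a a' as
    show "LS m g (mul A a a' # as) = l a (LS m g (a' # as))"
    proof (cases as rule: rev_cases)
      case Nil
      then show ?thesis by (simp add: LS_def)
    next
      case (snoc cs b)
      obtain Q where "left_linear Q" "\<And>as. as \<noteq> [] \<Longrightarrow> S m g as b = Q (as @ [unity A])"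
        using Q by blast
      then show ?thesis
        using snoc by (simp add: LS_def left_linearD)
    qed
  qed
  have LS: "left_linear (LS m g)" if "left_linear g" for m g
    using that
  proof (induction m arbitrary: g)
    case 0
    have h: "left_linear (tapp A (rsh A b g))" for b
      using 0 by (simp add: left_linear_tapp left_linear_rsh)
    show ?case
    proof (rule slots[OF _ 0])
      fix b
      let ?h = "tapp A (rsh A b g)"
      have "left_linear (\<lambda>cs. ?h cs - Psi (Phi phi0 ?h) cs)"
        using h by (intro left_linear_diff left_linear_Psi linear_family_Phi left_linear_multilinear)
      then show "\<exists>Q. left_linear Q \<and> (\<forall>as. as \<noteq> [] \<longrightarrow> S 0 g as b = Q (as @ [unity A]))"
        by (auto intro!: exI[of _ "\<lambda>cs. ?h cs - Psi (Phi phi0 ?h) cs"])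
    qed
  next
    case (Suc m)
    have h: "left_linear (tapp A (rsh A b g))" for b
      using Suc.prems by (simp add: left_linear_tapp left_linear_rsh)
    show ?case
    proof (rule slots[OF _ Suc.prems])
      fix b
      let ?h = "tapp A (rsh A b g)"
      have "left_linear (\<lambda>cs. (?h cs - Psi (Phi phi0 ?h) cs) - bd A (LS m ?h) cs)"
        using h by (intro left_linear_diff left_linear_Psi linear_family_Phi left_linear_multilinear
            left_linear_bd Suc.IH)
      then show "\<exists>Q. left_linear Q \<and> (\<forall>as. as \<noteq> [] \<longrightarrow> S (Suc m) g as b = Q (as @ [unity A]))"
        by (auto intro!: exI[of _ "\<lambda>cs. (?h cs - Psi (Phi phi0 ?h) cs) - bd A (LS m ?h) cs"] simp: LS_bd)
    qed
  qed
  obtain M where M: "\<And>as. length as > M \<Longrightarrow> f as = 0"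
    using bar_cochain_bound[OF f'] by blast
  define K where "K = max M (N + 2)"
  \<comment> \<open>The index \<open>length as - 2\<close> is the degree of the generator
    \<open>butlast as\<close>; cutting off above \<open>K\<close> supplies bounded support.\<close>
  define g where "g as = (if length as > K then 0 else LS (length as - 2) f as)" for as
  have LSf: "multilinear (LS m f)" "LS m f (mul A a a' # as) = l a (LS m f (a' # as))" for m a a' as
    using LS[OF ll, of m] by (simp_all add: left_linear_def)
  have "left_linear g"
    unfolding left_linear_def multilinear_def
  proof (intro conjI allI)
    fix us vs
    show "lin (\<lambda>a. g (us @ [a] @ vs))"
      using multilinearD[OF LSf(1), of "length us + length vs - 1" us vs]
      by (cases "K < Suc (length us + length vs)") (simp_all add: g_def lin_fun_zero numeral_2_eq_2)
  qed (simp add: g_def LSf(2))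
  moreover have "g (as @ [mul A a' a]) = r (g (as @ [a'])) a" if "as \<noteq> []" for a a' as
    using S_right[of as a f _ a'] bar_cochain_rsh[OF f'] that
    by (simp add: g_def LS_def)
  ultimately have cochain: "g \<in> bar_cochains A B l r"
    unfolding bar_cochains_iff by (auto simp: g_def LS_def intro!: exI[of _ K])
  have psi: "Psi (Phi phi0 f) as = psi (pb phi0 f) as" for as
    by (rule Psi_cong) (rule Phi_cochain[OF comparison_map_phi0 _ f'])
  have "f as - psi (pb phi0 f) as = bar_diff A B g as" for as
  proof (cases "length as < 2")
    case True
    then have "as = [] \<or> (\<exists>a. as = [a])" by (cases as) auto
    then show ?thesis
      using bar_cochain_small[OF f' True] by (auto simp: bar_diff_eq)
  next
    case False
    then obtain cs b where as: "as = cs @ [b]" by (cases as rule: rev_cases) auto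
    with False have cs: "cs \<noteq> []" by auto
    have *: "f as - psi (pb phi0 f) as = (case length cs - 1 of 0 \<Rightarrow> 0 | Suc m \<Rightarrow> bar_D (S m f) cs b)"
      using homotopy_cocycle[OF ll _ 0, of cs b] cs by (simp add: as psi)
    show ?thesis
    proof (cases "length cs - 1")
      case 0
      then obtain c where "cs = [c]" using cs by (cases cs) auto
      then show ?thesis using * 0 by (simp add: as bar_diff_eq g_def LS_def)
    next
      case (Suc m)
      then have len: "length cs = m + 2" by simp
      show ?thesis
      proof (cases "m + 2 \<le> K")
        case True
        have "bd A g as = bd A (LS m f) as"
          by (rule bd_cong) (use True len as in \<open>simp add: g_def\<close>)
        then show ?thesis using * Suc cs by (simp add: LS_bd as bar_diff_eq)
      next
        case False
        \<comment> \<open>Beyond the cut-off \<open>f\<close> and \<open>psi (pb phi0 f)\<close>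
          vanish as well, so the identity persists.\<close>
        have "bd A g as = bd A (\<lambda>_. 0) as"
          by (rule bd_cong) (use False len as in \<open>simp add: g_def\<close>)
        moreover have "f as = 0" by (rule M) (use False len in \<open>simp add: as K_def\<close>)
        moreover have "psi (pb phi0 f) as = 0" by (rule Psi_large) (use False len in \<open>simp add: as K_def\<close>)
        ultimately show ?thesis by (simp add: bar_diff_eq)
      qed
    qed
  qed
  with cochain show thesis by (rule that)
qed


subsection \<open>The product of the tensor product algebra\<close>

sublocale ext: exterior_parameters N "\<lambda>i j. inverse (q i j)"
  by unfold_locales (auto simp: quantum_parameters_def q_nonzero inverse_q q_diag)

definition set_cross :: "nat set \<Rightarrow> nat set \<Rightarrow> 'k" where
  "set_cross I J = cross_coeff e (sorted_list_of_set I) (sorted_list_of_set J)"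

lemma mset_sorted_list_of_set_Un:
  "finite I \<Longrightarrow> finite J \<Longrightarrow> I \<inter> J = {} \<Longrightarrow>
     mset (sorted_list_of_set (I \<union> J)) = mset (sorted_list_of_set I @ sorted_list_of_set J)"
  by (simp add: mset_set_Union flip: sorted_list_of_mset_set)

lemma set_cross_Un_left:
  assumes "finite I" "finite J" "I \<inter> J = {}"
  shows "set_cross (I \<union> J) K = set_cross I K * set_cross J K"
  unfolding set_cross_def cross_coeff_append_left[symmetric]
  by (rule cross_coeff_mset[OF mset_sorted_list_of_set_Un[OF assms] refl])

lemma set_cross_Un_right:
  assumes "finite I" "finite J" "I \<inter> J = {}"
  shows "set_cross K (I \<union> J) = set_cross K I * set_cross K J"
  unfolding set_cross_def cross_coeff_append_right[symmetric]
  by (rule cross_coeff_mset[OF refl mset_sorted_list_of_set_Un[OF assms]])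

lemma set_cross_empty [simp]: "set_cross {} K = 1" "set_cross K {} = 1"
  by (simp_all add: set_cross_def)

abbreviation "kmult \<equiv> tensor_ext_mult N (\<lambda>i j. inverse (q i j)) B"

text \<open>A structure constant can be nonzero only if the two index sets partition
  \<open>K\<close>, so the double sum collapses to the subsets of \<open>K\<close>.\<close>

lemma kmult_eq:
  "kmult u v K = (if K \<subseteq> {1..N} then
     \<Sum>I\<in>Pow K. smul B (set_cross I (K - I)) (mul B (u I) (v (K - I))) else 0)"
proof -
  have inner: "(\<Sum>J\<in>Pow {1..N}. smul B (ext_coeff N (\<lambda>i j. inverse (q i j)) I J K) (mul B (u I) (v J)))
     = (if I \<subseteq> K \<and> K \<subseteq> {1..N} then smul B (set_cross I (K - I)) (mul B (u I) (v (K - I))) else 0)"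
    if I: "I \<in> Pow {1..N}" for I
  proof -
    have "(\<Sum>J\<in>Pow {1..N}. smul B (ext_coeff N (\<lambda>i j. inverse (q i j)) I J K) (mul B (u I) (v J)))
      = (\<Sum>J\<in>Pow {1..N}. if J = K - I then
          (if I \<subseteq> K then smul B (set_cross I (K - I)) (mul B (u I) (v (K - I))) else 0) else 0)"
    proof (rule sum.cong)
      fix J assume J: "J \<in> Pow {1..N}"
      have "(I \<inter> J = {} \<and> K = I \<union> J) \<longleftrightarrow> (J = K - I \<and> I \<subseteq> K)" by blast
      then show "smul B (ext_coeff N (\<lambda>i j. inverse (q i j)) I J K) (mul B (u I) (v J))
        = (if J = K - I then
          (if I \<subseteq> K then smul B (set_cross I (K - I)) (mul B (u I) (v (K - I))) else 0) else 0)"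
        using I J by (simp add: ext.ext_coeff_eq set_cross_def)
    qed simp
    also have "\<dots> = (if K - I \<subseteq> {1..N} \<and> I \<subseteq> K then smul B (set_cross I (K - I)) (mul B (u I) (v (K - I))) else 0)"
      by (subst sum.delta) auto
    also have "\<dots> = (if I \<subseteq> K \<and> K \<subseteq> {1..N} then smul B (set_cross I (K - I)) (mul B (u I) (v (K - I))) else 0)"
      using I by (intro if_cong) auto
    finally show ?thesis .
  qed
  show ?thesis
  proof (cases "K \<subseteq> {1..N}")
    case True
    have "kmult u v K = (\<Sum>I\<in>Pow {1..N}. if I \<subseteq> K then smul B (set_cross I (K - I)) (mul B (u I) (v (K - I))) else 0)"
      unfolding tensor_ext_mult_def by (rule sum.cong) (use inner True in auto)
    also have "\<dots> = (\<Sum>I\<in>Pow K. if I \<subseteq> K then smul B (set_cross I (K - I)) (mul B (u I) (v (K - I))) else 0)"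
      by (rule sum.mono_neutral_right) (use True in auto)
    also have "\<dots> = (\<Sum>I\<in>Pow K. smul B (set_cross I (K - I)) (mul B (u I) (v (K - I))))"
      by (rule sum.cong) auto
    finally show ?thesis using True by simp
  next
    case False
    have "kmult u v K = (\<Sum>I\<in>Pow {1..N}. 0)"
      unfolding tensor_ext_mult_def by (rule sum.cong) (use inner False in auto)
    then show ?thesis using False by simp
  qed
qed

lemma kmult_add_left: "kmult (\<lambda>J. u J + u' J) v K = kmult u v K + kmult u' v K"
  by (simp add: kmult_eq B.mul_add_left B.V.scale_right_distrib sum.distrib)

lemma kmult_add_right: "kmult u (\<lambda>J. v J + v' J) K = kmult u v K + kmult u v' K"
  by (simp add: kmult_eq B.mul_add_right B.V.scale_right_distrib sum.distrib)

lemma kmult_one_left: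
  assumes "u \<in> kcarrier"
  shows "kmult (\<lambda>J. if J = {} then unity B else 0) u = u"
proof
  fix K
  show "kmult (\<lambda>J. if J = {} then unity B else 0) u K = u K"
  proof (cases "K \<subseteq> {1..N}")
    case True
    then have "finite K" using finite_subset by auto
    have "kmult (\<lambda>J. if J = {} then unity B else 0) u K
      = (\<Sum>I\<in>Pow K. if I = {} then u K else 0)"
      using True unfolding kmult_eq by (auto simp: B.unity_mul intro!: sum.cong)
    then show ?thesis using \<open>finite K\<close> by simp
  qed (use assms in \<open>simp add: kmult_eq kcarrier_iff\<close>)
qed

lemma kmult_one_right:
  assumes "u \<in> kcarrier"
  shows "kmult u (\<lambda>J. if J = {} then unity B else 0) = u"
proof
  fix K
  show "kmult u (\<lambda>J. if J = {} then unity B else 0) K = u K"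
  proof (cases "K \<subseteq> {1..N}")
    case True
    then have "finite K" using finite_subset by auto
    have "kmult u (\<lambda>J. if J = {} then unity B else 0) K
      = (\<Sum>I\<in>Pow K. if I = K then u K else 0)"
      using True unfolding kmult_eq by (auto simp: B.mul_unity intro!: sum.cong)
    then show ?thesis using \<open>finite K\<close> by simp
  qed (use assms in \<open>simp add: kmult_eq kcarrier_iff\<close>)
qed

text \<open>Both sides are sums over ordered partitions of \<open>K\<close> into three blocks,
  weighted by the product of the three pairwise crossing scalars.\<close>

lemma kmult_assoc: "kmult (kmult u v) w K = kmult u (kmult v w) K"
proof (cases "K \<subseteq> {1..N}")
  case True
  then have fin: "finite K" using finite_subset by auto
  have sub: "I \<subseteq> {1..N}" if "I \<subseteq> K" for I using that True by blast
  let ?t = "\<lambda>L M P. smul B (set_cross L M * set_cross L P * set_cross M P) (mul B (u L) (mul B (v M) (w P)))"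
  have "kmult (kmult u v) w K = (\<Sum>I\<in>Pow K. \<Sum>L\<in>Pow I. ?t L (I - L) (K - I))"
    unfolding kmult_eq[of "kmult u v"] if_P[OF True]
  proof (rule sum.cong[OF refl])
    fix I assume I: "I \<in> Pow K"
    have "smul B (set_cross I (K - I)) (mul B (smul B (set_cross L (I - L)) (mul B (u L) (v (I - L)))) (w (K - I)))
        = ?t L (I - L) (K - I)" if "L \<in> Pow I" for L
    proof -
      have "set_cross I (K - I) = set_cross L (K - I) * set_cross (I - L) (K - I)"
        using set_cross_Un_left[of L "I - L" "K - I"] that I fin
        by (simp add: Un_absorb1 finite_subset)
      then show ?thesis
        by (simp add: B.mul_smul_left B.mul_assoc ac_simps)
    qed
    note * = this
    have "I \<subseteq> {1..N}" using sub I by blast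
    show "smul B (set_cross I (K - I)) (mul B (kmult u v I) (w (K - I)))
        = (\<Sum>L\<in>Pow I. ?t L (I - L) (K - I))"
      unfolding kmult_eq if_P[OF \<open>I \<subseteq> {1..N}\<close>] B.mul_sum_left B.V.scale_sum_right
      by (rule sum.cong[OF refl *])
  qed
  also have "\<dots> = (\<Sum>p\<in>(SIGMA I:Pow K. Pow I). ?t (snd p) (fst p - snd p) (K - fst p))"
    using fin by (subst sum.Sigma) (auto simp: split_beta intro: finite_subset)
  also have "\<dots> = (\<Sum>p\<in>(SIGMA L:Pow K. Pow (K - L)). ?t (fst p) (snd p) (K - fst p - snd p))"
    by (rule sum.reindex_bij_witness[of _ "\<lambda>(L, M). (L \<union> M, L)" "\<lambda>(I, L). (L, I - L)"])
      (auto simp: Diff_Diff_Int intro!: arg_cong2[of _ _ _ _ "smul B"] arg_cong2[of _ _ _ _ "mul B"]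
        arg_cong2[of _ _ _ _ "(*)"] arg_cong2[of _ _ _ _ set_cross] arg_cong[of _ _ w] arg_cong[of _ _ v])
  also have "\<dots> = (\<Sum>L\<in>Pow K. \<Sum>M\<in>Pow (K - L). ?t L M (K - L - M))"
    using fin by (subst sum.Sigma) (auto simp: split_beta)
  also have "\<dots> = kmult u (kmult v w) K"
    unfolding kmult_eq[of u] if_P[OF True]
  proof (rule sum.cong[OF refl])
    fix L assume L: "L \<in> Pow K"
    have "smul B (set_cross L (K - L)) (mul B (u L) (smul B (set_cross M (K - L - M)) (mul B (v M) (w (K - L - M)))))
        = ?t L M (K - L - M)" if "M \<in> Pow (K - L)" for M
    proof -
      have "set_cross L (K - L) = set_cross L M * set_cross L (K - L - M)"
        using set_cross_Un_right[of M "K - L - M" L] that fin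
        by (simp add: Un_absorb1 finite_subset)
      then show ?thesis
        by (simp add: B.mul_smul_right ac_simps)
    qed
    note * = this
    have "K - L \<subseteq> {1..N}" using sub by blast
    show "(\<Sum>M\<in>Pow (K - L). ?t L M (K - L - M)) = smul B (set_cross L (K - L)) (mul B (u L) (kmult v w (K - L)))"
      unfolding kmult_eq if_P[OF \<open>K - L \<subseteq> {1..N}\<close>] B.mul_sum_right B.V.scale_sum_right
      by (rule sum.cong[OF refl *[symmetric]])
  qed
  finally show ?thesis .
qed (simp add: kmult_eq)

text \<open>Cutting after \<open>j\<close> generators is the summand \<open>Suc j\<close> of
  \<open>cup\<close>, because of the leading unit.\<close>

lemma cup_generators:
  "cup A B f g (unity A # map x w @ [unity A])
    = (\<Sum>j\<le>length w. mul B (f (unity A # map x (take j w) @ [unity A])) (g (unity A # map x (drop j w) @ [unity A])))"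
proof -
  let ?as = "unity A # map x w @ [unity A]"
  have "cup A B f g ?as = (\<Sum>j\<le>length w. mul B (f (take (Suc j) ?as @ [unity A])) (g (unity A # drop (Suc j) ?as)))"
    unfolding cup_def by (rule sum.reindex_bij_witness[of _ Suc "\<lambda>k. k - 1"]) auto
  also have "\<dots> = (\<Sum>j\<le>length w. mul B (f (unity A # map x (take j w) @ [unity A])) (g (unity A # map x (drop j w) @ [unity A])))"
    by (rule sum.cong) (auto simp: take_map drop_map)
  finally show ?thesis .
qed

text \<open>On the words occurring in the antisymmetrization map the cup product only sees pairs of descending
  words, that is, shuffles, and these produce the structure constants of the quantum exterior algebra.\<close>

theorem pullback_cup: "pb phi0 (cup A B (psi u) (psi v)) = kmult u v"
proof
  fix K
  show "pb phi0 (cup A B (psi u) (psi v)) K = kmult u v K"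
  proof (cases "K \<subseteq> {1..N}")
    case True
    then have fin: "finite K" using finite_subset by auto
    let ?desc = "sorted_wrt (>) :: nat list \<Rightarrow> bool"
    let ?P = "SIGMA w:permutations_of_set K. {..card K}"
    let ?t = "\<lambda>w j. smul B (cross_coeff e (take j w) (drop j w)) (mul B (u (set (take j w))) (v (set (drop j w))))"
    have gen: "smul B (inv_coeff e w) (mul B (psi u (unity A # map x (take j w) @ [unity A]))
          (psi v (unity A # map x (drop j w) @ [unity A])))
        = (if ?desc (take j w) \<and> ?desc (drop j w) then ?t w j else 0)"
      if w: "w \<in> permutations_of_set K" for w j
    proof -
      have w': "set w = K" "distinct w" using w by (simp_all add: permutations_of_set_def)
      have t: "distinct (take j w)" "set (take j w) \<subseteq> {1..N}" "distinct (drop j w)" "set (drop j w) \<subseteq> {1..N}"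
        using w' True set_take_subset[of j w] set_drop_subset[of j w] by auto
      have "inv_coeff e (take j w) \<noteq> 0" "inv_coeff e (drop j w) \<noteq> 0"
        using q_nonzero[OF subsetD[OF t(2)] subsetD[OF t(2)]] q_nonzero[OF subsetD[OF t(4)] subsetD[OF t(4)]]
        by (auto intro!: inv_coeff_nonzero)
      \<comment> \<open>The two \<open>psi\<close> factors contribute the inverses of the first two
        scalars, so only the crossing scalar remains.\<close>
      moreover have "inv_coeff e w = inv_coeff e (take j w) * inv_coeff e (drop j w) * cross_coeff e (take j w) (drop j w)"
        using inv_coeff_append[of e "take j w" "drop j w"] by simp
      ultimately show ?thesis
        unfolding Psi_generators[OF t(1,2)] Psi_generators[OF t(3,4)]
        by (auto simp: right_family_def r_unity B.mul_smul_left B.mul_smul_right field_simps)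
    qed
    have "pb phi0 (cup A B (psi u) (psi v)) K = (\<Sum>w\<in>permutations_of_set K. \<Sum>j\<le>card K.
        if ?desc (take j w) \<and> ?desc (drop j w) then ?t w j else 0)"
      using True
      by (simp add: pullback_def phi0_def B.V.lin_ext_linear cup_generators B.V.scale_sum_right gen
          length_finite_permutations_of_set cong: sum.cong)
    also have "\<dots> = (\<Sum>p\<in>?P. if ?desc (take (snd p) (fst p)) \<and> ?desc (drop (snd p) (fst p)) then ?t (fst p) (snd p) else 0)"
      by (subst sum.Sigma) (auto simp: split_beta)
    also have "\<dots> = (\<Sum>p\<in>{p \<in> ?P. ?desc (take (snd p) (fst p)) \<and> ?desc (drop (snd p) (fst p))}. ?t (fst p) (snd p))"
      by (rule sum.inter_filter[symmetric]) auto
    \<comment> \<open>A surviving pair \<open>(w, j)\<close> is determined by the set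
      \<open>I\<close> of its first \<open>j\<close> letters: \<open>w\<close> lists
      \<open>I\<close> and then \<open>K - I\<close>, each in descending order.\<close>
    also have "\<dots> = (\<Sum>I\<in>Pow K. smul B (set_cross I (K - I)) (mul B (u I) (v (K - I))))"
    proof (rule sum.reindex_bij_witness[of _ "\<lambda>I. (rev (sorted_list_of_set I) @ rev (sorted_list_of_set (K - I)), card I)"
          "\<lambda>p. set (take (snd p) (fst p))"])
      fix p assume "p \<in> {p \<in> ?P. ?desc (take (snd p) (fst p)) \<and> ?desc (drop (snd p) (fst p))}"
      then obtain w j where p: "p = (w, j)" and w: "set w = K" "distinct w" and j: "j \<le> length w"
        and d: "?desc (take j w)" "?desc (drop j w)"
        by (auto simp: permutations_of_set_def distinct_card[symmetric])
      have KI: "K - set (take j w) = set (drop j w)"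
        using w set_take_disj_set_drop_if_distinct[of w j j] set_append[of "take j w" "drop j w"] by auto
      have desc: "rev (sorted_list_of_set (set v)) = v" if "?desc v" for v
      proof -
        have "sorted_wrt (<) (rev v)" using that by (simp add: sorted_wrt_rev)
        then have "sorted_list_of_set (set (rev v)) = rev v"
          by (intro sorted_list_of_set.idem_if_sorted_distinct) (simp_all add: strict_sorted_iff)
        then show ?thesis by simp
      qed
      show "(rev (sorted_list_of_set (set (take (snd p) (fst p)))) @
          rev (sorted_list_of_set (K - set (take (snd p) (fst p)))), card (set (take (snd p) (fst p)))) = p"
        using j w(2) by (simp add: p KI desc[OF d(1)] desc[OF d(2)] distinct_card)
      show "set (take (snd p) (fst p)) \<in> Pow K"
        using w(1) set_take_subset[of j w] by (simp add: p)
      have "set_cross (set (take j w)) (set (drop j w)) = cross_coeff e (take j w) (drop j w)"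
        unfolding set_cross_def by (rule cross_coeff_mset)
          (use w(2) in \<open>simp_all add: mset_set_set flip: sorted_list_of_mset_set\<close>)
      then show "smul B (set_cross (set (take (snd p) (fst p))) (K - set (take (snd p) (fst p))))
          (mul B (u (set (take (snd p) (fst p)))) (v (K - set (take (snd p) (fst p))))) = ?t (fst p) (snd p)"
        by (simp add: p KI)
    next
      fix I assume I: "I \<in> Pow K"
      then have finI: "finite I" using fin finite_subset by auto
      let ?w = "rev (sorted_list_of_set I) @ rev (sorted_list_of_set (K - I))"
      have td: "take (card I) ?w = rev (sorted_list_of_set I)" "drop (card I) ?w = rev (sorted_list_of_set (K - I))"
        by simp_all
      show "set (take (snd (?w, card I)) (fst (?w, card I))) = I"
        using td finI by simp
      have "?desc (rev (sorted_list_of_set L))" for L :: "nat set"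
        by (simp add: sorted_wrt_rev)
      moreover have "?w \<in> permutations_of_set K"
        using I fin finI by (auto simp: permutations_of_set_def)
      moreover have "card I \<le> card K" using I fin by (simp add: card_mono)
      ultimately show "(?w, card I) \<in> {p \<in> ?P. ?desc (take (snd p) (fst p)) \<and> ?desc (drop (snd p) (fst p))}"
        using td by simp
    qed
    finally show ?thesis using True by (simp add: kmult_eq)
  qed (simp add: pullback_def kmult_eq)
qed

end


subsection \<open>The cup product of bar cochains\<close>

context bimodule_algebra
begin

definition bar_one :: "'a list \<Rightarrow> 'b" where
  "bar_one as = (if length as = 2 then r (l (as ! 0) (unity B)) (as ! 1) else 0)"

lemma cup_single [simp]: "cup A B f g [a] = 0"
  by (simp add: cup_def)

lemma cup_Cons:
  assumes "as \<noteq> []"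
  shows "cup A B f g (a # as) = mul B (f [a, unity A]) (g (unity A # as)) + cup A B (\<lambda>cs. f (a # cs)) g as"
proof -
  let ?t = "\<lambda>k. mul B (f (take k (a # as) @ [unity A])) (g (unity A # drop k (a # as)))"
  have "cup A B f g (a # as) = (\<Sum>k\<in>insert 1 {2..<Suc (length as)}. ?t k)"
    unfolding cup_def using assms by (intro sum.cong) (auto simp: Suc_le_eq)
  also have "\<dots> = ?t 1 + (\<Sum>k\<in>{2..<Suc (length as)}. ?t k)"
    by (rule sum.insert) auto
  also have "(\<Sum>k\<in>{2..<Suc (length as)}. ?t k) = cup A B (\<lambda>cs. f (a # cs)) g as"
    unfolding cup_def by (rule sum.reindex_bij_witness[of _ Suc "\<lambda>k. k - 1"]) (auto simp: take_Cons' drop_Cons')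
  finally show ?thesis by simp
qed

lemma cup_diff_left: "cup A B (\<lambda>cs. f cs - f' cs) g as = cup A B f g as - cup A B f' g as"
  by (simp add: cup_def B.mul_diff_left sum_subtractf)

lemma cup_diff_right: "cup A B f (\<lambda>cs. g cs - g' cs) as = cup A B f g as - cup A B f g' as"
  by (simp add: cup_def B.mul_diff_right sum_subtractf)

lemma cup_add_left: "cup A B (\<lambda>cs. f cs + f' cs) g as = cup A B f g as + cup A B f' g as"
  by (simp add: cup_def B.mul_add_left sum.distrib)

lemma cup_add_right: "cup A B f (\<lambda>cs. g cs + g' cs) as = cup A B f g as + cup A B f g' as"
  by (simp add: cup_def B.mul_add_right sum.distrib)

lemma cup_uminus_left: "cup A B (\<lambda>cs. - f cs) g as = - cup A B f g as"
  by (simp add: cup_def B.mul_uminus_left sum_negf)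

lemma cup_zero_left [simp]: "cup A B (\<lambda>cs. 0) g as = 0"
  by (simp add: cup_def)

lemma cup_zero_right [simp]: "cup A B f (\<lambda>cs. 0) as = 0"
  by (simp add: cup_def)

lemma lin_mul_const_left: "lin p \<Longrightarrow> lin (\<lambda>a. mul B b (p a))"
  by (simp add: lin_def B.mul_add_right B.mul_smul_right)

lemma lin_mul_const_right: "lin p \<Longrightarrow> lin (\<lambda>a. mul B (p a) b)"
  by (simp add: lin_def B.mul_add_left B.mul_smul_left)

lemma cup_cochain:
  assumes f: "f \<in> bar_cochains A B l r" and g: "g \<in> bar_cochains A B l r"
  shows "cup A B f g \<in> bar_cochains A B l r"
  unfolding bar_cochains_iff
proof (intro conjI allI impI)
  fix as :: "'a list" assume "length as < 2"
  then show "cup A B f g as = 0" by (simp add: cup_def)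
next
  obtain M M' where M: "\<And>as. length as > M \<Longrightarrow> f as = 0" "\<And>as. length as > M' \<Longrightarrow> g as = 0"
    using bar_cochain_bound f g by metis
  have "cup A B f g as = 0" if "length as > M + M'" for as
    unfolding cup_def
  proof (rule sum.neutral, rule ballI)
    fix k assume k: "k \<in> {1..<length as}"
    show "mul B (f (take k as @ [unity A])) (g (unity A # drop k as)) = 0"
    proof (cases "k \<ge> M")
      case True
      then show ?thesis using k M(1)[of "take k as @ [unity A]"] by simp
    next
      case False
      then show ?thesis using that M(2)[of "unity A # drop k as"] by simp
    qed
  qed
  then show "\<exists>M. \<forall>as. length as > M \<longrightarrow> cup A B f g as = 0" by blast
next
  note lf = bar_cochain_left_linear[OF f] and lg = bar_cochain_left_linear[OF g]
  show "left_linear (cup A B f g)"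
    unfolding left_linear_def multilinear_def
  proof (intro conjI allI)
    fix us vs
    show "lin (\<lambda>a. cup A B f g (us @ [a] @ vs))"
      unfolding cup_def length_append length_Cons list.size(3)
    proof (rule lin_fun_sum)
      fix k
      show "lin (\<lambda>a. mul B (f (take k (us @ [a] @ vs) @ [unity A])) (g (unity A # drop k (us @ [a] @ vs))))"
      proof (cases "k \<le> length us")
        case True
        then show ?thesis
          using multilinearD[OF left_linear_multilinear[OF lg], of "unity A # drop k us" vs]
          by (simp add: lin_mul_const_left)
      next
        case False
        then obtain j where "k = length us + Suc j"
          by (metis add_Suc_right less_iff_Suc_add not_le)
        then show ?thesis
          using multilinearD[OF left_linear_multilinear[OF lf], of us "take j vs @ [unity A]"]
          by (simp add: lin_mul_const_right)
      qed
    qed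
  next
    fix a a' as
    have "f (take k (mul A a a' # as) @ [unity A]) = l a (f (take k (a' # as) @ [unity A]))" if "k \<ge> 1" for k
      using that left_linearD[OF lf] by (cases k) simp_all
    moreover have "drop k (mul A a a' # as) = drop k (a' # as)" if "k \<ge> 1" for k
      using that by (cases k) simp_all
    ultimately show "cup A B f g (mul A a a' # as) = l a (cup A B f g (a' # as))"
      unfolding cup_def l_sum_right by (intro sum.cong) (simp_all add: compat_left)
  qed
next
  fix a a' and as :: "'a list" assume "as \<noteq> []"
  have "g (unity A # drop k (as @ [mul A a' a])) = r (g (unity A # drop k (as @ [a']))) a"
    if "k \<le> length as" for k
    using that bar_cochain_right[OF g, of "unity A # drop k as" a' a] by simp
  then show "cup A B f g (as @ [mul A a' a]) = r (cup A B f g (as @ [a'])) a"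
    unfolding cup_def r_sum_left by (intro sum.cong) (simp_all add: compat_right less_Suc_eq_le)
qed

lemma cup_assoc: "cup A B (cup A B f g) h as = cup A B f (cup A B g h) as"
proof -
  let ?n = "length as"
  let ?t = "\<lambda>j k. mul B (f (take j as @ [unity A]))
      (mul B (g (unity A # drop j (take k as) @ [unity A])) (h (unity A # drop k as)))"
  have "cup A B (cup A B f g) h as = (\<Sum>k\<in>{1..<?n}. \<Sum>j\<in>{1..k}. ?t j k)"
    unfolding cup_def[of _ _ _ h]
  proof (rule sum.cong[OF refl])
    fix k assume k: "k \<in> {1..<?n}"
    have "cup A B f g (take k as @ [unity A])
        = (\<Sum>j\<in>{1..k}. mul B (f (take j as @ [unity A])) (g (unity A # drop j (take k as) @ [unity A])))"
      unfolding cup_def by (rule sum.cong) (use k in \<open>auto simp: min_def\<close>)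
    then show "mul B (cup A B f g (take k as @ [unity A])) (h (unity A # drop k as)) = (\<Sum>j\<in>{1..k}. ?t j k)"
      by (simp add: B.mul_sum_left B.mul_assoc)
  qed
  also have "\<dots> = (\<Sum>p\<in>(SIGMA k:{1..<?n}. {1..k}). ?t (snd p) (fst p))"
    by (subst sum.Sigma) (auto simp: split_beta)
  \<comment> \<open>The inner product on the right starts with an extra unit, so its cut
    \<open>i\<close> is the cut \<open>j + i - 1\<close> of the original list.\<close>
  also have "\<dots> = (\<Sum>p\<in>(SIGMA j:{1..<?n}. {1..<Suc (?n - j)}). ?t (fst p) (fst p + snd p - 1))"
    by (rule sum.reindex_bij_witness[of _ "\<lambda>(j, i). (j + i - 1, j)" "\<lambda>(k, j). (j, Suc (k - j))"]) auto
  also have "\<dots> = (\<Sum>j\<in>{1..<?n}. \<Sum>i\<in>{1..<Suc (?n - j)}. ?t j (j + i - 1))"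
    by (subst sum.Sigma) (auto simp: split_beta)
  also have "\<dots> = cup A B f (cup A B g h) as"
    unfolding cup_def[of _ _ f]
  proof (rule sum.cong[OF refl])
    fix j assume "j \<in> {1..<?n}"
    have "cup A B g h (unity A # drop j as) = (\<Sum>i\<in>{1..<Suc (?n - j)}.
        mul B (g (unity A # drop j (take (j + i - 1) as) @ [unity A])) (h (unity A # drop (j + i - 1) as)))"
      unfolding cup_def
    proof (rule sum.cong)
      fix i assume "i \<in> {1..<Suc (?n - j)}"
      then obtain i' where "i = Suc i'" by (cases i) auto
      then show "mul B (g (take i (unity A # drop j as) @ [unity A])) (h (unity A # drop i (unity A # drop j as)))
        = mul B (g (unity A # drop j (take (j + i - 1) as) @ [unity A])) (h (unity A # drop (j + i - 1) as))"
        by (simp add: drop_take add.commute)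
    qed simp
    then show "(\<Sum>i\<in>{1..<Suc (?n - j)}. ?t j (j + i - 1))
        = mul B (f (take j as @ [unity A])) (cup A B g h (unity A # drop j as))"
      by (simp only: B.mul_sum_right)
  qed
  finally show ?thesis .
qed

lemma bar_one_cochain: "bar_one \<in> bar_cochains A B l r"
  unfolding bar_cochains_iff
proof (intro conjI allI impI exI[of _ 2])
  have lin_l': "lin (\<lambda>a. l a b)" for b
    by (simp add: lin_def l_add_left l_smul_left)
  show "left_linear bar_one"
    unfolding left_linear_def multilinear_def
  proof (intro conjI allI)
    fix us vs
    show "lin (\<lambda>a. bar_one (us @ [a] @ vs))"
    proof (cases "length us + length vs = 1")
      case True
      then consider v where "us = []" "vs = [v]" | u where "us = [u]" "vs = []"
        by (cases us; cases vs) auto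
      then show ?thesis
        by cases (simp_all add: bar_one_def lin_r_right lin_left_hom[OF left_hom_r lin_l'])
    next
      case False
      then have "bar_one (us @ [a] @ vs) = 0" for a
        by (simp add: bar_one_def)
      then show ?thesis by (simp add: lin_fun_zero)
    qed
  qed (simp add: bar_one_def l_mul l_r nth_Cons')
  fix a a' and as :: "'a list" assume "as \<noteq> []"
  then show "bar_one (as @ [mul A a' a]) = r (bar_one (as @ [a'])) a"
    by (cases as) (auto simp: bar_one_def r_mul)
qed (auto simp: bar_one_def)

lemma cup_one_left:
  assumes "f \<in> bar_cochains A B l r"
  shows "cup A B bar_one f as = f as"
proof (cases "length as < 2")
  case True
  then show ?thesis using bar_cochain_small[OF assms] by (simp add: cup_def)
next
  case False
  then obtain a cs where as: "as = a # cs" "cs \<noteq> []" by (cases as) auto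
  have "cup A B (\<lambda>cs. bar_one (a # cs)) f cs = 0"
    unfolding cup_def by (rule sum.neutral) (auto simp: bar_one_def)
  then have "cup A B bar_one f as = mul B (l a (unity B)) (f (unity A # cs))"
    unfolding as(1) cup_Cons[OF as(2)] by (simp add: bar_one_def r_unity)
  also have "\<dots> = f as"
    using left_linearD[OF bar_cochain_left_linear[OF assms], of a "unity A" cs]
    by (simp add: compat_left[symmetric] B.unity_mul as A.mul_unity)
  finally show ?thesis .
qed

lemma cup_one_right:
  assumes "f \<in> bar_cochains A B l r"
  shows "cup A B f bar_one as = f as"
proof (cases "length as < 2")
  case True
  then show ?thesis using bar_cochain_small[OF assms] by (simp add: cup_def)
next
  case False
  then obtain a cs where as: "as = cs @ [a]" "cs \<noteq> []" by (cases as rule: rev_cases) auto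
  have "cup A B f bar_one as = (\<Sum>k\<in>{1..<length as}. if k = length cs then
      mul B (f (cs @ [unity A])) (bar_one [unity A, a]) else 0)"
    unfolding cup_def by (rule sum.cong) (auto simp: as bar_one_def)
  also have "\<dots> = mul B (f (cs @ [unity A])) (r (unity B) a)"
    using as(2) by (simp add: as bar_one_def l_unity Suc_le_eq)
  also have "\<dots> = f as"
    using bar_cochain_right[OF assms as(2), of "unity A" a]
    by (simp add: compat_right[symmetric] B.mul_unity as A.unity_mul)
  finally show ?thesis .
qed

text \<open>The last term, which vanishes for cochains, makes the induction work: prefixing a fixed letter turns
  a cochain into a functional that need not vanish on lists of length one.\<close>

lemma cup_leibniz_aux:
  assumes bal: "balanced B l r" and g: "left_linear g" "\<And>a. g [a] = 0"
    and f: "\<And>as a a'. as \<noteq> [] \<Longrightarrow> f (as @ [mul A a' a]) = r (f (as @ [a'])) a"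
  shows "bd A (cup A B f g) (a # as) = cup A B (bd A f) g (a # as)
    + cup A B (\<lambda>cs. alt (length cs) (f cs)) (bd A g) (a # as) - mul B (f [a]) (g (unity A # as))"
  using f
proof (induction as arbitrary: f a)
  case Nil
  then show ?case by (simp add: g)
next
  case (Cons b as)
  show ?case
  proof (cases "as = []")
    case True
    then show ?thesis by (simp add: cup_Cons g A.mul_unity)
  next
    case False
    let ?f = "\<lambda>cs. f (a # cs)" and ?g = "\<lambda>cs. g (unity A # cs)"
    let ?h = "\<lambda>cs. f (mul A a b # cs)"
    have IH: "bd A (cup A B ?f g) (b # as) = cup A B (bd A ?f) g (b # as)
      + cup A B (\<lambda>cs. alt (length cs) (f (a # cs))) (bd A g) (b # as) - mul B (f [a, b]) (g (unity A # as))"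
      using Cons.prems by (intro Cons.IH) (metis append_Cons list.distinct(1))
    have "bd A (\<lambda>cs. cup A B f g (a # cs)) (b # as)
        = bd A (\<lambda>cs. mul B (f [a, unity A]) (?g cs) + cup A B ?f g cs) (b # as)"
      by (rule bd_cong, rule cup_Cons) (use False in auto)
    also have "\<dots> = mul B (f [a, unity A]) (bd A ?g (b # as)) + bd A (cup A B ?f g) (b # as)"
      by (simp only: bd_add bd_hom[of "mul B (f [a, unity A])", OF B.mul_diff_right])
    also have "bd A ?g (b # as) = g (b # as) - bd A g (unity A # b # as)"
      by (simp add: A.unity_mul)
    finally have "bd A (cup A B f g) (a # b # as)
      = mul B (f [mul A a b, unity A]) (g (unity A # as)) + cup A B ?h g as
        - (mul B (f [a, unity A]) (g (b # as) - bd A g (unity A # b # as)) + bd A (cup A B ?f g) (b # as))"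
      by (simp only: bd.simps cup_Cons[OF False])
    moreover have "cup A B (bd A f) g (a # b # as) = mul B (f [a]) (g (unity A # b # as))
        + (mul B (f [mul A a b, unity A]) (g (unity A # as)) + cup A B ?h g as - cup A B (bd A ?f) g (b # as))"
    proof -
      have "cup A B (\<lambda>cs. bd A f (a # cs)) g (b # as)
          = mul B (bd A f [a, b, unity A]) (g (unity A # as)) + cup A B (\<lambda>cs. ?h cs - bd A ?f (b # cs)) g as"
        using False by (simp add: cup_Cons)
      also have "\<dots> = mul B (f [mul A a b, unity A]) (g (unity A # as)) + cup A B ?h g as - cup A B (bd A ?f) g (b # as)"
        unfolding cup_diff_left cup_Cons[OF False, of "bd A ?f"] by (simp add: B.mul_diff_left)
      finally show ?thesis
        using cup_Cons[of "b # as" "bd A f" g a] by (simp add: A.mul_unity)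
    qed
    moreover have "cup A B (\<lambda>cs. alt (length cs) (f cs)) (bd A g) (a # b # as)
      = mul B (f [a, unity A]) (bd A g (unity A # b # as)) - cup A B (\<lambda>cs. alt (length cs) (f (a # cs))) (bd A g) (b # as)"
      using cup_Cons[of "b # as" "\<lambda>cs. alt (length cs) (f cs)" "bd A g" a]
      by (simp add: cup_uminus_left)
    \<comment> \<open>The place where balance enters: \<open>b\<close> is moved from the right of a
      value of \<open>f\<close> to the left of a value of \<open>g\<close>.\<close>
    moreover have "mul B (f [a, unity A]) (g (b # as)) = mul B (f [a, b]) (g (unity A # as))"
    proof -
      have "f [a, b] = r (f [a, unity A]) b"
        using Cons.prems[of "[a]" "unity A" b] by (simp add: A.unity_mul)
      moreover have "g (b # as) = l b (g (unity A # as))"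
        using left_linearD[OF g(1), of b "unity A" as] by (simp add: A.mul_unity)
      ultimately show ?thesis
        using bal by (simp add: balanced_def)
    qed
    ultimately show ?thesis
      unfolding IH by (simp only: B.mul_diff_right) (simp add: algebra_simps del: bd.simps)
  qed
qed

text \<open>A component of degree m is evaluated on m + 2 factors, so \<open>alt (length cs)\<close>
  is the usual sign; stated through lengths, it also covers inhomogeneous cochains.\<close>

lemma cup_leibniz:
  assumes "balanced B l r" "f \<in> bar_cochains A B l r" "g \<in> bar_cochains A B l r"
  shows "bd A (cup A B f g) as
    = cup A B (bd A f) g as + cup A B (\<lambda>cs. alt (length cs) (f cs)) (bd A g) as"
proof (cases as)
  case Nil
  then show ?thesis by (simp add: cup_def)
next
  case (Cons a cs)
  have "bd A (cup A B f g) (a # cs) = cup A B (bd A f) g (a # cs)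
    + cup A B (\<lambda>cs. alt (length cs) (f cs)) (bd A g) (a # cs) - mul B (f [a]) (g (unity A # cs))"
    by (rule cup_leibniz_aux[OF assms(1) bar_cochain_left_linear[OF assms(3)]])
      (simp_all add: bar_cochain_small[OF assms(3)] bar_cochain_right[OF assms(2)])
  then show ?thesis using bar_cochain_small[OF assms(2)] Cons by simp
qed

text \<open>Balance applied to the unit of \<open>B\<close> shows that the left and right actions
  agree on it.\<close>

lemma bar_one_cocycle:
  assumes "balanced B l r"
  shows "bd A bar_one as = 0"
proof (cases "length as = 3")
  case True
  then obtain a b c where as: "as = [a, b, c]"
    by (auto simp: numeral_3_eq_3 length_Suc_conv)
  have "r (unity B) b = l b (unity B)" for b
    using assms B.mul_unity B.unity_mul unfolding balanced_def by metis
  then show ?thesis by (simp add: as bar_one_def l_mul r_mul l_r)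
next
  case False
  have "bd A bar_one as = bd A (\<lambda>_. 0) as"
    by (rule bd_cong) (use False in \<open>auto simp: bar_one_def\<close>)
  then show ?thesis by simp
qed

lemma multilinear_alt: "multilinear f \<Longrightarrow> multilinear (\<lambda>cs. alt (length cs) (f cs))"
  by (auto simp: multilinear_def simp del: alt_Suc intro!: lin_alt)

lemma alt_cochain: "f \<in> bar_cochains A B l r \<Longrightarrow> (\<lambda>cs. alt (length cs) (f cs)) \<in> bar_cochains A B l r"
  unfolding bar_cochains_iff left_linear_def
  by (intro conjI allI impI multilinear_alt)
    (auto simp: alt_def l_uminus_right r_uminus_left)

lemma bd_alt_length: "bd A (\<lambda>cs. alt (length cs) (f cs)) as = alt (length as - 1) (bd A f as)"
proof -
  have "bd A (\<lambda>cs. alt (length cs) (f cs)) as = bd A (\<lambda>cs. alt (length as - 1) (f cs)) as"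
    by (rule bd_cong) (metis diff_Suc_1)
  then show ?thesis by (simp add: bd_alt)
qed

lemma cochain_add:
  assumes "f \<in> bar_cochains A B l r" "g \<in> bar_cochains A B l r"
  shows "(\<lambda>as. f as + g as) \<in> bar_cochains A B l r"
proof -
  obtain M M' where "\<And>as. length as > M \<Longrightarrow> f as = 0" "\<And>as. length as > M' \<Longrightarrow> g as = 0"
    using bar_cochain_bound assms by metis
  then have "\<exists>M. \<forall>as. length as > M \<longrightarrow> f as + g as = 0"
    by (intro exI[of _ "max M M'"]) simp
  then show ?thesis
    using assms unfolding bar_cochains_iff by (simp add: left_linear_add r_add_left)
qed

lemma cochain_smul:
  assumes "f \<in> bar_cochains A B l r"
  shows "(\<lambda>as. smul B c (f as)) \<in> bar_cochains A B l r"
proof -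
  obtain M where "\<And>as. length as > M \<Longrightarrow> f as = 0"
    using bar_cochain_bound assms by metis
  then have "\<exists>M. \<forall>as. length as > M \<longrightarrow> smul B c (f as) = 0"
    by (intro exI[of _ M]) simp
  then show ?thesis
    using assms unfolding bar_cochains_iff
    by (simp add: left_linear_left_hom[OF left_hom_smulI] r_smul_left)
qed

lemma bar_diff_cochain:
  assumes "f \<in> bar_cochains A B l r"
  shows "bar_diff A B f \<in> bar_cochains A B l r"
  unfolding bar_diff_eq bar_cochains_iff
proof (intro conjI allI impI)
  fix as :: "'a list" assume "length as < 2"
  then have "as = [] \<or> (\<exists>a. as = [a])" by (cases as) auto
  then show "bd A f as = 0" by auto
next
  obtain M where M: "\<And>as. length as > M \<Longrightarrow> f as = 0"
    using bar_cochain_bound assms by metis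
  have "bd A f as = bd A (\<lambda>_. 0) as" if "length as > Suc M" for as
    by (rule bd_cong, rule M) (use that in simp)
  then show "\<exists>M. \<forall>as. length as > M \<longrightarrow> bd A f as = 0" by auto
next
  show "left_linear (bd A f)"
    by (rule left_linear_bd[OF bar_cochain_left_linear[OF assms]])
next
  fix a a' and as :: "'a list" assume as: "as \<noteq> []"
  have two: "length (as @ [a']) \<ge> 2" using as by (cases as) auto
  have "bd A f (as @ [mul A a' a]) = bd A (rsh A a f) (as @ [a'])"
    using A.bd_rsh[OF two, of a f] by simp
  also have "\<dots> = r (bd A f (as @ [a'])) a"
  proof (cases "length as = 1")
    case True
    then obtain c where "as = [c]" by (cases as) auto
    then show ?thesis
      using bar_cochain_small[OF assms] by (simp add: rsh_def)
  next
    case False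
    have "bd A (rsh A a f) (as @ [a']) = bd A (\<lambda>cs. r (f cs) a) (as @ [a'])"
      by (rule bd_cong, rule bar_cochain_rsh[OF assms]) (use as False in \<open>cases as; auto simp: Suc_le_eq\<close>)
    also have "\<dots> = r (bd A f (as @ [a'])) a"
      by (rule bd_hom[symmetric]) (rule r_diff_left)
    finally show ?thesis .
  qed
  finally show "bd A f (as @ [mul A a' a]) = r (bd A f (as @ [a'])) a" .
qed

end


subsection \<open>Quotients of rings of functions\<close>

definition function_subgroup :: "('x \<Rightarrow> 'b::ab_group_add) set \<Rightarrow> bool" where
  "function_subgroup I \<longleftrightarrow> (\<lambda>_. 0) \<in> I \<and> (\<forall>u\<in>I. \<forall>v\<in>I. (\<lambda>x. u x - v x) \<in> I)"

lemma function_subgroup_zero: "function_subgroup I \<Longrightarrow> (\<lambda>_. 0) \<in> I"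
  and function_subgroup_diff: "function_subgroup I \<Longrightarrow> u \<in> I \<Longrightarrow> v \<in> I \<Longrightarrow> (\<lambda>x. u x - v x) \<in> I"
  by (simp_all add: function_subgroup_def)

lemma function_subgroup_uminus: "function_subgroup I \<Longrightarrow> u \<in> I \<Longrightarrow> (\<lambda>x. - u x) \<in> I"
  using function_subgroup_diff[of I "\<lambda>_. 0" u] by (simp add: function_subgroup_zero)

lemma function_subgroup_add: "function_subgroup I \<Longrightarrow> u \<in> I \<Longrightarrow> v \<in> I \<Longrightarrow> (\<lambda>x. u x + v x) \<in> I"
  using function_subgroup_diff[of I u "\<lambda>x. - v x"] by (simp add: function_subgroup_uminus)

definition function_coset :: "('x \<Rightarrow> 'b::ab_group_add) set \<Rightarrow> ('x \<Rightarrow> 'b) \<Rightarrow> ('x \<Rightarrow> 'b) set" where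
  "function_coset I u = (\<lambda>i x. i x + u x) ` I"

lemma function_coset_iff: "v \<in> function_coset I u \<longleftrightarrow> (\<lambda>x. v x - u x) \<in> I"
proof
  assume "v \<in> function_coset I u"
  then obtain i where "i \<in> I" "v = (\<lambda>x. i x + u x)" by (auto simp: function_coset_def)
  then show "(\<lambda>x. v x - u x) \<in> I" by simp
next
  assume "(\<lambda>x. v x - u x) \<in> I"
  then show "v \<in> function_coset I u"
    unfolding function_coset_def by (rule rev_image_eqI) simp
qed

lemma function_coset_self: "function_subgroup I \<Longrightarrow> u \<in> function_coset I u"
  by (simp add: function_coset_iff function_subgroup_zero)

lemma function_coset_eq_iff:
  assumes I: "function_subgroup I"
  shows "function_coset I u = function_coset I v \<longleftrightarrow> (\<lambda>x. u x - v x) \<in> I"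
proof
  assume "function_coset I u = function_coset I v"
  then show "(\<lambda>x. u x - v x) \<in> I"
    using function_coset_self[OF I, of u] by (simp add: function_coset_iff)
next
  assume uv: "(\<lambda>x. u x - v x) \<in> I"
  have "(\<lambda>x. w x - u x) \<in> I \<longleftrightarrow> (\<lambda>x. w x - v x) \<in> I" for w
    using function_subgroup_add[OF I _ uv, of "\<lambda>x. w x - u x"]
      function_subgroup_diff[OF I _ uv, of "\<lambda>x. w x - v x"] by auto
  then show "function_coset I u = function_coset I v"
    by (auto simp: function_coset_iff)
qed

text \<open>Only addition and zero are fixed, so that additive quotients can be handled before a
  product is known to descend.\<close>

locale function_ring =
  fixes R :: "('x \<Rightarrow> 'b::ab_group_add) ring"
  assumes add_eq: "add R = (\<lambda>u v x. u x + v x)" and zero_eq: "zero R = (\<lambda>_. 0)"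
begin

lemma coset_eq: "I +>\<^bsub>R\<lparr>carrier := Z\<rparr>\<^esub> u = function_coset I u" "I +>\<^bsub>R\<^esub> u = function_coset I u"
  unfolding a_r_coset_def' function_coset_def by (auto simp: add_eq)

lemma carrier_quotient: "carrier (R\<lparr>carrier := Z\<rparr> Quot I) = function_coset I ` Z"
  unfolding FactRing_def A_RCOSETS_def' by (auto simp: coset_eq)

lemma one_quotient: "one (R\<lparr>carrier := Z\<rparr> Quot I) = function_coset I (one R)"
  unfolding FactRing_def by (simp add: coset_eq)

lemma add_quotient:
  assumes I: "function_subgroup I"
  shows "add (R\<lparr>carrier := Z\<rparr> Quot I) (function_coset I u) (function_coset I v)
    = function_coset I (\<lambda>x. u x + v x)"
proof -
  have "add (R\<lparr>carrier := Z\<rparr> Quot I) (function_coset I u) (function_coset I v)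
      = (\<Union>a\<in>function_coset I u. \<Union>b\<in>function_coset I v. {\<lambda>x. a x + b x})"
    unfolding FactRing_def set_add_def' by (auto simp: add_eq set_add_def')
  also have "\<dots> = function_coset I (\<lambda>x. u x + v x)"
  proof (rule Set.set_eqI)
    fix w
    show "w \<in> (\<Union>a\<in>function_coset I u. \<Union>b\<in>function_coset I v. {\<lambda>x. a x + b x})
        \<longleftrightarrow> w \<in> function_coset I (\<lambda>x. u x + v x)"
    proof
      assume "w \<in> (\<Union>a\<in>function_coset I u. \<Union>b\<in>function_coset I v. {\<lambda>x. a x + b x})"
      then obtain a b where ab: "(\<lambda>x. a x - u x) \<in> I" "(\<lambda>x. b x - v x) \<in> I" "w = (\<lambda>x. a x + b x)"
        by (auto simp: function_coset_iff)
      then show "w \<in> function_coset I (\<lambda>x. u x + v x)"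
        using function_subgroup_add[OF I ab(1,2)] by (simp add: function_coset_iff algebra_simps)
    next
      assume "w \<in> function_coset I (\<lambda>x. u x + v x)"
      then have "(\<lambda>x. w x - v x) \<in> function_coset I u"
        by (simp add: function_coset_iff algebra_simps)
      then show "w \<in> (\<Union>a\<in>function_coset I u. \<Union>b\<in>function_coset I v. {\<lambda>x. a x + b x})"
        using function_coset_self[OF I, of v] by (intro UN_I[of "\<lambda>x. w x - v x"] UN_I[of v]) simp_all
    qed
  qed
  finally show ?thesis .
qed

lemma mult_quotient:
  assumes "ideal I (R\<lparr>carrier := Z\<rparr>)" "u \<in> Z" "v \<in> Z"
  shows "monoid.mult (R\<lparr>carrier := Z\<rparr> Quot I) (function_coset I u) (function_coset I v)
    = function_coset I (monoid.mult R u v)"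
  using ideal.rcoset_mult_add[OF assms(1), of u v] assms(2,3)
  unfolding FactRing_def coset_eq by (simp add: coset_eq)

lemma abelian_group_function_ring:
  assumes C: "function_subgroup (carrier R)"
  shows "abelian_group R"
proof (rule abelian_groupI)
  fix u assume "u \<in> carrier R"
  then show "\<exists>v\<in>carrier R. v \<oplus>\<^bsub>R\<^esub> u = \<zero>\<^bsub>R\<^esub>"
    using function_subgroup_uminus[OF C] by (intro bexI[of _ "\<lambda>x. - u x"]) (simp_all add: add_eq zero_eq)
qed (simp_all add: add_eq zero_eq function_subgroup_zero[OF C] function_subgroup_add[OF C] ac_simps)

lemma subgroup_add_monoid:
  assumes "function_subgroup (carrier R)" "function_subgroup H" "H \<subseteq> carrier R"
  shows "subgroup H (add_monoid R)"
proof -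
  note C = assms(1)
  have G: "group (add_monoid R)"
    using abelian_group_function_ring[OF C] by (rule abelian_group.a_group)
  show ?thesis
  proof (rule group.subgroupI[OF G])
    show "H \<noteq> {}" using function_subgroup_zero[OF assms(2)] by auto
  next
    fix u assume u: "u \<in> H"
    have "inv\<^bsub>add_monoid R\<^esub> u = (\<lambda>x. - u x)"
      by (rule group.inv_equality[OF G])
        (use u assms(3) function_subgroup_uminus[OF C] in \<open>auto simp: add_eq zero_eq\<close>)
    then show "inv\<^bsub>add_monoid R\<^esub> u \<in> H"
      using u assms(2) by (simp add: function_subgroup_uminus)
  qed (use assms in \<open>auto simp: add_eq function_subgroup_add\<close>)
qed

lemma function_ring_carrier: "function_ring (R\<lparr>carrier := Z\<rparr>)"
  by unfold_locales (simp_all add: add_eq zero_eq)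

lemma ringI':
  assumes C: "function_subgroup (carrier R)"
    and one: "one R \<in> carrier R" and mult: "\<And>u v. u \<in> carrier R \<Longrightarrow> v \<in> carrier R \<Longrightarrow> monoid.mult R u v \<in> carrier R"
    and "\<And>u v w. u \<in> carrier R \<Longrightarrow> v \<in> carrier R \<Longrightarrow> w \<in> carrier R \<Longrightarrow>
      monoid.mult R (monoid.mult R u v) w = monoid.mult R u (monoid.mult R v w)"
    and "\<And>u. u \<in> carrier R \<Longrightarrow> monoid.mult R (one R) u = u" "\<And>u. u \<in> carrier R \<Longrightarrow> monoid.mult R u (one R) = u"
    and "\<And>u v w x. monoid.mult R (\<lambda>x. u x + v x) w x = monoid.mult R u w x + monoid.mult R v w x"
    and "\<And>u v w x. monoid.mult R w (\<lambda>x. u x + v x) x = monoid.mult R w u x + monoid.mult R w v x"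
  shows "ring R"
proof (rule ringI)
  show "abelian_group R" by (rule abelian_group_function_ring[OF C])
  show "Group.monoid R"
    by (rule Group.monoidI) (use assms in simp_all)
qed (simp_all add: add_eq assms(7,8) fun_eq_iff)

end

text \<open>Abstract form of an isomorphism on cohomology: \<open>F_I\<close> is injectivity on
  classes and \<open>F_surj\<close> is surjectivity modulo \<open>J\<close>.\<close>

locale quotient_comparison =
  R: function_ring R + S: function_ring S
  for R :: "('x \<Rightarrow> 'b::ab_group_add) ring" and S :: "('y \<Rightarrow> 'b) ring" +
  fixes Z I :: "('x \<Rightarrow> 'b) set" and Z' J :: "('y \<Rightarrow> 'b) set" and F :: "('x \<Rightarrow> 'b) \<Rightarrow> 'y \<Rightarrow> 'b"
  assumes I: "function_subgroup I" "I \<subseteq> Z" and J: "function_subgroup J" "J \<subseteq> Z'"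
    and Z: "function_subgroup Z" and Z': "function_subgroup Z'"
    and F_add: "f \<in> Z \<Longrightarrow> g \<in> Z \<Longrightarrow> F (\<lambda>x. f x + g x) = (\<lambda>y. F f y + F g y)"
    and F_diff: "f \<in> Z \<Longrightarrow> g \<in> Z \<Longrightarrow> F (\<lambda>x. f x - g x) = (\<lambda>y. F f y - F g y)"
    and F_Z: "f \<in> Z \<Longrightarrow> F f \<in> Z'"
    and F_I: "f \<in> Z \<Longrightarrow> F f \<in> J \<longleftrightarrow> f \<in> I"
    and F_surj: "u \<in> Z' \<Longrightarrow> \<exists>f\<in>Z. (\<lambda>y. u y - F f y) \<in> J"
begin

text \<open>All representatives give the same coset, so the union is that coset; this form agrees
  with \<open>induced_map\<close>.\<close>

definition "quotient_map X = (\<Union>f\<in>X. J +>\<^bsub>S\<^esub> F f)"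

lemma quotient_map_coset:
  assumes f: "f \<in> Z"
  shows "quotient_map (function_coset I f) = function_coset J (F f)"
proof -
  have "function_coset J (F g) = function_coset J (F f)" if "g \<in> function_coset I f" for g
  proof -
    have gf: "(\<lambda>x. g x - f x) \<in> I" using that by (simp add: function_coset_iff)
    then have "(\<lambda>x. (g x - f x) + f x) \<in> Z" using I(2) f function_subgroup_add[OF Z] by blast
    then have g: "g \<in> Z" by simp
    have "F (\<lambda>x. g x - f x) \<in> J"
      using F_I[of "\<lambda>x. g x - f x"] gf I(2) by blast
    then show ?thesis
      unfolding function_coset_eq_iff[OF J(1)] F_diff[OF g f] .
  qed
  then show ?thesis
    unfolding quotient_map_def S.coset_eq using function_coset_self[OF I(1), of f] by blast
qed

lemma bij_quotient_map:
  "bij_betw quotient_map (carrier (R\<lparr>carrier := Z\<rparr> Quot I)) (carrier (S\<lparr>carrier := Z'\<rparr> Quot J))"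
  unfolding bij_betw_def
proof
  show "inj_on quotient_map (carrier (R\<lparr>carrier := Z\<rparr> Quot I))"
  proof (rule inj_onI)
    fix X Y assume "X \<in> carrier (R\<lparr>carrier := Z\<rparr> Quot I)" "Y \<in> carrier (R\<lparr>carrier := Z\<rparr> Quot I)"
      and eq: "quotient_map X = quotient_map Y"
    then obtain f g where fg: "f \<in> Z" "g \<in> Z" "X = function_coset I f" "Y = function_coset I g"
      unfolding R.carrier_quotient by blast
    then have "(\<lambda>y. F f y - F g y) \<in> J"
      using eq by (simp add: quotient_map_coset function_coset_eq_iff[OF J(1)])
    then have "(\<lambda>x. f x - g x) \<in> I"
      using F_I[OF function_subgroup_diff[OF Z fg(1,2)]] by (simp add: F_diff fg)
    then show "X = Y" by (simp add: fg function_coset_eq_iff[OF I(1)])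
  qed
  show "quotient_map ` carrier (R\<lparr>carrier := Z\<rparr> Quot I) = carrier (S\<lparr>carrier := Z'\<rparr> Quot J)"
  proof
    show "quotient_map ` carrier (R\<lparr>carrier := Z\<rparr> Quot I) \<subseteq> carrier (S\<lparr>carrier := Z'\<rparr> Quot J)"
      unfolding R.carrier_quotient S.carrier_quotient using F_Z by (auto simp: quotient_map_coset)
    show "carrier (S\<lparr>carrier := Z'\<rparr> Quot J) \<subseteq> quotient_map ` carrier (R\<lparr>carrier := Z\<rparr> Quot I)"
    proof
      fix X assume "X \<in> carrier (S\<lparr>carrier := Z'\<rparr> Quot J)"
      then obtain u where u: "u \<in> Z'" "X = function_coset J u"
        unfolding S.carrier_quotient by blast
      then obtain f where f: "f \<in> Z" "(\<lambda>y. u y - F f y) \<in> J" using F_surj by blast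
      then have "X = quotient_map (function_coset I f)"
        by (simp add: quotient_map_coset u function_coset_eq_iff[OF J(1)])
      then show "X \<in> quotient_map ` carrier (R\<lparr>carrier := Z\<rparr> Quot I)"
        unfolding R.carrier_quotient using f(1) by blast
    qed
  qed
qed

lemma quotient_map_closed:
  "X \<in> carrier (R\<lparr>carrier := Z\<rparr> Quot I) \<Longrightarrow> quotient_map X \<in> carrier (S\<lparr>carrier := Z'\<rparr> Quot J)"
  using bij_quotient_map unfolding bij_betw_def by blast

lemma quotient_map_add:
  assumes "X \<in> carrier (R\<lparr>carrier := Z\<rparr> Quot I)" "Y \<in> carrier (R\<lparr>carrier := Z\<rparr> Quot I)"
  shows "quotient_map (add (R\<lparr>carrier := Z\<rparr> Quot I) X Y)
    = add (S\<lparr>carrier := Z'\<rparr> Quot J) (quotient_map X) (quotient_map Y)"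
proof -
  obtain f g where fg: "f \<in> Z" "g \<in> Z" "X = function_coset I f" "Y = function_coset I g"
    using assms unfolding R.carrier_quotient by blast
  then show ?thesis
    by (simp add: R.add_quotient[OF I(1)] S.add_quotient[OF J(1)] quotient_map_coset
        function_subgroup_add[OF Z] F_add)
qed

theorem quotient_map_iso:
  "quotient_map \<in> iso (add_monoid (R\<lparr>carrier := Z\<rparr> Quot I)) (add_monoid (S\<lparr>carrier := Z'\<rparr> Quot J))"
  unfolding iso_def hom_def using bij_quotient_map quotient_map_closed quotient_map_add by simp

theorem quotient_map_ring_iso:
  assumes R: "ideal I (R\<lparr>carrier := Z\<rparr>)" and S: "ideal J (S\<lparr>carrier := Z'\<rparr>)"
    and one: "one R \<in> Z" "(\<lambda>y. F (one R) y - one S y) \<in> J"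
    and mult: "\<And>f g. f \<in> Z \<Longrightarrow> g \<in> Z \<Longrightarrow> monoid.mult R f g \<in> Z"
      "\<And>f g. f \<in> Z \<Longrightarrow> g \<in> Z \<Longrightarrow> (\<lambda>y. F (monoid.mult R f g) y - monoid.mult S (F f) (F g) y) \<in> J"
  shows "quotient_map \<in> ring_iso (R\<lparr>carrier := Z\<rparr> Quot I) (S\<lparr>carrier := Z'\<rparr> Quot J)"
  unfolding ring_iso_def
proof (intro CollectI conjI ring_hom_memI bij_quotient_map)
  fix X Y assume "X \<in> carrier (R\<lparr>carrier := Z\<rparr> Quot I)" "Y \<in> carrier (R\<lparr>carrier := Z\<rparr> Quot I)"
  then obtain f g where fg: "f \<in> Z" "g \<in> Z" "X = function_coset I f" "Y = function_coset I g"
    unfolding R.carrier_quotient by blast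
  have "function_coset J (F (monoid.mult R f g)) = function_coset J (monoid.mult S (F f) (F g))"
    unfolding function_coset_eq_iff[OF J(1)] by (rule mult(2)[OF fg(1,2)])
  then show "quotient_map (monoid.mult (R\<lparr>carrier := Z\<rparr> Quot I) X Y)
      = monoid.mult (S\<lparr>carrier := Z'\<rparr> Quot J) (quotient_map X) (quotient_map Y)"
    using fg by (simp add: R.mult_quotient[OF R] S.mult_quotient[OF S] quotient_map_coset mult(1) F_Z)
next
  have "function_coset J (F (one R)) = function_coset J (one S)"
    unfolding function_coset_eq_iff[OF J(1)] by (rule one(2))
  then show "quotient_map (one (R\<lparr>carrier := Z\<rparr> Quot I)) = one (S\<lparr>carrier := Z'\<rparr> Quot J)"
    using one(1) by (simp add: R.one_quotient S.one_quotient quotient_map_coset)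
qed (simp_all add: quotient_map_closed quotient_map_add)

end


subsection \<open>Cocycles and coboundaries\<close>

context bimodule_algebra
begin

lemma bar_ring_simps [simp]:
  "carrier (bar_ring A B l r) = bar_cochains A B l r"
  "monoid.mult (bar_ring A B l r) = cup A B"
  "one (bar_ring A B l r) = bar_one"
  by (simp_all add: bar_ring_def bar_one_def[abs_def])

lemma function_ring_bar: "function_ring (bar_ring A B l r)"
  by unfold_locales (simp_all add: bar_ring_def)

lemma bar_cochains_subgroup: "function_subgroup (bar_cochains A B l r)"
  unfolding function_subgroup_def
proof (intro conjI ballI)
  show "(\<lambda>_. 0) \<in> bar_cochains A B l r"
    by (simp add: bar_cochains_def)
  fix f g assume "f \<in> bar_cochains A B l r" "g \<in> bar_cochains A B l r"
  then show "(\<lambda>as. f as - g as) \<in> bar_cochains A B l r"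
    using cochain_add[of f "\<lambda>as. smul B (- 1) (g as)"] cochain_smul[of g "- 1"] by simp
qed

lemma bar_cocycles_iff: "f \<in> bar_cocycles A B l r \<longleftrightarrow> f \<in> bar_cochains A B l r \<and> (\<forall>as. bd A f as = 0)"
  by (simp add: bar_cocycles_def bar_diff_eq fun_eq_iff)

lemma bar_cocycles_subgroup: "function_subgroup (bar_cocycles A B l r)"
  using function_subgroup_diff[OF bar_cochains_subgroup] function_subgroup_zero[OF bar_cochains_subgroup]
  unfolding function_subgroup_def by (auto simp: bar_cocycles_iff bd_diff)

lemma bar_coboundaries_iff:
  "f \<in> bar_coboundaries A B l r \<longleftrightarrow> (\<exists>g\<in>bar_cochains A B l r. f = bd A g)"
  by (auto simp: bar_coboundaries_def bar_diff_eq)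

lemma bar_coboundaries_subgroup: "function_subgroup (bar_coboundaries A B l r)"
  unfolding function_subgroup_def
proof (intro conjI ballI)
  show "(\<lambda>_. 0) \<in> bar_coboundaries A B l r"
    unfolding bar_coboundaries_iff using function_subgroup_zero[OF bar_cochains_subgroup]
    by (intro bexI[of _ "\<lambda>_. 0"]) auto
  fix f g assume "f \<in> bar_coboundaries A B l r" "g \<in> bar_coboundaries A B l r"
  then obtain f' g' where "f' \<in> bar_cochains A B l r" "g' \<in> bar_cochains A B l r" "f = bd A f'" "g = bd A g'"
    unfolding bar_coboundaries_iff by blast
  then show "(\<lambda>as. f as - g as) \<in> bar_coboundaries A B l r"
    unfolding bar_coboundaries_iff using function_subgroup_diff[OF bar_cochains_subgroup]
    by (intro bexI[of _ "\<lambda>as. f' as - g' as"]) (auto simp: bd_diff)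
qed

lemma bar_coboundaries_cocycles: "bar_coboundaries A B l r \<subseteq> bar_cocycles A B l r"
  using bar_diff_cochain A.bd_bd by (auto simp: bar_coboundaries_iff bar_cocycles_iff bar_diff_eq)

lemma bar_cocycle_smul:
  "f \<in> bar_cocycles A B l r \<Longrightarrow> (\<lambda>as. smul B c (f as)) \<in> bar_cocycles A B l r"
  using cochain_smul[of f c] bd_hom[of "smul B c" A f]
  by (simp add: bar_cocycles_iff B.V.scale_right_diff_distrib)

theorem balanced_cup_descends:
  assumes bal: "balanced B l r"
  shows "cup_descends A B l r"
proof -
  interpret function_ring "bar_ring A B l r" by (rule function_ring_bar)
  let ?Z = "bar_cocycles A B l r" and ?I = "bar_coboundaries A B l r"
  have sub: "?Z \<subseteq> bar_cochains A B l r" by (auto simp: bar_cocycles_iff)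
  have one: "bar_one \<in> ?Z"
    by (simp add: bar_cocycles_iff bar_one_cochain bar_one_cocycle[OF bal])
  have cup: "cup A B f g \<in> ?Z" if "f \<in> ?Z" "g \<in> ?Z" for f g
  proof -
    have fg: "f \<in> bar_cochains A B l r" "g \<in> bar_cochains A B l r" "bd A f = (\<lambda>_. 0)" "bd A g = (\<lambda>_. 0)"
      using that by (auto simp: bar_cocycles_iff)
    then show ?thesis
      using cup_leibniz[OF bal fg(1,2)] by (simp add: bar_cocycles_iff cup_cochain)
  qed
  have ring: "ring (bar_ring A B l r\<lparr>carrier := ?Z\<rparr>)"
  proof (rule function_ring.ringI'[OF function_ring_carrier])
    fix f assume "f \<in> carrier (bar_ring A B l r\<lparr>carrier := ?Z\<rparr>)"
    then have f: "f \<in> bar_cochains A B l r" using sub by auto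
    show "monoid.mult (bar_ring A B l r\<lparr>carrier := ?Z\<rparr>) (one (bar_ring A B l r\<lparr>carrier := ?Z\<rparr>)) f = f"
      "monoid.mult (bar_ring A B l r\<lparr>carrier := ?Z\<rparr>) f (one (bar_ring A B l r\<lparr>carrier := ?Z\<rparr>)) = f"
      by (simp_all add: cup_one_left[OF f] cup_one_right[OF f] fun_eq_iff)
  qed (simp_all add: bar_cocycles_subgroup one cup cup_assoc fun_eq_iff cup_add_left cup_add_right)
  have "subring ?Z (bar_ring A B l r)"
  proof (rule subring.intro)
    show "subgroup ?Z (add_monoid (bar_ring A B l r))"
      by (rule subgroup_add_monoid) (simp_all add: bar_cochains_subgroup bar_cocycles_subgroup sub)
    show "submonoid ?Z (bar_ring A B l r)"
      by unfold_locales (use sub one cup in auto)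
  qed
  moreover have "ideal ?I (bar_ring A B l r\<lparr>carrier := ?Z\<rparr>)"
  proof (rule idealI[OF ring])
    show "subgroup ?I (add_monoid (bar_ring A B l r\<lparr>carrier := ?Z\<rparr>))"
      by (rule function_ring.subgroup_add_monoid[OF function_ring_carrier])
        (simp_all add: bar_cocycles_subgroup bar_coboundaries_subgroup bar_coboundaries_cocycles)
    fix f g assume "f \<in> ?I" and "g \<in> carrier (bar_ring A B l r\<lparr>carrier := ?Z\<rparr>)"
    then obtain h where h: "h \<in> bar_cochains A B l r" "f = bd A h"
      and g: "g \<in> bar_cochains A B l r" "bd A g = (\<lambda>_. 0)"
      by (auto simp: bar_coboundaries_iff bar_cocycles_iff)
    have "cup A B f g = bd A (cup A B h g)"
      using cup_leibniz[OF bal h(1) g(1)] by (simp add: h(2) g(2) fun_eq_iff)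
    then show "monoid.mult (bar_ring A B l r\<lparr>carrier := ?Z\<rparr>) f g \<in> ?I"
      using cup_cochain[OF h(1) g(1)] by (auto simp: bar_coboundaries_iff)
    \<comment> \<open>Twisting the cocycle by its degree sign turns the signed Leibniz term into the
      plain product of \<open>g\<close> with the coboundary.\<close>
    let ?g = "\<lambda>as. alt (length as) (g as)"
    have g': "bd A ?g = (\<lambda>_. 0)"
      by (simp add: fun_eq_iff bd_alt_length g(2))
    have "cup A B g f = bd A (cup A B ?g h)"
      using cup_leibniz[OF bal alt_cochain[OF g(1)] h(1)] by (intro ext) (simp add: h(2) g')
    then show "monoid.mult (bar_ring A B l r\<lparr>carrier := ?Z\<rparr>) g f \<in> ?I"
      using cup_cochain[OF alt_cochain[OF g(1)] h(1)] by (auto simp: bar_coboundaries_iff)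
  qed
  ultimately show ?thesis
    unfolding cup_descends_def by blast
qed

end

section \<open>Transfer of cocycles, coboundaries and products between the two complexes\<close>

context quantum_bimodule
begin

abbreviation "kring \<equiv> tensor_ext N (\<lambda>i j. inverse (q i j)) B"
abbreviation "kcocycles \<equiv> koszul_cocycles N q x B l r"
abbreviation "kcoboundaries \<equiv> koszul_coboundaries N q x B l r"
abbreviation "bcocycles \<equiv> bar_cocycles A B l r"
abbreviation "bcoboundaries \<equiv> bar_coboundaries A B l r"

lemma kring_simps [simp]:
  "monoid.mult kring = kmult" "one kring = (\<lambda>J. if J = {} then unity B else 0)"
  by (simp_all add: tensor_ext_def)

lemma function_ring_koszul: "function_ring kring"
  by unfold_locales (simp_all add: tensor_ext_def)

lemma kcarrier_subgroup: "function_subgroup kcarrier"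
  by (simp add: function_subgroup_def kcarrier_iff)

lemma kcocycles_iff: "u \<in> kcocycles \<longleftrightarrow> u \<in> kcarrier \<and> (\<forall>J. kd u J = 0)"
  by (simp add: koszul_cocycles_def fun_eq_iff)

lemma kcoboundaries_iff: "u \<in> kcoboundaries \<longleftrightarrow> (\<exists>v\<in>kcarrier. u = kd v)"
  by (auto simp: koszul_coboundaries_def)

lemma kd_diff: "kd (\<lambda>J. u J - v J) J = kd u J - kd v J"
  using kd_add[of "\<lambda>J. u J - v J" v J] by simp

lemma kd_zero: "kd (\<lambda>_. 0) J = 0"
  using kd_diff[of "\<lambda>_. 0" "\<lambda>_. 0" J] by simp

lemma kcocycles_subgroup: "function_subgroup kcocycles"
  using function_subgroup_diff[OF kcarrier_subgroup] function_subgroup_zero[OF kcarrier_subgroup]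
  unfolding function_subgroup_def by (auto simp: kcocycles_iff kd_diff kd_zero)

lemma kcoboundaries_subgroup: "function_subgroup kcoboundaries"
  unfolding function_subgroup_def
proof (intro conjI ballI)
  show "(\<lambda>_. 0) \<in> kcoboundaries"
    unfolding kcoboundaries_iff using function_subgroup_zero[OF kcarrier_subgroup]
    by (intro bexI[of _ "\<lambda>_. 0"]) (auto simp: kd_zero)
  fix u v assume "u \<in> kcoboundaries" "v \<in> kcoboundaries"
  then obtain u' v' where "u' \<in> kcarrier" "v' \<in> kcarrier" "u = kd u'" "v = kd v'"
    unfolding kcoboundaries_iff by blast
  then show "(\<lambda>J. u J - v J) \<in> kcoboundaries"
    unfolding kcoboundaries_iff using function_subgroup_diff[OF kcarrier_subgroup]
    by (intro bexI[of _ "\<lambda>J. u' J - v' J"]) (auto simp: kd_diff)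
qed

lemma kcoboundaries_cocycles: "kcoboundaries \<subseteq> kcocycles"
  using kd_carrier kd_kd by (auto simp: kcoboundaries_iff kcocycles_iff)

lemma kcocycle_smul: "u \<in> kcocycles \<Longrightarrow> (\<lambda>J. smul B c (u J)) \<in> kcocycles"
  by (simp add: kcocycles_iff kd_smul kcarrier_iff)

lemma pullback_diff: "pb \<phi> (\<lambda>as. f as - g as) = (\<lambda>J. pb \<phi> f J - pb \<phi> g J)"
  by (simp add: pullback_def B.V.lin_ext_fun_diff fun_eq_iff)

lemma pullback_add: "pb \<phi> (\<lambda>as. f as + g as) = (\<lambda>J. pb \<phi> f J + pb \<phi> g J)"
  by (simp add: pullback_def B.V.lin_ext_fun_add fun_eq_iff)

lemma pullback_smul: "pb \<phi> (\<lambda>as. smul B c (f as)) = (\<lambda>J. smul B c (pb \<phi> f J))"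
  by (simp add: pullback_def fun_eq_iff left_hom_lin_ext[OF left_hom_smulI])

lemma pullback_cocycle:
  assumes "comparison_map N q A x \<phi>" "f \<in> bcocycles"
  shows "pb \<phi> f \<in> kcocycles"
proof -
  have f: "f \<in> bar_cochains A B l r" "bar_diff A B f = (\<lambda>_. 0)"
    using assms(2) by (auto simp: bar_cocycles_def)
  have "kd (pb \<phi> f) J = 0" for J
    unfolding pullback_bar_diff[OF assms(1) f(1), symmetric] f(2)
    by (simp add: pullback_def lin_ext_def)
  then show ?thesis by (simp add: kcocycles_iff pullback_carrier)
qed

lemma pullback_coboundary:
  assumes "comparison_map N q A x \<phi>" "f \<in> bcoboundaries"
  shows "pb \<phi> f \<in> kcoboundaries"
  using assms(2) pullback_bar_diff[OF assms(1)] pullback_carrier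
  by (auto simp: bar_coboundaries_iff kcoboundaries_iff bar_diff_eq)

lemma psi_cocycle: "u \<in> kcocycles \<Longrightarrow> psi u \<in> bcocycles"
proof -
  assume u: "u \<in> kcocycles"
  then have "kd u = (\<lambda>_. 0)" by (auto simp: kcocycles_iff)
  moreover have "right_family (\<lambda>_. 0) = (\<lambda>J b. 0)"
    by (intro ext) (simp add: right_family_def)
  ultimately have "bar_diff A B (psi u) = Psi (\<lambda>J b. 0)"
    by (simp add: bar_diff_psi)
  moreover have "Psi (\<lambda>J b. 0) as = 0" for as
    using Psi_diff[of "\<lambda>J b. 0" "\<lambda>J b. 0" as] by simp
  ultimately show "psi u \<in> bcocycles"
    by (simp add: bar_cocycles_iff psi_bar_cochain bar_diff_eq)
qed

lemma psi_coboundary: "u \<in> kcoboundaries \<Longrightarrow> psi u \<in> bcoboundaries"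
  using bar_diff_psi psi_bar_cochain
  by (auto simp: kcoboundaries_iff bar_coboundaries_iff bar_diff_eq intro!: bexI)

lemma pullback_phi0_class:
  assumes "comparison_map N q A x \<phi>" "f \<in> bcocycles"
  shows "(\<lambda>J. pb \<phi> f J - pb phi0 f J) \<in> kcoboundaries"
proof -
  obtain u where "u \<in> kcarrier" "\<And>J. pb \<phi> f J - pb phi0 f J = kd u J"
    using comparison_maps_agree[OF assms(1) comparison_map_phi0 assms(2)] by blast
  then show ?thesis by (auto simp: kcoboundaries_iff)
qed

lemma psi_pullback_class:
  assumes "f \<in> bcocycles"
  shows "(\<lambda>as. f as - psi (pb phi0 f) as) \<in> bcoboundaries"
proof -
  obtain g where "g \<in> bar_cochains A B l r" "\<And>as. f as - psi (pb phi0 f) as = bar_diff A B g as"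
    using psi_pullback_homotopic[OF assms] by blast
  then show ?thesis by (auto simp: bar_coboundaries_iff bar_diff_eq)
qed

text \<open>Up to coboundaries \<phi> may be replaced by \<open>phi0\<close>, and \<open>f\<close>
  by \<open>psi (pb phi0 f)\<close>, which is a coboundary as soon as \<open>pb phi0 f\<close>
  is.\<close>

lemma pullback_coboundary_iff:
  assumes \<phi>: "comparison_map N q A x \<phi>" and f: "f \<in> bcocycles"
  shows "pb \<phi> f \<in> kcoboundaries \<longleftrightarrow> f \<in> bcoboundaries"
proof
  assume "pb \<phi> f \<in> kcoboundaries"
  from function_subgroup_diff[OF kcoboundaries_subgroup this pullback_phi0_class[OF \<phi> f]]
  have "pb phi0 f \<in> kcoboundaries" by simp
  from function_subgroup_add[OF bar_coboundaries_subgroup psi_pullback_class[OF f] psi_coboundary[OF this]]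
  show "f \<in> bcoboundaries" by simp
qed (rule pullback_coboundary[OF \<phi>])

text \<open>Surjectivity is witnessed by \<open>psi u\<close>: its pullback along
  \<open>phi0\<close> is \<open>u\<close>, and the pullback along \<phi> differs from that by a
  coboundary.\<close>

lemma quotient_comparison_pullback:
  assumes \<phi>: "comparison_map N q A x \<phi>"
  shows "quotient_comparison (bar_ring A B l r) kring bcocycles bcoboundaries kcocycles kcoboundaries (pb \<phi>)"
proof (intro quotient_comparison.intro quotient_comparison_axioms.intro function_ring_bar function_ring_koszul)
  fix u assume u: "u \<in> kcocycles"
  have "(\<lambda>J. pb \<phi> (psi u) J - pb phi0 (psi u) J) \<in> kcoboundaries"
    by (rule pullback_phi0_class[OF \<phi> psi_cocycle[OF u]])
  from function_subgroup_uminus[OF kcoboundaries_subgroup this]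
  have "(\<lambda>J. u J - pb \<phi> (psi u) J) \<in> kcoboundaries"
    using u by (simp add: pullback_psi kcocycles_iff)
  then show "\<exists>f\<in>bcocycles. (\<lambda>J. u J - pb \<phi> f J) \<in> kcoboundaries"
    using psi_cocycle[OF u] by blast
qed (simp_all add: bar_coboundaries_subgroup bar_coboundaries_cocycles kcoboundaries_subgroup
      kcoboundaries_cocycles bar_cocycles_subgroup kcocycles_subgroup pullback_add pullback_diff
      pullback_cocycle[OF \<phi>] pullback_coboundary_iff[OF \<phi>])

lemma induced_map_eq:
  assumes \<phi>: "comparison_map N q A x \<phi>"
  shows "induced_map N q x B l r \<phi> = quotient_comparison.quotient_map kring kcoboundaries (pb \<phi>)"
  using quotient_comparison.quotient_map_def[OF quotient_comparison_pullback[OF \<phi>]]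
  by (intro ext) (simp add: induced_map_def)

theorem induced_map_iso:
  assumes \<phi>: "comparison_map N q A x \<phi>"
  shows "induced_map N q x B l r \<phi>
    \<in> iso (add_monoid (HH A B l r)) (add_monoid (koszul_subquotient N q x B l r))"
  unfolding induced_map_eq[OF \<phi>] HH_def koszul_subquotient_def
  by (rule quotient_comparison.quotient_map_iso[OF quotient_comparison_pullback[OF \<phi>]])

lemma pullback_one: "pb phi0 bar_one = one kring"
proof
  fix J
  show "pb phi0 bar_one J = one kring J"
  proof (cases "J \<subseteq> {1..N} \<and> J \<noteq> {}")
    case True
    then have "card J \<noteq> 0" using finite_subset by fastforce
    then have "lin_ext (smul B) bar_one (phi0 J) = lin_ext (smul B) (\<lambda>_. 0) (phi0 J)"
      using True comparison_map_length[OF comparison_map_phi0, of J]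
      by (intro lin_ext_cong) (simp add: bar_one_def)
    then show ?thesis using True by (simp add: pullback_def lin_ext_def)
  next
    case False
    then show ?thesis
      by (auto simp: pullback_def phi0_def bar_one_def l_unity r_unity)
  qed
qed

context
  assumes descends: "cup_descends A B l r"
begin

interpretation bar: function_ring "bar_ring A B l r" by (rule function_ring_bar)
interpretation koszul: function_ring kring by (rule function_ring_koszul)
interpretation bar_ideal: ideal bcoboundaries "bar_ring A B l r\<lparr>carrier := bcocycles\<rparr>"
  using descends by (simp add: cup_descends_def)

lemma bar_one_in: "bar_one \<in> bcocycles"
  using bar_ideal.one_closed by simp

lemma cup_in: "f \<in> bcocycles \<Longrightarrow> g \<in> bcocycles \<Longrightarrow> cup A B f g \<in> bcocycles"
  using bar_ideal.m_closed[of f g] by simp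

lemma cup_ideal_left: "f \<in> bcocycles \<Longrightarrow> g \<in> bcoboundaries \<Longrightarrow> cup A B f g \<in> bcoboundaries"
  using bar_ideal.I_l_closed[of g f] by simp

lemma cup_ideal_right: "f \<in> bcoboundaries \<Longrightarrow> g \<in> bcocycles \<Longrightarrow> cup A B f g \<in> bcoboundaries"
  using bar_ideal.I_r_closed[of f g] by simp

lemma kone_in: "one kring \<in> kcocycles"
  using pullback_cocycle[OF comparison_map_phi0 bar_one_in] by (simp only: pullback_one)

text \<open>By \<open>pullback_cup\<close> the product is the pullback of a cup product, so closure
  is inherited from the bar side; the ideal properties below follow in the same way.\<close>

lemma kmult_in: "u \<in> kcocycles \<Longrightarrow> v \<in> kcocycles \<Longrightarrow> kmult u v \<in> kcocycles"
  using pullback_cocycle[OF comparison_map_phi0 cup_in[OF psi_cocycle psi_cocycle]]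
  by (simp add: pullback_cup)

lemma kmult_ideal_left: "u \<in> kcocycles \<Longrightarrow> v \<in> kcoboundaries \<Longrightarrow> kmult u v \<in> kcoboundaries"
  using pullback_coboundary[OF comparison_map_phi0 cup_ideal_left[OF psi_cocycle psi_coboundary]]
  by (simp add: pullback_cup)

lemma kmult_ideal_right: "u \<in> kcoboundaries \<Longrightarrow> v \<in> kcocycles \<Longrightarrow> kmult u v \<in> kcoboundaries"
  using pullback_coboundary[OF comparison_map_phi0 cup_ideal_right[OF psi_coboundary psi_cocycle]]
  by (simp add: pullback_cup)

lemma kcocycles_carrier: "u \<in> kcocycles \<Longrightarrow> u \<in> kcarrier"
  by (simp add: kcocycles_iff)

theorem koszul_subring: "subring kcocycles kring"
proof (rule subring.intro)
  show "subgroup kcocycles (add_monoid kring)"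
    by (rule koszul.subgroup_add_monoid)
      (auto simp: kcarrier_subgroup kcocycles_subgroup kcocycles_carrier)
  show "submonoid kcocycles kring"
    by unfold_locales (use kone_in kmult_in kcocycles_carrier in auto)
qed

theorem koszul_ideal: "ideal kcoboundaries (kring\<lparr>carrier := kcocycles\<rparr>)"
proof (rule idealI)
  show "ring (kring\<lparr>carrier := kcocycles\<rparr>)"
  proof (rule function_ring.ringI'[OF koszul.function_ring_carrier])
    show "one (kring\<lparr>carrier := kcocycles\<rparr>) \<in> carrier (kring\<lparr>carrier := kcocycles\<rparr>)"
      using kone_in by simp
    fix u assume "u \<in> carrier (kring\<lparr>carrier := kcocycles\<rparr>)"
    then have u: "u \<in> kcarrier" by (simp add: kcocycles_carrier)
    show "monoid.mult (kring\<lparr>carrier := kcocycles\<rparr>) (one (kring\<lparr>carrier := kcocycles\<rparr>)) u = u"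
      "monoid.mult (kring\<lparr>carrier := kcocycles\<rparr>) u (one (kring\<lparr>carrier := kcocycles\<rparr>)) = u"
      by (simp_all add: kmult_one_left[OF u] kmult_one_right[OF u])
  qed (simp_all add: kcocycles_subgroup kmult_in kmult_assoc fun_eq_iff kmult_add_left kmult_add_right)
  show "subgroup kcoboundaries (add_monoid (kring\<lparr>carrier := kcocycles\<rparr>))"
    by (rule function_ring.subgroup_add_monoid[OF koszul.function_ring_carrier])
      (simp_all add: kcocycles_subgroup kcoboundaries_subgroup kcoboundaries_cocycles)
qed (simp_all add: kmult_ideal_left kmult_ideal_right)

text \<open>Modulo coboundaries each factor may be replaced by its image under \<open>psi\<close>
  after pullback, and for such factors multiplicativity is exact.\<close>

lemma pullback_phi0_cup:
  assumes f: "f \<in> bcocycles" and g: "g \<in> bcocycles"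
  shows "(\<lambda>J. pb phi0 (cup A B f g) J - kmult (pb phi0 f) (pb phi0 g) J) \<in> kcoboundaries"
proof -
  let ?f = "psi (pb phi0 f)" and ?g = "psi (pb phi0 g)"
  have psi: "?f \<in> bcocycles" "?g \<in> bcocycles"
    using psi_cocycle pullback_cocycle[OF comparison_map_phi0] f g by blast+
  have "cup A B (\<lambda>as. f as - ?f as) g \<in> bcoboundaries" "cup A B ?f (\<lambda>as. g as - ?g as) \<in> bcoboundaries"
    using cup_ideal_right[OF psi_pullback_class[OF f] g] cup_ideal_left[OF psi(1) psi_pullback_class[OF g]] .
  from function_subgroup_add[OF bar_coboundaries_subgroup this]
  have "(\<lambda>as. cup A B f g as - cup A B ?f ?g as) \<in> bcoboundaries"
    by (simp add: cup_diff_left cup_diff_right)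
  from pullback_coboundary[OF comparison_map_phi0 this] show ?thesis
    by (simp add: pullback_diff pullback_cup)
qed

theorem induced_map_ring_iso:
  assumes \<phi>: "comparison_map N q A x \<phi>"
  shows "induced_map N q x B l r \<phi> \<in> ring_iso (HH A B l r) (koszul_subquotient N q x B l r)"
  unfolding induced_map_eq[OF \<phi>] HH_def koszul_subquotient_def
proof (rule quotient_comparison.quotient_map_ring_iso[OF quotient_comparison_pullback[OF \<phi>]
      bar_ideal.ideal_axioms koszul_ideal])
  show "one (bar_ring A B l r) \<in> bcocycles"
    using bar_one_in by simp
  show "(\<lambda>J. pb \<phi> (one (bar_ring A B l r)) J - one kring J) \<in> kcoboundaries"
    using pullback_phi0_class[OF \<phi> bar_one_in] by (simp add: pullback_one)
  fix f g assume f: "f \<in> bcocycles" and g: "g \<in> bcocycles"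
  show "monoid.mult (bar_ring A B l r) f g \<in> bcocycles"
    using cup_in[OF f g] by simp
  note sub = kcoboundaries_subgroup
  note pf = pullback_cocycle[OF \<phi> f] and pg = pullback_cocycle[OF comparison_map_phi0 g]
  have kmult_diff: "kmult (\<lambda>J. u J - v J) w = (\<lambda>K. kmult u w K - kmult v w K)"
    "kmult w (\<lambda>J. u J - v J) = (\<lambda>K. kmult w u K - kmult w v K)" for u v w
    using kmult_add_left[of "\<lambda>J. u J - v J" v w] kmult_add_right[of w "\<lambda>J. u J - v J" v]
    by (simp_all add: fun_eq_iff eq_diff_eq)
  have 1: "(\<lambda>J. kmult (pb \<phi> f) (pb \<phi> g) J - kmult (pb \<phi> f) (pb phi0 g) J) \<in> kcoboundaries"
    using kmult_ideal_left[OF pf pullback_phi0_class[OF \<phi> g]] by (simp add: kmult_diff)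
  have 2: "(\<lambda>J. kmult (pb \<phi> f) (pb phi0 g) J - kmult (pb phi0 f) (pb phi0 g) J) \<in> kcoboundaries"
    using kmult_ideal_right[OF pullback_phi0_class[OF \<phi> f] pg] by (simp add: kmult_diff)
  \<comment> \<open>A telescoping sum: pass from \<phi> to \<open>phi0\<close> on the cup product,
    use multiplicativity there, then return to \<phi> one factor at a time.\<close>
  have "(\<lambda>J. pb \<phi> (cup A B f g) J - pb phi0 (cup A B f g) J
      + (pb phi0 (cup A B f g) J - kmult (pb phi0 f) (pb phi0 g) J)
      - (kmult (pb \<phi> f) (pb \<phi> g) J - kmult (pb \<phi> f) (pb phi0 g) J
         + (kmult (pb \<phi> f) (pb phi0 g) J - kmult (pb phi0 f) (pb phi0 g) J))) \<in> kcoboundaries"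
    by (intro function_subgroup_diff[OF sub] function_subgroup_add[OF sub] 1 2
        pullback_phi0_class[OF \<phi> cup_in[OF f g]] pullback_phi0_cup[OF f g])
  then show "(\<lambda>J. pb \<phi> (monoid.mult (bar_ring A B l r) f g) J - monoid.mult kring (pb \<phi> f) (pb \<phi> g) J) \<in> kcoboundaries"
    by simp
qed

end

end

text \<open>\<open>bimodule_algebra\<close> alone does not make the cup product well defined on
  cohomology, so the multiplicative claims carry \<open>cup_descends\<close>. As \<open>HH\<close>
  is encoded as a ring, compatibility with scalars is expressed on representatives.\<close>

theorem theorem3p1:
  fixes N :: nat
    and q :: "nat \<Rightarrow> nat \<Rightarrow> 'k::field_char_0"
    and A :: "('k, 'a::ab_group_add) alg"
    and x :: "nat \<Rightarrow> 'a"
    and B :: "('k, 'b::ab_group_add) alg"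
    and l :: "'a \<Rightarrow> 'b \<Rightarrow> 'b"
    and r :: "'b \<Rightarrow> 'a \<Rightarrow> 'b"
  assumes "N \<ge> 1"
    and "quantum_parameters N q"
    and "quantum_symmetric_algebra N q A x"
    and "bimodule_algebra A B l r"
  shows
    "(\<exists>\<phi>. comparison_map N q A x \<phi>) \<and>
     (\<forall>\<phi>. comparison_map N q A x \<phi> \<longrightarrow>
       induced_map N q x B l r \<phi>
         \<in> iso (add_monoid (HH A B l r)) (add_monoid (koszul_subquotient N q x B l r)) \<and>
       (\<forall>c. \<forall>f\<in>bar_cocycles A B l r.
          (\<lambda>as. smul B c (f as)) \<in> bar_cocycles A B l r \<and>
          pullback N B \<phi> (\<lambda>as. smul B c (f as)) = (\<lambda>J. smul B c (pullback N B \<phi> f J)))) \<and>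
     (balanced B l r \<longrightarrow> cup_descends A B l r) \<and>
     (cup_descends A B l r \<longrightarrow>
       subring (koszul_cocycles N q x B l r) (tensor_ext N (\<lambda>i j. inverse (q i j)) B) \<and>
       (\<forall>c. \<forall>u\<in>koszul_cocycles N q x B l r. (\<lambda>J. smul B c (u J)) \<in> koszul_cocycles N q x B l r) \<and>
       ideal (koszul_coboundaries N q x B l r)
         (tensor_ext N (\<lambda>i j. inverse (q i j)) B\<lparr>carrier := koszul_cocycles N q x B l r\<rparr>) \<and>
       (\<forall>\<phi>. comparison_map N q A x \<phi> \<longrightarrow>
          induced_map N q x B l r \<phi> \<in> ring_iso (HH A B l r) (koszul_subquotient N q x B l r)))"
proof -
  interpret quantum_bimodule N q A x B l r
    using assms by (simp add: quantum_bimodule_def quantum_symmetric_def)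
  show ?thesis
    using comparison_map_phi0 induced_map_iso bar_cocycle_smul pullback_smul balanced_cup_descends
      koszul_subring kcocycle_smul koszul_ideal induced_map_ring_iso
    by blast
qed

end
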